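(* Let $k$ be a field and let $\{\Phi_1,\Phi_2\}$ and $\{\Lambda_1,\Lambda_2\}$ be pairs of alternating $k$-forms, all of whose orthogonally indecomposable summands are sloped, each pair written relative to any fully refined orthogonal decomposition, so for $i=1,2$, $$\Phi_i=\mathrm{diag}\left(\Phi_i^{(1)},\ldots,\Phi_i^{(s)}\right),\qquad \Lambda_i=\mathrm{diag}\left(\Lambda_i^{(1)},\ldots,\Lambda_i^{(t)}\right).$$ For $\hat\alpha\in\Gamma\mathrm{L}(2,k)$, there is a pseudo-isometry $(\alpha,\hat\alpha)$ from $\{\Phi_1,\Phi_2\}$ to $\{\Lambda_1,\Lambda_2\}$ if, and only if, $s=t$ and there is a permutation $\sigma$ of $\{1,\ldots,s\}$ such that for all $i$, $$\mathrm{Pf}\left(\Phi_1^{(i)},\Phi_2^{(i)}\right)^{\hat\alpha}\equiv \mathrm{Pf}\left(\Lambda_1^{(i\sigma)},\Lambda_2^{(i\sigma)}\right)\pmod{k^\times}.$$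
   Context: A pair $\{\Phi_1,\Phi_2\}$ of alternating $d\times d$ matrices over $k$ represents the alternating $k$-bimap $\circ\colon k^d\times k^d\to k^2$, $u\circ v=(u\Phi_1v^{\mathrm{tr}},u\Phi_2v^{\mathrm{tr}})$. An orthogonal decomposition of $V=k^d$ is a direct sum decomposition $V=V_1\oplus\cdots\oplus V_s$ into nonzero subspaces with $V_i\circ V_j=0$ for $i\neq j$; it is fully refined if no $V_i$ (with restricted bimap) admits a proper orthogonal decomposition. Relative to a basis adapted to it the forms are block diagonal as displayed. An indecomposable summand is sloped if, after a change of basis of $k^2$, it is represented by a pair whose first form is invertible (equivalently some $k$-linear combination of its two forms is invertible). Let $\circ,\bullet$ be the bimaps represented by $\{\Phi_1,\Phi_2\}$ and $\{\Lambda_1,\Lambda_2\}$. A pseudo-isometry from the first pair to the second is a pair $(\alpha,\hat\alpha)$ of $k$-semilinear bijections, $\alpha$ between the underlying vector spaces and $\hat\alpha\in\Gamma\mathrm{L}(2,k)$, such that $u\alpha\bullet v\alpha=(u\circ v)\hat\alpha$ for all $u,v$. For square matrices $\Psi_1,\Psi_2$ of equal size let $\mathrm{disc}(\Psi_1,\Psi_2)=\det(x\Psi_1+y\Psi_2)\in k[x,y]$, considered up to nonzero scalar multiples. For a sloped pair $\{\Phi_1,\Phi_2\}$ there is a basis, adapted to a decomposition into two subspaces of equal dimension that are totally isotropic for both forms, relative to which $\Phi_i=\begin{bmatrix}0&\Psi_i\\-\Psi_i^{\mathrm{tr}}&0\end{bmatrix}$ $(i=1,2)$; the generalized Pfaffian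 is $\mathrm{Pf}(\Phi_1,\Phi_2)=\mathrm{disc}(\Psi_1,\Psi_2)$, defined up to $k^\times$. $\Gamma\mathrm{L}(2,k)=\mathrm{GL}(2,k)\rtimes\mathrm{Gal}(k)$ acts on homogeneous polynomials $f\in k[x,y]$ by $f^{\hat\alpha}(x,y)=f^\tau(ax+by,cx+dy)$ for $\hat\alpha=\left(\begin{bmatrix}a&b\\c&d\end{bmatrix},\tau\right)$, where $f^\tau$ is $f$ with $\tau$ applied to its coefficients; correspondingly $\hat\alpha$ acts on row vectors $w\in k^2$ by $w\mapsto w^\tau\begin{bmatrix}a&b\\c&d\end{bmatrix}$. The relation $f\equiv g\pmod{k^\times}$ means $f=\lambda g$ for some $\lambda\in k^\times$. *)

theory Defs
  imports
    "Jordan_Normal_Form.VS_Connect"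
    "Jordan_Normal_Form.Determinant"
    "HOL-Combinatorics.Permutations"
begin

section \<open>Pairs of alternating forms and their bimaps\<close>

definition alternating_mat :: "nat \<Rightarrow> 'a :: field mat \<Rightarrow> bool" where
  "alternating_mat d A \<longleftrightarrow>
     A \<in> carrier_mat d d \<and> transpose_mat A = - A \<and> (\<forall>i<d. A $$ (i, i) = 0)"

definition alternating_pair :: "nat \<Rightarrow> 'a :: field mat \<times> 'a mat \<Rightarrow> bool" where
  "alternating_pair d \<Phi> \<longleftrightarrow> alternating_mat d (fst \<Phi>) \<and> alternating_mat d (snd \<Phi>)"

definition bimap :: "'a :: field mat \<times> 'a mat \<Rightarrow> 'a vec \<Rightarrow> 'a vec \<Rightarrow> 'a vec" where
  "bimap \<Phi> u v = vec_of_list [u \<bullet> (fst \<Phi> *\<^sub>v v), u \<bullet> (snd \<Phi> *\<^sub>v v)]"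


section \<open>Orthogonal decompositions\<close>

text \<open>An orthogonal decomposition of a subspace \<open>U\<close> of \<open>k\<^sup>d\<close> for the restriction of the bimap
  to \<open>U\<close>. The last two conjuncts say that \<open>U\<close> is the internal direct sum of the listed subspaces.\<close>

definition orth_decomp ::
  "nat \<Rightarrow> 'a :: field mat \<times> 'a mat \<Rightarrow> 'a vec set \<Rightarrow> 'a vec set list \<Rightarrow> bool" where
  "orth_decomp d \<Phi> U Vs \<longleftrightarrow>
     (\<forall>V\<in>set Vs. VectorSpace.subspace class_ring V (module_vec TYPE('a) d)
                 \<and> V \<noteq> {0\<^sub>v d} \<and> V \<subseteq> U) \<and>
     (\<forall>i<length Vs. \<forall>j<length Vs. i \<noteq> j \<longrightarrow>
        (\<forall>u\<in>Vs ! i. \<forall>v\<in>Vs ! j. bimap \<Phi> u v = 0\<^sub>v 2)) \<and>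
     (\<forall>vs. list_all2 (\<in>) vs Vs \<longrightarrow> foldr (+) vs (0\<^sub>v d) \<in> U) \<and>
     (\<forall>u\<in>U. \<exists>!vs. list_all2 (\<in>) vs Vs \<and> foldr (+) vs (0\<^sub>v d) = u)"

definition fully_refined ::
  "nat \<Rightarrow> 'a :: field mat \<times> 'a mat \<Rightarrow> 'a vec set list \<Rightarrow> bool" where
  "fully_refined d \<Phi> Vs \<longleftrightarrow>
     orth_decomp d \<Phi> (carrier_vec d) Vs \<and>
     (\<forall>V\<in>set Vs. \<not> (\<exists>Ws. orth_decomp d \<Phi> V Ws \<and> length Ws \<ge> 2))"

text \<open>Given pairs \<open>Bs\<close> of blocks, the coordinate subspace spanned by the standard basis vectors
  belonging to block \<open>i\<close>.\<close>

definition block_start :: "('a mat \<times> 'a mat) list \<Rightarrow> nat \<Rightarrow> nat" where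
  "block_start Bs i = (\<Sum>B\<leftarrow>take i Bs. dim_row (fst B))"

definition block_space :: "nat \<Rightarrow> ('a :: field mat \<times> 'a mat) list \<Rightarrow> nat \<Rightarrow> 'a vec set" where
  "block_space d Bs i =
     {v \<in> carrier_vec d. \<forall>j<d. j < block_start Bs i \<or> block_start Bs (Suc i) \<le> j \<longrightarrow> v $ j = 0}"

text \<open>The pair \<open>\<Phi>\<close> on \<open>k\<^sup>d\<close> is block diagonal with pairs of blocks \<open>Bs\<close>, and the coordinate
  subspaces of the blocks form a fully refined orthogonal decomposition of \<open>k\<^sup>d\<close>. The pair \<open>Bs ! i\<close>
  then represents the restriction of the bimap to the \<open>i\<close>-th summand.\<close>

definition fully_refined_blocks ::
  "nat \<Rightarrow> 'a :: field mat \<times> 'a mat \<Rightarrow> ('a mat \<times> 'a mat) list \<Rightarrow> bool" where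
  "fully_refined_blocks d \<Phi> Bs \<longleftrightarrow>
     (\<forall>B\<in>set Bs. \<exists>n. fst B \<in> carrier_mat n n \<and> snd B \<in> carrier_mat n n) \<and>
     fst \<Phi> = diag_block_mat (map fst Bs) \<and> snd \<Phi> = diag_block_mat (map snd Bs) \<and>
     fully_refined d \<Phi> (map (block_space d Bs) [0..<length Bs])"

text \<open>If \<open>w \<mapsto> w g\<close> is the change of basis on row vectors of \<open>k\<^sup>2\<close>, the new first form is
  \<open>g\<^sub>0\<^sub>0 \<Phi>\<^sub>1 + g\<^sub>1\<^sub>0 \<Phi>\<^sub>2\<close>, and similarly for the second.\<close>

definition change_basis :: "'a :: field mat \<Rightarrow> 'a mat \<times> 'a mat \<Rightarrow> 'a mat \<times> 'a mat" where
  "change_basis g \<Phi> =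
     (g $$ (0,0) \<cdot>\<^sub>m fst \<Phi> + g $$ (1,0) \<cdot>\<^sub>m snd \<Phi>,
      g $$ (0,1) \<cdot>\<^sub>m fst \<Phi> + g $$ (1,1) \<cdot>\<^sub>m snd \<Phi>)"

definition sloped :: "'a :: field mat \<times> 'a mat \<Rightarrow> bool" where
  "sloped \<Phi> \<longleftrightarrow>
     (\<exists>g\<in>carrier_mat 2 2. invertible_mat g \<and> invertible_mat (fst (change_basis g \<Phi>)))"


section \<open>Pseudo-isometries\<close>

text \<open>Elements of \<open>\<Gamma>L(2,k)\<close> are pairs of an invertible matrix and a field automorphism.\<close>

definition GammaL2 :: "('a :: field mat \<times> ('a \<Rightarrow> 'a)) set" where
  "GammaL2 = {(M, \<tau>). M \<in> carrier_mat 2 2 \<and> invertible_mat M \<and> field_isom \<tau>}"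

text \<open>The action \<open>w \<mapsto> w\<^sup>\<tau> M\<close> on row vectors.\<close>

definition act_vec :: "'a :: field mat \<times> ('a \<Rightarrow> 'a) \<Rightarrow> 'a vec \<Rightarrow> 'a vec" where
  "act_vec h w = transpose_mat (fst h) *\<^sub>v map_vec (snd h) w"

definition semilinear_bij :: "nat \<Rightarrow> nat \<Rightarrow> ('a :: field vec \<Rightarrow> 'a vec) \<Rightarrow> bool" where
  "semilinear_bij d e \<alpha> \<longleftrightarrow>
     bij_betw \<alpha> (carrier_vec d) (carrier_vec e) \<and>
     (\<forall>u\<in>carrier_vec d. \<forall>v\<in>carrier_vec d. \<alpha> (u + v) = \<alpha> u + \<alpha> v) \<and>
     (\<exists>\<tau>. field_isom \<tau> \<and> (\<forall>c. \<forall>u\<in>carrier_vec d. \<alpha> (c \<cdot>\<^sub>v u) = \<tau> c \<cdot>\<^sub>v \<alpha> u))"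

definition pseudo_isometry ::
  "nat \<Rightarrow> 'a :: field mat \<times> 'a mat \<Rightarrow> nat \<Rightarrow> 'a mat \<times> 'a mat \<Rightarrow>
   ('a vec \<Rightarrow> 'a vec) \<Rightarrow> 'a mat \<times> ('a \<Rightarrow> 'a) \<Rightarrow> bool" where
  "pseudo_isometry d \<Phi> e \<Lambda> \<alpha> h \<longleftrightarrow>
     semilinear_bij d e \<alpha> \<and> h \<in> GammaL2 \<and>
     (\<forall>u\<in>carrier_vec d. \<forall>v\<in>carrier_vec d. bimap \<Lambda> (\<alpha> u) (\<alpha> v) = act_vec h (bimap \<Phi> u v))"


section \<open>Generalized Pfaffians\<close>

text \<open>The ring \<open>k[x,y]\<close> is modelled as \<open>k[x][y]\<close>.\<close>

abbreviation const_xy :: "'a :: comm_ring_1 \<Rightarrow> 'a poly poly" where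
  "const_xy c \<equiv> [:[:c:]:]"

abbreviation var_x :: "'a :: comm_ring_1 poly poly" where
  "var_x \<equiv> [:[:0, 1:]:]"

abbreviation var_y :: "'a :: comm_ring_1 poly poly" where
  "var_y \<equiv> [:0, 1:]"

definition eval_xy :: "'a :: comm_ring_1 poly poly \<Rightarrow> 'a poly poly \<Rightarrow> 'a poly poly \<Rightarrow> 'a poly poly"
  where \<comment> \<open>\<open>f(X, Y)\<close>\<close>
  "eval_xy f X Y = poly (map_poly (\<lambda>p. poly (map_poly const_xy p) X) f) Y"

definition act_poly :: "'a :: field mat \<times> ('a \<Rightarrow> 'a) \<Rightarrow> 'a poly poly \<Rightarrow> 'a poly poly" where
  "act_poly h f =
     (let M = fst h; \<tau> = snd h in
      eval_xy (map_poly (map_poly \<tau>) f)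
        (const_xy (M $$ (0,0)) * var_x + const_xy (M $$ (0,1)) * var_y)
        (const_xy (M $$ (1,0)) * var_x + const_xy (M $$ (1,1)) * var_y))"

definition equiv_units :: "'a :: field poly poly \<Rightarrow> 'a poly poly \<Rightarrow> bool" where
  "equiv_units f g \<longleftrightarrow> (\<exists>c. c \<noteq> 0 \<and> f = const_xy c * g)"

definition pencil :: "'a :: field mat \<times> 'a mat \<Rightarrow> 'a poly poly mat" where
  "pencil \<Psi> = var_x \<cdot>\<^sub>m map_mat const_xy (fst \<Psi>) + var_y \<cdot>\<^sub>m map_mat const_xy (snd \<Psi>)"

definition disc :: "'a :: field mat \<times> 'a mat \<Rightarrow> 'a poly poly" where
  "disc \<Psi> = det (pencil \<Psi>)"

definition hyperbolic :: "nat \<Rightarrow> 'a :: field mat \<Rightarrow> 'a mat" where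
  "hyperbolic n \<Psi> = four_block_mat (0\<^sub>m n n) \<Psi> (- transpose_mat \<Psi>) (0\<^sub>m n n)"

text \<open>\<open>is_Pf \<Phi> f\<close>: for some choice of adapted basis (the rows of \<open>P\<close>), \<open>f\<close> is the
  discriminant of the resulting off-diagonal blocks.\<close>

definition is_Pf :: "'a :: field mat \<times> 'a mat \<Rightarrow> 'a poly poly \<Rightarrow> bool" where
  "is_Pf \<Phi> f \<longleftrightarrow>
     (\<exists>n P \<Psi>\<^sub>1 \<Psi>\<^sub>2.
        fst \<Phi> \<in> carrier_mat (n + n) (n + n) \<and> snd \<Phi> \<in> carrier_mat (n + n) (n + n) \<and>
        P \<in> carrier_mat (n + n) (n + n) \<and> invertible_mat P \<and>
        \<Psi>\<^sub>1 \<in> carrier_mat n n \<and> \<Psi>\<^sub>2 \<in> carrier_mat n n \<and>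
        P * fst \<Phi> * transpose_mat P = hyperbolic n \<Psi>\<^sub>1 \<and>
        P * snd \<Phi> * transpose_mat P = hyperbolic n \<Psi>\<^sub>2 \<and>
        f = disc (\<Psi>\<^sub>1, \<Psi>\<^sub>2))"

text \<open>A representative of the class of the generalized Pfaffian modulo nonzero scalars; by
  \<open>is_Pf_unique\<close> below the class does not depend on the choice.\<close>

definition Pf :: "'a :: field mat \<times> 'a mat \<Rightarrow> 'a poly poly" where
  "Pf \<Phi> = (SOME f. is_Pf \<Phi> f)"

lemma comm_ring_hom_const_xy: "comm_ring_hom (const_xy :: 'a :: comm_ring_1 \<Rightarrow> 'a poly poly)"
  by unfold_locales (auto simp: one_pCons)

lemma pencil_carrier:
  "A \<in> carrier_mat n m \<Longrightarrow> B \<in> carrier_mat n m \<Longrightarrow> pencil (A, B) \<in> carrier_mat n m"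
  by (auto simp: pencil_def)

lemma det_pencil_hyperbolic:
  fixes A B :: "'a :: field mat"
  assumes A: "A \<in> carrier_mat n n" and B: "B \<in> carrier_mat n n"
  shows "det (pencil (hyperbolic n A, hyperbolic n B)) = (disc (A, B))\<^sup>2"
proof -
  let ?D = "pencil (A, B)"
  have D: "?D \<in> carrier_mat n n" by (rule pencil_carrier[OF A B])
  have eq: "pencil (hyperbolic n A, hyperbolic n B)
      = four_block_mat (0\<^sub>m n n) ?D (- transpose_mat ?D) (0\<^sub>m n n)"
    by (rule eq_matI) (use A B in \<open>auto simp: pencil_def hyperbolic_def\<close>)
  have "0\<^sub>m n n * 0\<^sub>m n n - ?D * (- transpose_mat ?D) = ?D * transpose_mat ?D"
    using D by auto
  then have "det (pencil (hyperbolic n A, hyperbolic n B)) = det (?D * transpose_mat ?D)"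
    unfolding eq using D by (subst det_four_block_mat[of _ n]) auto
  also have "\<dots> = (disc (A, B))\<^sup>2"
    using D by (simp add: det_mult[of _ n] det_transpose[of _ n] disc_def power2_eq_square)
  finally show ?thesis .
qed

lemma det_pencil_congruence:
  fixes P :: "'a :: field mat"
  assumes P: "P \<in> carrier_mat n n" and A: "A \<in> carrier_mat n n" and B: "B \<in> carrier_mat n n"
  shows "det (pencil (P * A * transpose_mat P, P * B * transpose_mat P))
       = const_xy ((det P)\<^sup>2) * det (pencil (A, B))"
proof -
  interpret h: comm_ring_hom "const_xy :: 'a \<Rightarrow> 'a poly poly" by (rule comm_ring_hom_const_xy)
  let ?c = "map_mat const_xy :: 'a mat \<Rightarrow> 'a poly poly mat"
  have PT: "transpose_mat P \<in> carrier_mat n n" using P by simp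
  have cP: "?c P \<in> carrier_mat n n" "?c (transpose_mat P) \<in> carrier_mat n n"
    "?c A \<in> carrier_mat n n" "?c B \<in> carrier_mat n n"
    using P A B by auto
  have hom: "?c (P * C * transpose_mat P) = ?c P * ?c C * ?c (transpose_mat P)"
    if "C \<in> carrier_mat n n" for C
    using that P PT by (simp add: h.mat_hom_mult[of _ n n _ n])
  have "pencil (P * A * transpose_mat P, P * B * transpose_mat P)
      = ?c P * pencil (A, B) * ?c (transpose_mat P)"
    unfolding pencil_def fst_conv snd_conv hom[OF A] hom[OF B]
    using cP by (simp add: mult_add_distrib_mat[of _ n n _ n] add_mult_distrib_mat[of _ n n _ _ n]
        mult_smult_distrib[of _ n n _ n] mult_smult_assoc_mat[of _ n n _ n])
  then have "det (pencil (P * A * transpose_mat P, P * B * transpose_mat P))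
      = det (?c P) * det (pencil (A, B)) * det (?c (transpose_mat P))"
    using cP pencil_carrier[OF A B] by (simp add: det_mult[of _ n])
  also have "det (?c P) = const_xy (det P)" by (simp add: h.hom_det)
  also have "det (?c (transpose_mat P)) = const_xy (det P)"
    using P by (simp add: h.hom_det det_transpose[of _ n])
  finally show ?thesis by (simp add: power2_eq_square mult_ac)
qed

lemma is_Pf_unique:
  fixes \<Phi> :: "'a :: field mat \<times> 'a mat"
  assumes "is_Pf \<Phi> f" and "is_Pf \<Phi> g"
  shows "equiv_units f g"
proof -
  have sq: "\<exists>c. c \<noteq> 0 \<and> f\<^sup>2 = const_xy (c\<^sup>2) * det (pencil \<Phi>)" if f: "is_Pf \<Phi> f" for f
  proof -
    obtain n P \<Psi>\<^sub>1 \<Psi>\<^sub>2 where *: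
      "fst \<Phi> \<in> carrier_mat (n + n) (n + n)" "snd \<Phi> \<in> carrier_mat (n + n) (n + n)"
      "P \<in> carrier_mat (n + n) (n + n)" "invertible_mat P"
      "\<Psi>\<^sub>1 \<in> carrier_mat n n" "\<Psi>\<^sub>2 \<in> carrier_mat n n"
      "P * fst \<Phi> * transpose_mat P = hyperbolic n \<Psi>\<^sub>1"
      "P * snd \<Phi> * transpose_mat P = hyperbolic n \<Psi>\<^sub>2"
      "f = disc (\<Psi>\<^sub>1, \<Psi>\<^sub>2)"
      using f unfolding is_Pf_def by blast
    obtain Q where Q: "inverts_mat P Q" "inverts_mat Q P"
      using *(4) unfolding invertible_mat_def by blast
    have "P * Q = 1\<^sub>m (n + n)" and QP: "Q * P = 1\<^sub>m (dim_row Q)"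
      using Q *(3) by (auto simp: inverts_mat_def)
    moreover have "dim_col Q = n + n"
      using arg_cong[OF \<open>P * Q = 1\<^sub>m (n + n)\<close>, of dim_col] by simp
    moreover have "dim_row Q = n + n"
      using arg_cong[OF QP, of dim_col] *(3) by simp
    ultimately have "det P * det Q = 1"
      using det_mult[OF *(3), of Q] by auto
    then have "det P \<noteq> 0" by auto
    moreover have "f\<^sup>2 = const_xy ((det P)\<^sup>2) * det (pencil \<Phi>)"
      using det_pencil_hyperbolic[OF *(5,6)] det_pencil_congruence[OF *(3,1,2)] *(7-9) by simp
    ultimately show ?thesis by blast
  qed
  obtain a b where ab: "a \<noteq> 0" "b \<noteq> 0"
    and f: "f\<^sup>2 = const_xy (a\<^sup>2) * det (pencil \<Phi>)" and g: "g\<^sup>2 = const_xy (b\<^sup>2) * det (pencil \<Phi>)"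
    using sq[OF assms(1)] sq[OF assms(2)] by blast
  have "f\<^sup>2 = (const_xy (a / b) * g)\<^sup>2"
    unfolding power_mult_distrib f g using ab by (simp add: power2_eq_square)
  then have "f = const_xy (a / b) * g \<or> f = const_xy (- (a / b)) * g"
    unfolding power2_eq_iff by (metis minus_pCons minus_zero mult_minus_left)
  then show ?thesis
    unfolding equiv_units_def using ab by (metis divide_eq_0_iff neg_equal_0_iff_equal)
qed

end

theory Submission
  imports
    Defs
    "Jordan_Normal_Form.Char_Poly"
    "HOL-Computational_Algebra.Polynomial_Factorial"
begin

text \<open>A sloped indecomposable pair becomes, after a change of basis of \<open>k\<^sup>2\<close>, a nondegenerate form
  \<open>A\<close> together with the form \<open>(u, v) \<mapsto> - A (S u, v)\<close> for an \<open>A\<close>-self-adjoint \<open>S\<close>. Cyclic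
  \<open>k[S]\<close>-submodules are totally isotropic, polynomials in \<open>S\<close> are self-adjoint, and indecomposability
  forces the minimal polynomial of \<open>S\<close> to be a power \<open>p\<^sup>e\<close> and the space to be a hyperbolic sum of
  two cyclic modules \<open>k[t]/(p\<^sup>e)\<close>. Thus the pair is determined up to isometry by its Pfaffian, which
  is the homogenization of \<open>p\<^sup>e\<close> in suitable coordinates. Twisting the first pair by the given
  element of \<open>\<Gamma>L(2,k)\<close>, this constructs a pseudo-isometry summand by summand.

  For the other direction the multiset of Pfaffian classes has to be recovered from the whole pair.
  For a prime form \<open>P\<close> of \<open>k[x,y]\<close> the pencil \<open>x \<Phi>\<^sub>1 + y \<Phi>\<^sub>2\<close> can be diagonalised by matrices whose
  determinants are prime to \<open>P\<close>, even though no single change of basis need make all summands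
  nondegenerate over a small field. The number of diagonal entries divisible by \<open>P\<^sup>e\<close> is independent
  of the diagonalisation, and it is twice the number of summands whose Pfaffian is divisible by
  \<open>P\<^sup>e\<close>.\<close>

text \<open>The sign in \<open>S = - (A' * B)\<close> gives \<open>x A + y B = A (x - y S)\<close>,
  so the pencil leads to homogenised polynomials of \<open>S\<close>. Characteristic 2 shapes the
  form arguments: skew symmetry alone does not give isotropy, so vanishing diagonals have to be
  carried along. The localisation at a prime \<open>P\<close> is a discrete valuation ring, and
  transformation matrices with determinant prime to \<open>P\<close> imitate it inside k[x,y]. The
  factor two arises because a hyperbolic pencil with block \<open>M\<close> is equivalent to
  \<open>M\<close> beside its transpose. Comparing the counts for \<open>P^e\<close> and
  \<open>P^(e+1)\<close> isolates the summands with Pfaffian \<open>P^e\<close>, as every Pfaffian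
  is a prime power up to a scalar. In the converse direction equal Pfaffian classes act twice: one
  change of basis then serves both summands, and in those coordinates the companion matrices
  coincide. The automorphism belonging to \<alpha> is a priori unrelated to that of
  \<open>h\<close>; a nonzero value of the bimap forces them to agree.\<close>

lemma smult_smult_mat: "a \<cdot>\<^sub>m (b \<cdot>\<^sub>m A) = (a * b :: 'a :: semigroup_mult) \<cdot>\<^sub>m A"
  by (rule eq_matI) (auto simp: mult.assoc)

section \<open>Inverses, determinants and kernels of matrices over a field\<close>

lemma invertible_matE:
  assumes "A \<in> carrier_mat n n" and "invertible_mat A"
  obtains B where "B \<in> carrier_mat n n" and "A * B = 1\<^sub>m n" and "B * A = 1\<^sub>m n"
proof -
  obtain B where B: "inverts_mat A B" "inverts_mat B A"
    using assms(2) unfolding invertible_mat_def by blast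
  have AB: "A * B = 1\<^sub>m n" and BA: "B * A = 1\<^sub>m (dim_row B)"
    using B assms(1) by (auto simp: inverts_mat_def)
  have "dim_col B = n" using arg_cong[OF AB, of dim_col] by simp
  moreover have "dim_row B = n" using arg_cong[OF BA, of dim_col] assms(1) by simp
  ultimately show thesis using that[of B] AB BA by auto
qed

lemma invertible_matI:
  assumes "A \<in> carrier_mat n n" and "B \<in> carrier_mat n n" and "A * B = 1\<^sub>m n" and "B * A = 1\<^sub>m n"
  shows "invertible_mat A"
  using assms unfolding invertible_mat_def inverts_mat_def by auto

lemma invertible_mat_right_inverseI:
  fixes A :: "'a :: field mat"
  assumes "A \<in> carrier_mat n n" and "B \<in> carrier_mat n n" and "A * B = 1\<^sub>m n"
  shows "invertible_mat A"
  by (rule invertible_matI[OF assms]) (rule mat_mult_left_right_inverse[OF assms])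

lemma invertible_mat_iff_det:
  fixes A :: "'a :: field mat"
  assumes A: "A \<in> carrier_mat n n"
  shows "invertible_mat A \<longleftrightarrow> det A \<noteq> 0"
proof
  assume "invertible_mat A"
  then obtain B where B: "B \<in> carrier_mat n n" and AB: "A * B = 1\<^sub>m n" by (rule invertible_matE[OF A])
  have "det A * det B = 1" using det_mult[OF A B] AB by simp
  then show "det A \<noteq> 0" by auto
next
  assume d: "det A \<noteq> 0"
  show "invertible_mat A"
  proof (rule invertible_mat_right_inverseI[OF A])
    show "(1 / det A) \<cdot>\<^sub>m adj_mat A \<in> carrier_mat n n" using adj_mat(1)[OF A] by simp
    have "A * ((1 / det A) \<cdot>\<^sub>m adj_mat A) = (1 / det A) \<cdot>\<^sub>m (A * adj_mat A)"
      using A adj_mat(1)[OF A] by (simp add: mult_smult_distrib)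
    also have "\<dots> = 1\<^sub>m n" unfolding adj_mat(2)[OF A] using d by (auto simp: smult_smult_mat)
    finally show "A * ((1 / det A) \<cdot>\<^sub>m adj_mat A) = 1\<^sub>m n" .
  qed
qed

lemma invertible_mat_mult:
  fixes A B :: "'a :: field mat"
  assumes "A \<in> carrier_mat n n" and "B \<in> carrier_mat n n"
    and "invertible_mat A" and "invertible_mat B"
  shows "invertible_mat (A * B)"
  using assms by (simp add: invertible_mat_iff_det[of _ n] det_mult[of _ n])

lemma invertible_mat_transpose:
  fixes A :: "'a :: field mat"
  assumes "A \<in> carrier_mat n n" and "invertible_mat A"
  shows "invertible_mat (transpose_mat A)"
  using assms by (simp add: invertible_mat_iff_det[of _ n] det_transpose[of _ n])

text \<open>Padding with zero rows gives a square matrix. Its determinant vanishes, because every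
  permutation product takes a factor from the zero row \<open>n\<close>, and a kernel vector of the
  padded matrix is one of \<open>A\<close>.\<close>

lemma wide_mat_kernel:
  fixes A :: "'a :: field mat"
  assumes A: "A \<in> carrier_mat n m" and nm: "n < m"
  obtains v where "v \<in> carrier_vec m" and "v \<noteq> 0\<^sub>v m" and "A *\<^sub>v v = 0\<^sub>v n"
proof -
  define B where "B = mat m m (\<lambda>(i, j). if i < n then A $$ (i, j) else 0)"
  have B: "B \<in> carrier_mat m m" by (simp add: B_def)
  have "det B = 0"
    unfolding det_def'[OF B]
  proof (rule sum.neutral, rule ballI)
    fix p assume "p \<in> {p. p permutes {0..<m}}"
    then have "p n < m" using nm permutes_in_image[of p "{0..<m}" n] by auto
    then have "B $$ (n, p n) = 0" using nm by (simp add: B_def)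
    then have "(\<Prod>i = 0..<m. B $$ (i, p i)) = 0" using nm by (intro prod_zero) auto
    then show "of_int (sign p) * (\<Prod>i = 0..<m. B $$ (i, p i)) = 0" by simp
  qed
  then obtain v where v: "v \<in> carrier_vec m" "v \<noteq> 0\<^sub>v m" "B *\<^sub>v v = 0\<^sub>v m"
    using det_0_iff_vec_prod_zero_field[OF B] by blast
  have "A *\<^sub>v v = 0\<^sub>v n"
  proof (rule eq_vecI)
    fix i assume "i < dim_vec (0\<^sub>v n :: 'a vec)"
    then have i: "i < n" by simp
    have "row A i = row B i" using A i nm by (auto simp: B_def row_def)
    then show "(A *\<^sub>v v) $ i = 0\<^sub>v n $ i"
      using arg_cong[OF v(3), of "\<lambda>w. w $ i"] A B i nm by simp
  qed (use A in auto)
  with v show thesis using that by blast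
qed

lemma right_inverse_dim_le:
  fixes A B :: "'a :: field mat"
  assumes A: "A \<in> carrier_mat m n" and B: "B \<in> carrier_mat n m" and AB: "A * B = 1\<^sub>m m"
  shows "m \<le> n"
proof (rule ccontr)
  assume "\<not> m \<le> n"
  then obtain v where v: "v \<in> carrier_vec m" "v \<noteq> 0\<^sub>v m" "B *\<^sub>v v = 0\<^sub>v n"
    using wide_mat_kernel[OF B] by auto
  have "v = A *\<^sub>v (B *\<^sub>v v)" using AB A B v(1) by (simp add: assoc_mult_mat_vec[symmetric])
  also have "\<dots> = 0\<^sub>v m" unfolding v(3) using A by auto
  finally show False using v(2) by simp
qed

section \<open>Diagonalisation away from a prime\<close>

text \<open>For prime \<open>p\<close> this is diagonalisation over the localisation at
  \<open>p\<close> with denominators cleared: a matrix becomes invertible there exactly when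
  \<open>p\<close> does not divide its determinant. The entries \<open>ds\<close> are not ordered by
  divisibility; only their \<open>p\<close>-adic valuations will be compared.\<close>

definition loc_diag :: "'b :: {idom_divide, algebraic_semidom} \<Rightarrow> 'b mat \<Rightarrow> 'b list \<Rightarrow> bool" where
  "loc_diag p A ds \<longleftrightarrow> A \<in> carrier_mat (length ds) (length ds) \<and>
     (\<exists>P\<in>carrier_mat (length ds) (length ds). \<exists>Q\<in>carrier_mat (length ds) (length ds).
        \<not> p dvd det P \<and> \<not> p dvd det Q \<and> P * A * Q = mat_diag (length ds) (\<lambda>i. ds ! i))"

lemma loc_diagI:
  assumes "length ds = n" "A \<in> carrier_mat n n" "P \<in> carrier_mat n n" "Q \<in> carrier_mat n n"
    "\<not> p dvd det P" "\<not> p dvd det Q" "P * A * Q = mat_diag n (\<lambda>i. ds ! i)"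
  shows "loc_diag p A ds"
  using assms unfolding loc_diag_def by blast

lemma loc_diagE:
  assumes "loc_diag p A ds"
  obtains n P Q where "length ds = n" "A \<in> carrier_mat n n" "P \<in> carrier_mat n n"
    "Q \<in> carrier_mat n n" "\<not> p dvd det P" "\<not> p dvd det Q" "P * A * Q = mat_diag n (\<lambda>i. ds ! i)"
  using assms unfolding loc_diag_def by blast

lemma prime_not_dvd_det_mult:
  fixes A :: "'b :: {idom_divide, algebraic_semidom} mat"
  assumes "prime_elem p" "A \<in> carrier_mat n n" "B \<in> carrier_mat n n" "\<not> p dvd det A" "\<not> p dvd det B"
  shows "\<not> p dvd det (A * B)"
  using assms by (simp add: det_mult[of _ n] prime_elem_dvd_mult_iff)

lemma prime_not_dvd_one: "prime_elem p \<Longrightarrow> \<not> p dvd (1 :: 'b :: {idom_divide, algebraic_semidom})"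
  by (simp add: prime_elem_def)

text \<open>Because \<open>det A * det (adj_mat A) = det A ^ n\<close>. The adjugate can therefore
  replace the inverse in localised arguments without leaving the ring.\<close>

lemma prime_not_dvd_det_adj_mat:
  fixes A :: "'b :: {idom_divide, algebraic_semidom} mat"
  assumes p: "prime_elem p" and A: "A \<in> carrier_mat n n" and d: "\<not> p dvd det A"
  shows "\<not> p dvd det (adj_mat A)"
proof
  assume "p dvd det (adj_mat A)"
  then have "p dvd det (A * adj_mat A)" using A adj_mat(1)[OF A] by (simp add: det_mult[of _ n])
  then have "p dvd det A ^ n" unfolding adj_mat(2)[OF A] by simp
  with d show False using prime_elem_dvd_power[OF p] by blast
qed

text \<open>The pigeonhole half of the Frobenius-Koenig theorem: a permutation cannot map
  \<open>I\<close> into the complement of \<open>J\<close>, so every term of the Leibniz expansion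
  has a factor from the block.\<close>

lemma prime_dvd_det_of_block:
  fixes A :: "'b :: {idom_divide, algebraic_semidom} mat"
  assumes A: "A \<in> carrier_mat n n" and I: "I \<subseteq> {..<n}" and J: "J \<subseteq> {..<n}"
    and big: "card I + card J > n"
    and dvd: "\<And>i j. i \<in> I \<Longrightarrow> j \<in> J \<Longrightarrow> p dvd A $$ (i, j)"
  shows "p dvd det A"
  unfolding det_def'[OF A]
proof (rule dvd_sum)
  fix \<pi> assume "\<pi> \<in> {\<pi>. \<pi> permutes {0..<n}}"
  then have \<pi>: "\<pi> permutes {..<n}" by (simp add: atLeast0LessThan)
  have fin: "finite I" "finite J" using I J finite_subset by auto
  have "\<pi> ` I \<inter> J \<noteq> {}"
  proof
    assume "\<pi> ` I \<inter> J = {}"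
    then have "card (\<pi> ` I) + card J = card (\<pi> ` I \<union> J)" using fin by (simp add: card_Un_disjoint)
    also have "\<pi> ` I \<union> J \<subseteq> {..<n}" using I J permutes_image[OF \<pi>] by blast
    then have "card (\<pi> ` I \<union> J) \<le> n" using card_mono[of "{..<n}"] by fastforce
    finally have "card I + card J \<le> n"
      by (simp add: card_image[OF inj_on_subset[OF permutes_inj[OF \<pi>]]])
    with big show False by simp
  qed
  then obtain i where i: "i \<in> I" "\<pi> i \<in> J" by blast
  have "A $$ (i, \<pi> i) dvd (\<Prod>i = 0..<n. A $$ (i, \<pi> i))"
    using i I by (intro dvd_prodI) auto
  then show "p dvd of_int (sign \<pi>) * (\<Prod>i = 0..<n. A $$ (i, \<pi> i))"
    using dvd[OF i] dvd_trans by (intro dvd_mult) blast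
qed

text \<open>Two diagonalisations are linked by \<open>X * diag as = diag bs * Y\<close> with
  \<open>p\<close> not dividing \<open>det X\<close>. If \<open>p ^ e\<close> divides
  \<open>bs ! i\<close> but not \<open>as ! j\<close>, then \<open>p\<close> divides
  \<open>X $$ (i, j)\<close>. A block of such entries that is too large would force
  \<open>p dvd det X\<close>.\<close>

lemma loc_diag_card_le:
  fixes p :: "'b :: {idom_divide, algebraic_semidom}"
  assumes p: "prime_elem p" and e: "e > 0"
    and a: "loc_diag p A as" and b: "loc_diag p A bs"
  shows "length as = length bs \<and>
    card {i. i < length bs \<and> p ^ e dvd bs ! i} \<le> card {i. i < length as \<and> p ^ e dvd as ! i}"
proof -
  obtain n P Q where P: "length as = n" "A \<in> carrier_mat n n" "P \<in> carrier_mat n n"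
    "Q \<in> carrier_mat n n" "\<not> p dvd det P" "\<not> p dvd det Q" "P * A * Q = mat_diag n (\<lambda>i. as ! i)"
    using a by (rule loc_diagE)
  obtain n' P' Q' where P': "length bs = n'" "A \<in> carrier_mat n' n'" "P' \<in> carrier_mat n' n'"
    "Q' \<in> carrier_mat n' n'" "\<not> p dvd det P'" "\<not> p dvd det Q'" "P' * A * Q' = mat_diag n' (\<lambda>i. bs ! i)"
    using b by (rule loc_diagE)
  have n': "n' = n" using P(2) P'(2) by (metis carrier_matD(1))
  note P' = P'[unfolded n']
  let ?a = "mat_diag n (\<lambda>i. as ! i)" and ?b = "mat_diag n (\<lambda>i. bs ! i)"
  have adj: "adj_mat P \<in> carrier_mat n n" "adj_mat Q' \<in> carrier_mat n n"
    using adj_mat(1) P(3) P'(4) by auto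
  \<comment> \<open>Over the fraction field \<open>X = c P' P^-1\<close> and
    \<open>Y = c Q'^-1 Q\<close> with the common factor \<open>c = det P * det Q'\<close>; the
    adjugates keep both matrices over the ring.\<close>
  define X where "X = det Q' \<cdot>\<^sub>m (P' * adj_mat P)"
  define Y where "Y = det P \<cdot>\<^sub>m (adj_mat Q' * Q)"
  have XY: "X \<in> carrier_mat n n" "Y \<in> carrier_mat n n"
    using adj P(4) P'(3) by (auto simp: X_def Y_def)
  have "X * ?a = det Q' \<cdot>\<^sub>m (P' * ((adj_mat P * P) * (A * Q)))"
    unfolding X_def P(7)[symmetric] using P(2-4) P'(2-4) adj
    by (simp add: mult_smult_assoc_mat[of _ n n _ n] assoc_mult_mat[of _ n n _ n _ n] mult_carrier_mat[of _ n n _ n])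
  also have "\<dots> = (det Q' * det P) \<cdot>\<^sub>m (P' * (A * Q))"
    unfolding adj_mat(3)[OF P(3)] using P(2-4) P'(2-4) adj
    by (simp add: mult_smult_distrib[of _ n n _ n] mult_smult_assoc_mat[of _ n n _ n] smult_smult_mat)
  finally have 1: "X * ?a = (det Q' * det P) \<cdot>\<^sub>m (P' * (A * Q))" .
  have "?b * Y = det P \<cdot>\<^sub>m (P' * (A * ((Q' * adj_mat Q') * Q)))"
    unfolding Y_def P'(7)[symmetric] using P(2-4) P'(2-4) adj
    by (simp add: mult_smult_distrib[of _ n n _ n] assoc_mult_mat[of _ n n _ n _ n] mult_carrier_mat[of _ n n _ n])
  also have "\<dots> = (det Q' * det P) \<cdot>\<^sub>m (P' * (A * Q))"
    unfolding adj_mat(2)[OF P'(4)] using P(2-4) P'(2-4) adj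
    by (simp add: mult_smult_distrib[of _ n n _ n] mult_smult_assoc_mat[of _ n n _ n] smult_smult_mat ac_simps)
  finally have eq: "X * ?a = ?b * Y" using 1 by simp
  have ent: "X $$ (i, j) * as ! j = bs ! i * Y $$ (i, j)" if "i < n" "j < n" for i j
    using arg_cong[OF eq, of "\<lambda>M. M $$ (i, j)"] that
    unfolding mat_diag_mult_left[OF XY(2)] mat_diag_mult_right[OF XY(1)] by simp
  have "\<not> p dvd det X"
  proof -
    have "\<not> p dvd det Q' ^ n" using P'(6) prime_elem_dvd_power[OF p] by blast
    moreover have "\<not> p dvd det (P' * adj_mat P)"
      by (rule prime_not_dvd_det_mult[OF p P'(3) adj(1) P'(5) prime_not_dvd_det_adj_mat[OF p P(3,5)]])
    moreover have "det X = det Q' ^ n * det (P' * adj_mat P)" using P'(3) adj by (simp add: X_def)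
    ultimately show ?thesis by (simp only: prime_elem_dvd_mult_iff[OF p] simp_thms)
  qed
  define I where "I = {i. i < n \<and> p ^ e dvd bs ! i}"
  define J where "J = {j. j < n \<and> \<not> p ^ e dvd as ! j}"
  have "card I + card J \<le> n"
  proof (rule ccontr)
    assume "\<not> card I + card J \<le> n"
    moreover have "p dvd X $$ (i, j)" if "i \<in> I" "j \<in> J" for i j
    proof (rule ccontr)
      assume "\<not> p dvd X $$ (i, j)"
      moreover have "p ^ e dvd X $$ (i, j) * as ! j" using ent[of i j] that by (auto simp: I_def J_def)
      ultimately have "p ^ e dvd as ! j" using prime_power_dvd_multD[OF p] e by blast
      with that show False by (simp add: J_def)
    qed
    \<comment> \<open>All entries of \<open>X\<close> with row in \<open>I\<close> and column in
      \<open>J\<close> are divisible by \<open>p\<close>, so the pigeonhole lemma applies as soon as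
      the two sizes add up to more than \<open>n\<close>.\<close>
    ultimately have "p dvd det X" by (intro prime_dvd_det_of_block[OF XY(1), of I J]) (auto simp: I_def J_def)
    with \<open>\<not> p dvd det X\<close> show False by simp
  qed
  moreover have "card {i. i < n \<and> p ^ e dvd as ! i} + card J = n"
  proof -
    have "card ({i. i < n \<and> p ^ e dvd as ! i} \<union> J) = card {i. i < n \<and> p ^ e dvd as ! i} + card J"
      by (rule card_Un_disjoint) (auto simp: J_def)
    also have "{i. i < n \<and> p ^ e dvd as ! i} \<union> J = {..<n}" by (auto simp: J_def)
    finally show ?thesis by simp
  qed
  ultimately show ?thesis using P(1) P'(1) n' by (simp add: I_def)
qed

lemma loc_diag_count_eq:
  fixes p :: "'b :: {idom_divide, algebraic_semidom}"
  assumes p: "prime_elem p" and e: "e > 0"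
    and a: "loc_diag p A as" and b: "loc_diag p A bs"
  shows "length (filter (\<lambda>x. p ^ e dvd x) as) = length (filter (\<lambda>x. p ^ e dvd x) bs)"
  unfolding length_filter_conv_card
  using loc_diag_card_le[OF p e a b] loc_diag_card_le[OF p e b a] by (intro le_antisym) blast+

text \<open>The factors \<open>M\<close> and \<open>N\<close> are absorbed into the matrices that
  diagonalise \<open>A\<close>, so a diagonalisation of the product is one of the middle
  factor.\<close>

lemma loc_diag_mult:
  assumes p: "prime_elem p" and A: "loc_diag p A ds" "length ds = n"
    and M: "M \<in> carrier_mat n n" "N \<in> carrier_mat n n" "B \<in> carrier_mat n n"
    and d: "\<not> p dvd det M" "\<not> p dvd det N" and eq: "A = M * B * N"
  shows "loc_diag p B ds"
proof -
  obtain P Q where P: "A \<in> carrier_mat n n" "P \<in> carrier_mat n n"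
    "Q \<in> carrier_mat n n" "\<not> p dvd det P" "\<not> p dvd det Q" "P * A * Q = mat_diag n (\<lambda>i. ds ! i)"
    using A by (auto elim: loc_diagE)
  show ?thesis
  proof (rule loc_diagI[OF A(2) M(3)])
    show "P * M \<in> carrier_mat n n" "N * Q \<in> carrier_mat n n" using P M by auto
    show "\<not> p dvd det (P * M)" by (rule prime_not_dvd_det_mult[OF p P(2) M(1) P(4) d(1)])
    show "\<not> p dvd det (N * Q)" by (rule prime_not_dvd_det_mult[OF p M(2) P(3) d(2) P(5)])
    show "P * M * B * (N * Q) = mat_diag n (\<lambda>i. ds ! i)"
      unfolding P(6)[symmetric] eq using P(1-3) M
      by (simp add: assoc_mult_mat[of _ n n _ n _ n] mult_carrier_mat[of _ n n _ n])
  qed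
qed

lemma loc_diag_transpose:
  assumes "loc_diag p A ds"
  shows "loc_diag p (transpose_mat A) ds"
proof -
  obtain n P Q where P: "length ds = n" "A \<in> carrier_mat n n" "P \<in> carrier_mat n n"
    "Q \<in> carrier_mat n n" "\<not> p dvd det P" "\<not> p dvd det Q" "P * A * Q = mat_diag n (\<lambda>i. ds ! i)"
    using assms by (rule loc_diagE)
  show ?thesis
  proof (rule loc_diagI[OF P(1), of _ "transpose_mat Q" "transpose_mat P"])
    have "transpose_mat Q * transpose_mat A * transpose_mat P = transpose_mat (P * A * Q)"
      using P(2-4) by (simp add: transpose_mult[of _ n n _ n])
    also have "\<dots> = mat_diag n (\<lambda>i. ds ! i)" unfolding P(7) by (auto simp: mat_diag_def)
    finally show "transpose_mat Q * transpose_mat A * transpose_mat P = mat_diag n (\<lambda>i. ds ! i)" .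
  qed (use P in \<open>auto simp: det_transpose\<close>)
qed

lemma mat_diag_append:
  "mat_diag (length xs + length ys) (\<lambda>i. (xs @ ys) ! i) =
   four_block_mat (mat_diag (length xs) (\<lambda>i. xs ! i)) (0\<^sub>m (length xs) (length ys))
     (0\<^sub>m (length ys) (length xs)) (mat_diag (length ys) (\<lambda>i. ys ! i))"
  by (rule eq_matI) (auto simp: mat_diag_def nth_append)

lemma loc_diag_four_block:
  fixes p :: "'b :: {idom_divide, algebraic_semidom}"
  assumes p: "prime_elem p" and A: "loc_diag p A as" and B: "loc_diag p B bs"
  shows "loc_diag p (four_block_mat A (0\<^sub>m (length as) (length bs)) (0\<^sub>m (length bs) (length as)) B) (as @ bs)"
proof -
  obtain n P Q where P: "length as = n" "A \<in> carrier_mat n n" "P \<in> carrier_mat n n"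
    "Q \<in> carrier_mat n n" "\<not> p dvd det P" "\<not> p dvd det Q" "P * A * Q = mat_diag n (\<lambda>i. as ! i)"
    using A by (rule loc_diagE)
  obtain m P' Q' where P': "length bs = m" "B \<in> carrier_mat m m" "P' \<in> carrier_mat m m"
    "Q' \<in> carrier_mat m m" "\<not> p dvd det P'" "\<not> p dvd det Q'" "P' * B * Q' = mat_diag m (\<lambda>i. bs ! i)"
    using B by (rule loc_diagE)
  let ?f = "\<lambda>X Y. four_block_mat X (0\<^sub>m n m) (0\<^sub>m m n) Y :: 'b mat"
  have mult: "?f X Y * ?f X' Y' = ?f (X * X') (Y * Y')"
    if "X \<in> carrier_mat n n" "X' \<in> carrier_mat n n" "Y \<in> carrier_mat m m" "Y' \<in> carrier_mat m m"
    for X Y X' Y' using that by (subst mult_four_block_mat[of _ n n _ m _ m _ _ n _ m]) auto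
  have det: "det (?f X Y) = det X * det Y" if "X \<in> carrier_mat n n" "Y \<in> carrier_mat m m" for X Y
    using that by (intro det_four_block_mat_lower_left_zero) auto
  show ?thesis unfolding P(1) P'(1)
  proof (rule loc_diagI[of _ "n + m"])
    show "?f P P' * ?f A B * ?f Q Q' = mat_diag (n + m) (\<lambda>i. (as @ bs) ! i)"
      unfolding mat_diag_append[of as bs, unfolded P(1) P'(1)] P(7)[symmetric] P'(7)[symmetric]
      using P(2-4) P'(2-4) by (simp add: mult)
  qed (use P P' in \<open>auto simp: det prime_elem_dvd_mult_iff[OF p]\<close>)
qed

lemma loc_diag_diag_block_mat:
  fixes p :: "'b :: {idom_divide, algebraic_semidom}"
  assumes p: "prime_elem p" and "list_all2 (loc_diag p) As dss"
  shows "loc_diag p (diag_block_mat As) (concat dss)"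
  using assms(2)
proof (induction rule: list_all2_induct)
  case Nil
  have "loc_diag p (0\<^sub>m 0 0) []"
    by (rule loc_diagI[of _ 0 _ "1\<^sub>m 0" "1\<^sub>m 0"]) (use prime_not_dvd_one[OF p] in \<open>auto simp: mat_diag_def\<close>)
  then show ?case by simp
next
  case (Cons A As ds dss)
  have "A \<in> carrier_mat (length ds) (length ds)"
    "diag_block_mat As \<in> carrier_mat (length (concat dss)) (length (concat dss))"
    using Cons unfolding loc_diag_def by auto
  then show ?case using loc_diag_four_block[OF p Cons(1,3)] by (simp add: Let_def)
qed

text \<open>The adjugate turns \<open>A\<close> into the scalar matrix \<open>det A\<close>. This
  settles the primes at which the pencil is already invertible in the localisation.\<close>

lemma loc_diag_adj:
  fixes p :: "'b :: {idom_divide, algebraic_semidom}"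
  assumes p: "prime_elem p" and A: "A \<in> carrier_mat n n" and d: "\<not> p dvd det A"
  shows "loc_diag p A (replicate n (det A))"
proof (rule loc_diagI[of _ n _ "adj_mat A" "1\<^sub>m n"])
  show "adj_mat A * A * 1\<^sub>m n = mat_diag n (\<lambda>i. replicate n (det A) ! i)"
    using A adj_mat(1)[OF A] unfolding adj_mat(3)[OF A] by (auto simp: mat_diag_def)
qed (use A adj_mat(1)[OF A] prime_not_dvd_det_adj_mat[OF p A d] prime_not_dvd_one[OF p] in auto)

text \<open>Multiplying by the skew permutation matrix \<open>?J\<close> moves the two off-diagonal
  blocks onto the diagonal as \<open>M\<close> and its transpose, which share the diagonal entries
  \<open>ds\<close>. This is where each entry gets doubled.\<close>

lemma loc_diag_hyperbolic:
  fixes p :: "'b :: {idom_divide, algebraic_semidom}"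
  assumes p: "prime_elem p" and M: "loc_diag p M ds" "length ds = n"
  shows "loc_diag p (four_block_mat (0\<^sub>m n n) M (- transpose_mat M) (0\<^sub>m n n)) (ds @ ds)"
proof -
  let ?J = "four_block_mat (0\<^sub>m n n) (- 1\<^sub>m n) (1\<^sub>m n) (0\<^sub>m n n) :: 'b mat"
  have cM: "M \<in> carrier_mat n n" using M unfolding loc_diag_def by auto
  have "?J * transpose_mat ?J = 1\<^sub>m (n + n)"
    by (subst transpose_four_block_mat[of _ n n _ n _ n], simp, simp, simp, simp)
      (subst mult_four_block_mat[of _ n n _ n _ n _ _ n _ n], auto intro!: eq_matI)
  then have "det ?J * det (transpose_mat ?J) = 1"
    by (subst det_mult[symmetric, of _ "n + n"]) auto
  then have J: "\<not> p dvd det ?J" using prime_not_dvd_one[OF p] by (metis dvd_mult2)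
  have eq: "four_block_mat (0\<^sub>m n n) M (- transpose_mat M) (0\<^sub>m n n) * ?J
      = four_block_mat M (0\<^sub>m n n) (0\<^sub>m n n) (transpose_mat M)"
    using cM by (subst mult_four_block_mat[of _ n n _ n _ n _ _ n _ n]) auto
  show ?thesis
    by (rule loc_diag_mult[OF p loc_diag_four_block[OF p M(1) loc_diag_transpose[OF M(1)]],
          of "n + n" "1\<^sub>m (n + n)" ?J])
      (use cM M J eq prime_not_dvd_one[OF p] in auto)
qed

section \<open>Binary forms\<close>

lemma comm_ring_hom_poly_map_const:
  "comm_ring_hom (\<lambda>p. poly (map_poly (const_xy :: 'a :: field \<Rightarrow> _) p) X)"
proof -
  interpret c: comm_ring_hom "const_xy :: 'a \<Rightarrow> 'a poly poly" by (rule comm_ring_hom_const_xy)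
  interpret m: map_poly_comm_ring_hom "const_xy :: 'a \<Rightarrow> 'a poly poly" ..
  show ?thesis by unfold_locales (auto simp: m.hom_add m.hom_mult)
qed

lemma comm_ring_hom_eval_xy: "comm_ring_hom (\<lambda>f :: 'a :: field poly poly. eval_xy f X Y)"
proof -
  interpret c: comm_ring_hom "\<lambda>p. poly (map_poly (const_xy :: 'a \<Rightarrow> _) p) X"
    by (rule comm_ring_hom_poly_map_const)
  interpret m: map_poly_comm_ring_hom "\<lambda>p. poly (map_poly (const_xy :: 'a \<Rightarrow> _) p) X" ..
  show ?thesis unfolding eval_xy_def by unfold_locales (auto simp: m.hom_add m.hom_mult)
qed

lemma eval_xy_simps [simp]:
  fixes X Y :: "'a :: field poly poly"
  shows "eval_xy (const_xy c) X Y = const_xy c" "eval_xy var_x X Y = X" "eval_xy var_y X Y = Y"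
proof -
  interpret c: comm_ring_hom "const_xy :: 'a \<Rightarrow> 'a poly poly" by (rule comm_ring_hom_const_xy)
  interpret d: comm_ring_hom "\<lambda>p. poly (map_poly (const_xy :: 'a \<Rightarrow> _) p) X"
    by (rule comm_ring_hom_poly_map_const)
  show "eval_xy (const_xy c) X Y = const_xy c" "eval_xy var_x X Y = X" "eval_xy var_y X Y = Y"
    by (auto simp: eval_xy_def c.map_poly_pCons_hom d.map_poly_pCons_hom)
qed

lemma poly_poly_pCons:
  "pCons p f = [:p:] + var_y * f" for f :: "'a :: comm_ring_1 poly poly"
  by simp

lemma const_pCons:
  "[:pCons a p:] = const_xy a + var_x * [:p:]" for p :: "'a :: comm_ring_1 poly"
  by simp

lemma poly_poly_hom_eqI:
  fixes F G :: "'a :: comm_ring_1 poly poly \<Rightarrow> 'b :: comm_ring_1"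
  assumes "comm_ring_hom F" and "comm_ring_hom G"
    and c: "\<And>c. F (const_xy c) = G (const_xy c)" and x: "F var_x = G var_x" and y: "F var_y = G var_y"
  shows "F f = G f"
proof -
  interpret F: comm_ring_hom F by fact
  interpret G: comm_ring_hom G by fact
  have 1: "F [:p:] = G [:p:]" for p
  proof (induction p)
    case (pCons a p)
    show ?case unfolding const_pCons[of a p] F.hom_add G.hom_add F.hom_mult G.hom_mult pCons x c ..
  qed simp
  show ?thesis
  proof (induction f)
    case (pCons p f)
    show ?case unfolding poly_poly_pCons[of p f] F.hom_add G.hom_add F.hom_mult G.hom_mult pCons y 1 ..
  qed simp
qed

section \<open>Linear substitutions, homogenisation and prime forms\<close>

definition lin_form :: "'a :: field mat \<Rightarrow> nat \<Rightarrow> 'a poly poly" where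
  "lin_form M i = const_xy (M $$ (i, 0)) * var_x + const_xy (M $$ (i, 1)) * var_y"

definition subst_lin :: "'a :: field mat \<Rightarrow> 'a poly poly \<Rightarrow> 'a poly poly" where
  "subst_lin M f = eval_xy f (lin_form M 0) (lin_form M 1)"

lemma comm_ring_hom_subst_lin: "comm_ring_hom (subst_lin M)"
  unfolding subst_lin_def by (rule comm_ring_hom_eval_xy)

lemma subst_lin_simps:
  "subst_lin M (const_xy c) = const_xy c" "subst_lin M var_x = lin_form M 0" "subst_lin M var_y = lin_form M 1"
  unfolding subst_lin_def by (rule eval_xy_simps)+

lemma subst_lin_lin_form:
  assumes "M \<in> carrier_mat 2 2" and "N \<in> carrier_mat 2 2" and "i < 2"
  shows "subst_lin M (lin_form N i) = lin_form (N * M) i"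
proof -
  interpret s: comm_ring_hom "subst_lin M" by (rule comm_ring_hom_subst_lin)
  have "(N * M) $$ (i, j) = N $$ (i, 0) * M $$ (0, j) + N $$ (i, 1) * M $$ (1, j)" if "j < 2" for j
  proof -
    have "{0..<2::nat} = {0, 1}" by auto
    then show ?thesis using assms that by (simp add: scalar_prod_def)
  qed
  then have NM: "(N * M) $$ (i, 0) = N $$ (i, 0) * M $$ (0, 0) + N $$ (i, 1) * M $$ (1, 0)"
    "(N * M) $$ (i, 1) = N $$ (i, 0) * M $$ (0, 1) + N $$ (i, 1) * M $$ (1, 1)" by auto
  interpret c: comm_ring_hom "const_xy :: 'a \<Rightarrow> 'a poly poly" by (rule comm_ring_hom_const_xy)
  show ?thesis
    unfolding lin_form_def[of N] s.hom_add s.hom_mult subst_lin_simps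
    unfolding lin_form_def NM c.hom_add c.hom_mult
    by (simp only: ring_distribs ac_simps)
qed

lemma subst_lin_mult:
  assumes "M \<in> carrier_mat 2 2" and "N \<in> carrier_mat 2 2"
  shows "subst_lin M (subst_lin N f) = subst_lin (N * M) f"
proof -
  interpret s: comm_ring_hom "subst_lin M" by (rule comm_ring_hom_subst_lin)
  interpret t: comm_ring_hom "subst_lin N" by (rule comm_ring_hom_subst_lin)
  interpret u: comm_ring_hom "subst_lin (N * M)" by (rule comm_ring_hom_subst_lin)
  show ?thesis
    by (rule poly_poly_hom_eqI[where F = "\<lambda>f. subst_lin M (subst_lin N f)" and G = "subst_lin (N * M)"],
        unfold_locales)
      (simp_all add: s.hom_add s.hom_mult t.hom_add t.hom_mult subst_lin_simps subst_lin_lin_form[OF assms]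
        del: mult_pCons_left mult_pCons_right)
qed

lemma lin_form_one: "lin_form (1\<^sub>m 2) 0 = var_x" "lin_form (1\<^sub>m 2) 1 = var_y"
  by (simp_all add: lin_form_def)

lemma subst_lin_one: "subst_lin (1\<^sub>m 2) f = f"
proof (rule poly_poly_hom_eqI[where F = "subst_lin (1\<^sub>m 2)" and G = "\<lambda>f. f"])
  show "comm_ring_hom (\<lambda>f :: 'a poly poly. f)" by unfold_locales auto
qed (simp_all only: comm_ring_hom_subst_lin subst_lin_simps lin_form_one)

text \<open>Divisibility is transported: \<open>F p dvd f\<close> is equivalent to
  \<open>p dvd G f\<close>.\<close>

lemma prime_elem_automorphism:
  fixes F G :: "'b :: idom \<Rightarrow> 'b"
  assumes "comm_ring_hom F" and "comm_ring_hom G"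
    and FG: "\<And>f. F (G f) = f" and GF: "\<And>f. G (F f) = f" and p: "prime_elem p"
  shows "prime_elem (F p)"
proof -
  interpret F: comm_ring_hom F by fact
  interpret G: comm_ring_hom G by fact
  have dvd: "F p dvd f \<longleftrightarrow> p dvd G f" for f
    by (metis F.hom_dvd G.hom_dvd FG GF)
  show ?thesis
    using p unfolding prime_elem_def dvd by (auto simp: G.hom_mult) (metis GF G.hom_zero)
qed

text \<open>For \<open>degree q \<le> k\<close> this is the homogenisation of \<open>q\<close> in
  degree \<open>k\<close>. The degree is a separate parameter so that surplus powers of
  \<open>Y\<close> are recorded and multiplicativity holds; the arguments \<open>X\<close>,
  \<open>Y\<close> cover the variables, pairs of linear forms and the specialisation
  \<open>Y = 1\<close> at once.\<close>

definition homog :: "nat \<Rightarrow> 'a :: field poly \<Rightarrow> 'a poly poly \<Rightarrow> 'a poly poly \<Rightarrow> 'a poly poly" where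
  "homog k q X Y = (\<Sum>i\<le>k. const_xy (coeff q i) * X ^ i * Y ^ (k - i))"

lemma hom_homog:
  assumes "comm_ring_hom F" and "\<And>c. F (const_xy c) = const_xy c"
  shows "F (homog k q X Y) = homog k q (F X) (F Y)"
proof -
  interpret F: comm_ring_hom F by fact
  show ?thesis unfolding homog_def by (simp only: F.hom_sum F.hom_mult F.hom_power assms)
qed

lemma homog_scale: "homog k q (X * Z) (Y * Z) = homog k q X Y * Z ^ k"
  unfolding homog_def sum_distrib_right
proof (rule sum.cong)
  fix i assume "i \<in> {..k}"
  then have "Z ^ k = Z ^ i * Z ^ (k - i)" by (simp flip: power_add)
  then show "const_xy (coeff q i) * (X * Z) ^ i * (Y * Z) ^ (k - i)
      = const_xy (coeff q i) * X ^ i * Y ^ (k - i) * Z ^ k"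
    by (simp only: power_mult_distrib ac_simps)
qed simp

lemma homog_pCons: "homog (Suc k) (pCons a q) X Y = const_xy a * Y ^ Suc k + X * homog k q X Y"
  unfolding homog_def sum.atMost_Suc_shift sum_distrib_left
  by (simp only: diff_Suc_Suc diff_zero coeff_pCons_0 coeff_pCons_Suc power_0 mult_1_right mult_1_left power_Suc[of X] ac_simps)

lemma homog_0 [simp]: "homog k 0 X Y = 0"
  by (simp add: homog_def)

lemma homog_1: "homog 0 1 X Y = 1"
  by (simp add: homog_def pCons_one)

lemma homog_add: "homog k (p + q) X Y = homog k p X Y + homog k q X Y"
proof -
  interpret c: comm_ring_hom "const_xy :: 'a \<Rightarrow> 'a poly poly" by (rule comm_ring_hom_const_xy)
  show ?thesis unfolding homog_def by (simp only: coeff_add c.hom_add distrib_right sum.distrib)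
qed

lemma homog_smult: "homog k (Polynomial.smult a q) X Y = const_xy a * homog k q X Y"
proof -
  interpret c: comm_ring_hom "const_xy :: 'a \<Rightarrow> 'a poly poly" by (rule comm_ring_hom_const_xy)
  show ?thesis unfolding homog_def by (simp only: coeff_smult c.hom_mult sum_distrib_left mult.assoc)
qed

lemma homog_add_degree:
  assumes "degree q \<le> k"
  shows "homog (k + l) q X Y = homog k q X Y * Y ^ l"
proof -
  have "homog (k + l) q X Y = (\<Sum>i\<le>k. const_xy (coeff q i) * X ^ i * Y ^ (k + l - i))"
    unfolding homog_def using assms
    by (intro sum.mono_neutral_right) (auto simp: coeff_eq_0)
  also have "\<dots> = homog k q X Y * Y ^ l"
    unfolding homog_def sum_distrib_right
  proof (rule sum.cong)
    fix i assume "i \<in> {..k}"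
    then have "Y ^ (k + l - i) = Y ^ (k - i) * Y ^ l" by (simp flip: power_add)
    then show "const_xy (coeff q i) * X ^ i * Y ^ (k + l - i)
        = const_xy (coeff q i) * X ^ i * Y ^ (k - i) * Y ^ l"
      by (simp only: ac_simps)
  qed simp
  finally show ?thesis .
qed

lemma homog_mult:
  assumes "degree p \<le> k" and "degree q \<le> l"
  shows "homog (k + l) (p * q) X Y = homog k p X Y * homog l q X Y"
  using assms(1)
proof (induction p arbitrary: k)
  case (pCons a p)
  show ?case
  proof (cases "p = 0")
    case True
    then have "homog (k + l) (pCons a p * q) X Y = const_xy a * homog (l + k) q X Y"
      by (simp add: homog_smult add.commute)
    also have "\<dots> = (const_xy a * Y ^ k) * homog l q X Y"
      unfolding homog_add_degree[OF assms(2)] by (simp only: mult_ac)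
    also have "const_xy a * Y ^ k = homog k (pCons a p) X Y"
      using homog_add_degree[of "[:a:]" 0 k X Y] True by (simp add: homog_def)
    finally show ?thesis .
  next
    case False
    then obtain k' where k: "k = Suc k'" and d: "degree p \<le> k'"
      using pCons.prems by (cases k) auto
    have "homog (k + l) (pCons a p * q) X Y
        = homog (k + l) (Polynomial.smult a q) X Y + homog (Suc (k' + l)) (pCons 0 (p * q)) X Y"
      by (simp add: homog_add k)
    also have "homog (k + l) (Polynomial.smult a q) X Y = const_xy a * (homog l q X Y * Y ^ k)"
      by (simp only: homog_smult add.commute[of k l] homog_add_degree[OF assms(2)])
    also have "homog (Suc (k' + l)) (pCons 0 (p * q)) X Y = X * (homog k' p X Y * homog l q X Y)"
      unfolding homog_pCons pCons.IH[OF d] by simp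
    also have "const_xy a * (homog l q X Y * Y ^ k) + X * (homog k' p X Y * homog l q X Y)
        = homog k (pCons a p) X Y * homog l q X Y"
      unfolding k homog_pCons distrib_right by (simp only: ac_simps)
    finally show ?thesis .
  qed
qed simp

lemma homog_power:
  assumes "degree q \<le> k"
  shows "homog (k * e) (q ^ e) X Y = homog k q X Y ^ e"
proof (induction e)
  case (Suc e)
  have "degree (q ^ e) \<le> k * e"
    using degree_power_le[of q e] mult_le_mono1[OF assms, of e] by linarith
  from homog_mult[OF assms this, of X Y] show ?case by (simp add: Suc)
qed (simp add: homog_1)

lemma const_eq_sum: "degree q \<le> k \<Longrightarrow> (\<Sum>i\<le>k. const_xy (coeff q i) * var_x ^ i) = [:q:]"
proof (induction q arbitrary: k)
  case (pCons a q)
  show ?case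
  proof (cases k)
    case 0
    then have "q = 0" using pCons.prems by (simp split: if_splits)
    then show ?thesis using 0 by simp
  next
    case (Suc k')
    then have "degree q \<le> k'" using pCons.prems by (auto split: if_splits)
    then have "var_x * (\<Sum>i\<le>k'. const_xy (coeff q i) * var_x ^ i) = var_x * [:q:]"
      by (simp only: pCons.IH)
    then show ?thesis unfolding Suc sum.atMost_Suc_shift sum_distrib_left const_pCons[of a q]
      by (simp add: mult.left_commute[of var_x] del: mult_pCons_left mult_pCons_right)
  qed
qed simp

lemma homog_x_1: "degree q \<le> k \<Longrightarrow> homog k q var_x 1 = [:q:]"
  using const_eq_sum[of q k] by (simp add: homog_def del: mult_pCons_left mult_pCons_right)

lemma poly_homog_1:
  assumes "degree q \<le> k"
  shows "poly (homog k q var_x var_y) 1 = q"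
proof -
  have "poly (homog k q var_x var_y) 1 = poly (homog k q var_x 1) 1"
    unfolding homog_def poly_sum by (rule sum.cong) (auto simp: poly_power)
  then show ?thesis using homog_x_1[OF assms] by simp
qed

lemma power_x: "(var_x :: 'a :: field poly poly) ^ i = [:monom 1 i:]"
  by (induction i) (auto simp: monom_altdef pCons_one)

lemma power_y: "(var_y :: 'a :: field poly poly) ^ i = monom 1 i"
  by (simp add: monom_altdef)

lemma coeff_coeff_homog:
  "coeff (coeff (homog k q var_x var_y) j) i = (if i + j = k then coeff q i else 0)"
proof -
  have "coeff (coeff (const_xy (coeff q l) * var_x ^ l * var_y ^ (k - l)) j) i
      = (if i = l then (if i + j = k then coeff q i else 0) else 0)" if "l \<le> k" for l
    unfolding power_x power_y using that by (auto simp: coeff_smult)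
  then have "coeff (coeff (homog k q var_x var_y) j) i
      = (\<Sum>l\<le>k. if i = l then (if i + j = k then coeff q i else 0) else 0)"
    unfolding homog_def coeff_sum by (intro sum.cong) auto
  then show ?thesis by simp
qed

text \<open>The substitution \<open>x \<mapsto> x y\<close>, \<open>y \<mapsto> y\<close> separates the homogeneous components.\<close>

lemma coeff_coeff_eval_xy:
  fixes f :: "'a :: field poly poly"
  shows "coeff (coeff (eval_xy f (var_x * var_y) var_y) k) i = (if i \<le> k then coeff (coeff f (k - i)) i else 0)"
proof -
  define Z :: "'a poly poly" where "Z = var_x * var_y"
  have Z: "Z * g = pCons 0 (Polynomial.smult [:0, 1:] g)" for g by (simp add: Z_def)
  let ?\<phi> = "\<lambda>f :: 'a poly poly. eval_xy f Z var_y"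
  interpret h: comm_ring_hom ?\<phi> by (rule comm_ring_hom_eval_xy)
  have 1: "coeff (coeff (?\<phi> [:p:]) k) i = (if i = k then coeff p i else 0)" for p k i
  proof (induction p arbitrary: k i)
    case (pCons a p)
    have "?\<phi> [:pCons a p:] = const_xy a + pCons 0 (Polynomial.smult [:0, 1:] (?\<phi> [:p:]))"
      unfolding const_pCons[of a p] h.hom_add h.hom_mult by (simp add: Z)
    then show ?case by (auto simp: pCons coeff_pCons split: nat.splits)
  qed simp
  show ?thesis unfolding Z_def[symmetric]
  proof (induction f arbitrary: k i)
    case (pCons p f)
    have "?\<phi> (pCons p f) = ?\<phi> [:p:] + pCons 0 (?\<phi> f)"
      unfolding poly_poly_pCons[of p f] h.hom_add h.hom_mult by simp
    then show ?case by (cases k) (auto simp: 1 pCons coeff_pCons Suc_diff_le split: nat.splits)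
  qed simp
qed

lemma sum_homog_components:
  fixes f :: "'a :: field poly poly"
  obtains N where "f = (\<Sum>k\<le>N. homog k (coeff (eval_xy f (var_x * var_y) var_y) k) var_x var_y)"
proof -
  \<comment> \<open>A crude bound on the total degree: the first summand bounds the exponent of
    \<open>y\<close>, the second the exponent of \<open>x\<close>.\<close>
  define N where "N = degree f + (\<Sum>j\<le>degree f. degree (coeff f j))"
  have 0: "coeff (coeff f j) i = 0" if "i + j > N" for i j
  proof (cases "j \<le> degree f")
    case True
    then have "degree (coeff f j) \<le> (\<Sum>j\<le>degree f. degree (coeff f j))"
      by (intro member_le_sum) auto
    then show ?thesis using that True by (intro coeff_eq_0) (simp add: N_def)
  qed (simp add: coeff_eq_0)
  have "coeff (coeff f j) i
    = coeff (coeff (\<Sum>k\<le>N. homog k (coeff (eval_xy f (var_x * var_y) var_y) k) var_x var_y) j) i" for i j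
    using 0[of i j] by (auto simp: coeff_sum coeff_coeff_homog coeff_coeff_eval_xy simp del: mult_pCons_left mult_pCons_right)
  then have "f = (\<Sum>k\<le>N. homog k (coeff (eval_xy f (var_x * var_y) var_y) k) var_x var_y)"
    by (intro poly_eqI)
  then show thesis by (rule that)
qed

lemma degree_coeff_eval_xy:
  fixes f :: "'a :: field poly poly"
  shows "degree (coeff (eval_xy f (var_x * var_y) var_y) k) \<le> k"
  by (rule degree_le) (simp add: coeff_coeff_eval_xy del: mult_pCons_left mult_pCons_right)

text \<open>Under \<open>x \<mapsto> x y\<close> the form becomes \<open>q(x)\<close> times a power
  of \<open>y\<close>, and \<open>q\<close>, as a constant of k[x][y], is prime there. Hence
  \<open>q\<close> divides all coefficients of the image of one factor, which are the dehomogenised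
  components of that factor; homogenising again recovers divisibility by the form.\<close>

lemma prime_elem_homog:
  fixes q :: "'a :: field poly"
  assumes q: "irreducible q"
  shows "prime_elem (homog (degree q) q var_x var_y)"
proof (rule prime_elemI)
  let ?P = "homog (degree q) q var_x var_y"
  have pq: "prime_elem q" using q by (rule field_poly_irreducible_imp_prime)
  have q1: "poly ?P 1 = q" by (rule poly_homog_1) simp
  show "?P \<noteq> 0" using q1 pq by auto
  show "\<not> ?P dvd 1"
  proof
    assume "?P dvd 1"
    then obtain g where "?P * g = 1" by (metis dvdE)
    then have "poly ?P 1 * poly g 1 = 1" by (metis poly_mult poly_1)
    then have "q dvd 1" unfolding q1 by (metis dvd_triv_left)
    with pq show False using prime_elem_not_unit by blast
  qed
  fix f g assume dvd: "?P dvd f * g"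
  let ?\<phi> = "\<lambda>f :: 'a poly poly. eval_xy f (var_x * var_y) var_y"
  interpret h: comm_ring_hom ?\<phi> by (rule comm_ring_hom_eval_xy)
  have "?\<phi> ?P = homog (degree q) q (var_x * var_y) (1 * var_y)"
    by (subst hom_homog[OF comm_ring_hom_eval_xy]) (simp_all del: mult_pCons_left mult_pCons_right)
  also have "\<dots> = [:q:] * var_y ^ degree q" unfolding homog_scale by (subst homog_x_1) auto
  finally have "[:q:] dvd ?\<phi> ?P" by (metis dvd_triv_left)
  then have "[:q:] dvd ?\<phi> f * ?\<phi> g" using h.hom_dvd[OF dvd] unfolding h.hom_mult by (rule dvd_trans)
  then have "[:q:] dvd ?\<phi> f \<or> [:q:] dvd ?\<phi> g"
    using prime_elem_dvd_multD[OF lift_prime_elem_poly[OF pq]] by blast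
  moreover have "?P dvd f" if "[:q:] dvd ?\<phi> f" for f
  proof -
    obtain N where f: "f = (\<Sum>k\<le>N. homog k (coeff (?\<phi> f) k) var_x var_y)" by (rule sum_homog_components)
    have "?P dvd homog k (coeff (?\<phi> f) k) var_x var_y" for k
    proof (cases "coeff (?\<phi> f) k = 0")
      case False
      have "q dvd coeff (?\<phi> f) k" using that by (simp only: const_poly_dvd_iff)
      then obtain r where r: "coeff (?\<phi> f) k = q * r" by (rule dvdE)
      \<comment> \<open>The component of degree \<open>k\<close> dehomogenises to a polynomial of
        degree at most \<open>k\<close>, so the cofactor \<open>r\<close> fits into the remaining
        degree \<open>l = k - degree q\<close>.\<close>
      then have "degree q + degree r \<le> k"
        using False degree_coeff_eval_xy[of f k] by (simp only: r degree_mult_eq mult_eq_0_iff simp_thms) (metis degree_mult_eq)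
      then obtain l where k: "k = degree q + l" and l: "degree r \<le> l" by (metis add_le_cancel_left le_Suc_ex add.assoc le_add1)
      show ?thesis unfolding r unfolding k homog_mult[OF order_refl l] by simp
    qed (simp only: homog_0 dvd_0_right)
    then show ?thesis by (subst f) (rule dvd_sum)
  qed
  ultimately show "?P dvd f \<or> ?P dvd g" by blast
qed

lemma prime_elem_homog_lin_form:
  fixes q :: "'a :: field poly"
  assumes q: "irreducible q" and M: "M \<in> carrier_mat 2 2" "N \<in> carrier_mat 2 2" "M * N = 1\<^sub>m 2" "N * M = 1\<^sub>m 2"
  shows "prime_elem (homog (degree q) q (lin_form M 0) (lin_form M 1))"
proof -
  have "prime_elem (subst_lin M (homog (degree q) q var_x var_y))"
    by (rule prime_elem_automorphism[of _ "subst_lin N"])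
      (use M in \<open>simp_all add: comm_ring_hom_subst_lin subst_lin_mult subst_lin_one prime_elem_homog[OF q]\<close>)
  also have "subst_lin M (homog (degree q) q var_x var_y) = homog (degree q) q (lin_form M 0) (lin_form M 1)"
    by (subst hom_homog[OF comm_ring_hom_subst_lin]) (simp_all add: subst_lin_simps)
  finally show ?thesis .
qed

text \<open>The rows of an invertible \<open>M\<close> span the linear forms, so \<open>p\<close>
  divides both variables. Dividing \<open>x\<close> makes \<open>p\<close> constant in
  \<open>y\<close>, and dividing \<open>y\<close>, which has coefficient 1, makes that constant a
  unit.\<close>

lemma dvd_lin_forms_imp_unit:
  fixes p :: "'a :: field poly poly"
  assumes M: "M \<in> carrier_mat 2 2" "N \<in> carrier_mat 2 2" "M * N = 1\<^sub>m 2"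
    and p: "p dvd lin_form M 0" "p dvd lin_form M 1"
  shows "p dvd 1"
proof -
  interpret t: comm_ring_hom "subst_lin M" by (rule comm_ring_hom_subst_lin)
  have "p dvd const_xy (N $$ (i, 0)) * lin_form M 0 + const_xy (N $$ (i, 1)) * lin_form M 1" for i
    using p by (intro dvd_add dvd_mult)
  moreover have "const_xy (N $$ (i, 0)) * lin_form M 0 + const_xy (N $$ (i, 1)) * lin_form M 1
      = lin_form (N * M) i" if "i < 2" for i
    using subst_lin_lin_form[OF M(1,2) that]
    unfolding lin_form_def[of N] t.hom_add t.hom_mult subst_lin_simps .
  moreover have "N * M = 1\<^sub>m 2" by (rule mat_mult_left_right_inverse[OF M])
  ultimately have x: "p dvd var_x" and y: "p dvd var_y"
    using lin_form_one by (metis pos2, metis one_less_numeral_iff semiring_norm(76))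
  have "degree p = 0" using dvd_imp_degree_le[OF x] by simp
  then obtain c where p: "p = [:c:]" by (metis degree_eq_zeroE)
  have "c dvd 1" using y unfolding p const_poly_dvd_iff by (auto dest: spec[of _ 1])
  then show ?thesis unfolding p by (simp add: is_unit_const_poly_iff)
qed

lemma equiv_unitsI_dvd:
  assumes "f dvd g" and "g dvd f"
  shows "equiv_units f g"
proof -
  obtain a b where a: "g = f * a" and b: "f = g * b" using assms by (metis dvdE)
  show ?thesis
  proof (cases "f = 0")
    case True
    then show ?thesis using a unfolding equiv_units_def by (intro exI[of _ 1]) simp
  next
    case False
    then have "b dvd 1" using a b by (metis dvd_triv_right mult.assoc mult_cancel_left1)
    then obtain c where "b = [:c:]" "c dvd 1" by (auto simp: is_unit_poly_iff)
    moreover from this obtain d where "c = [:d:]" "d dvd 1" by (metis is_unit_poly_iff)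
    ultimately obtain d where "b = const_xy d" "d \<noteq> 0" by auto
    then show ?thesis unfolding equiv_units_def using b by (metis mult.commute)
  qed
qed

lemma equiv_units_imp_dvd:
  assumes "equiv_units f g"
  shows "f dvd g" and "g dvd f"
proof -
  obtain c where c: "c \<noteq> 0" "f = const_xy c * g" using assms unfolding equiv_units_def by blast
  then show "g dvd f" by (metis dvd_triv_right)
  have "g = const_xy (1 / c) * f" unfolding c(2) using c(1) by (simp add: pCons_one)
  then show "f dvd g" by (metis dvd_triv_right)
qed

lemma equiv_units_iff_dvd: "equiv_units f g \<longleftrightarrow> f dvd g \<and> g dvd f"
  by (metis equiv_unitsI_dvd equiv_units_imp_dvd)

section \<open>Alternating matrices\<close>

text \<open>Off-diagonal terms cancel in pairs. The diagonal is assumed to vanish separately because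
  antisymmetry does not imply it in characteristic 2.\<close>

lemma sum_alternating_zero:
  fixes f :: "nat \<Rightarrow> nat \<Rightarrow> 'a :: ab_group_add"
  assumes "\<And>i. i < n \<Longrightarrow> f i i = 0" and "\<And>i j. i < n \<Longrightarrow> j < n \<Longrightarrow> f j i = - f i j"
  shows "(\<Sum>i<n. \<Sum>j<n. f i j) = 0"
  using assms
proof (induction n)
  case (Suc n)
  have "(\<Sum>i<Suc n. \<Sum>j<Suc n. f i j)
      = (\<Sum>i<n. \<Sum>j<n. f i j) + (\<Sum>i<n. f i n) + ((\<Sum>j<n. f n j) + f n n)"
    by (simp add: sum.distrib)
  also have "(\<Sum>j<n. f n j) = - (\<Sum>i<n. f i n)"
  proof -
    have "(\<Sum>j<n. f n j) = (\<Sum>j<n. - f j n)"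
      by (intro sum.cong Suc.prems(2)) auto
    then show ?thesis by (simp add: sum_negf)
  qed
  also have "(\<Sum>i<n. \<Sum>j<n. f i j) = 0" by (intro Suc.IH Suc.prems less_SucI)
  finally show ?case using Suc.prems(1)[of n] by simp
qed (unfold lessThan_0 sum.empty, rule refl)

lemma bilinear_sum:
  fixes A :: "'a :: comm_ring_1 mat"
  assumes "A \<in> carrier_mat n m" "u \<in> carrier_vec n" "v \<in> carrier_vec m"
  shows "u \<bullet> (A *\<^sub>v v) = (\<Sum>i<n. \<Sum>j<m. u $ i * A $$ (i, j) * v $ j)"
proof -
  have "(A *\<^sub>v v) $ i = (\<Sum>j<m. A $$ (i, j) * v $ j)" if "i < n" for i
  proof -
    have "(A *\<^sub>v v) $ i = (\<Sum>j\<in>{0..<m}. row A i $ j * v $ j)"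
      using assms that by (simp only: index_mult_mat_vec carrier_matD scalar_prod_def carrier_vecD)
    also have "\<dots> = (\<Sum>j\<in>{0..<m}. A $$ (i, j) * v $ j)"
      using assms that by (intro sum.cong) auto
    finally show ?thesis by (simp only: lessThan_atLeast0)
  qed
  then have "(\<Sum>i<n. u $ i * (A *\<^sub>v v) $ i) = (\<Sum>i<n. \<Sum>j<m. u $ i * A $$ (i, j) * v $ j)"
    by (intro sum.cong) (simp_all add: sum_distrib_left mult.assoc)
  moreover have "dim_vec (A *\<^sub>v v) = n" using assms by simp
  ultimately show ?thesis unfolding scalar_prod_def by (simp only: lessThan_atLeast0)
qed

lemma bilinear_unit_vec:
  fixes A :: "'a :: comm_ring_1 mat"
  assumes "A \<in> carrier_mat n m" "i < n" "j < m"
  shows "unit_vec n i \<bullet> (A *\<^sub>v unit_vec m j) = A $$ (i, j)"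
proof -
  have "A *\<^sub>v unit_vec m j \<in> carrier_vec n" using assms by simp
  then have "unit_vec n i \<bullet> (A *\<^sub>v unit_vec m j) = (A *\<^sub>v unit_vec m j) $ i"
    using assms(2) by (rule scalar_prod_left_unit)
  also have "\<dots> = row A i \<bullet> unit_vec m j" using assms by (intro index_mult_mat_vec) simp
  also have "\<dots> = A $$ (i, j)" unfolding scalar_prod_right_unit[OF assms(3)] using assms by simp
  finally show ?thesis .
qed

lemma alternating_mat_iff:
  fixes A :: "'a :: field mat"
  assumes A: "A \<in> carrier_mat n n"
  shows "alternating_mat n A \<longleftrightarrow> (\<forall>v\<in>carrier_vec n. v \<bullet> (A *\<^sub>v v) = 0)"
proof
  assume alt: "alternating_mat n A"
  have ent: "A $$ (j, i) = - A $$ (i, j)" if "i < n" "j < n" for i j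
  proof -
    have "transpose_mat A $$ (i, j) = (- A) $$ (i, j)" using alt by (simp add: alternating_mat_def)
    then show ?thesis using that A by simp
  qed
  show "\<forall>v\<in>carrier_vec n. v \<bullet> (A *\<^sub>v v) = 0"
  proof
    fix v :: "'a vec" assume v: "v \<in> carrier_vec n"
    show "v \<bullet> (A *\<^sub>v v) = 0"
      unfolding bilinear_sum[OF A v v]
    proof (rule sum_alternating_zero)
      fix i j assume "i < n" "j < n"
      then show "v $ j * A $$ (j, i) * v $ i = - (v $ i * A $$ (i, j) * v $ j)"
        using ent[of i j] by simp
    qed (use alt in \<open>auto simp: alternating_mat_def\<close>)
  qed
next
  assume *: "\<forall>v\<in>carrier_vec n. v \<bullet> (A *\<^sub>v v) = 0"
  have diag: "A $$ (i, i) = 0" if "i < n" for i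
    using *[rule_format, of "unit_vec n i"] bilinear_unit_vec[OF A that that] by simp
  have "A $$ (i, j) + A $$ (j, i) = 0" if "i < n" "j < n" for i j
  proof -
    have "0 = (unit_vec n i + unit_vec n j) \<bullet> (A *\<^sub>v (unit_vec n i + unit_vec n j))"
      using * by simp
    also have "\<dots> = A $$ (i, i) + A $$ (i, j) + (A $$ (j, i) + A $$ (j, j))"
      using A that
      by (simp add: mult_add_distrib_mat_vec[of _ n n] add_scalar_prod_distrib[of _ n] scalar_prod_add_distrib[of _ n]
          bilinear_unit_vec[OF A] mult_mat_vec_carrier[of _ n n])
    finally show ?thesis using diag that by simp
  qed
  then have "transpose_mat A = - A" using A by (intro eq_matI) (auto simp: eq_neg_iff_add_eq_0)
  then show "alternating_mat n A" using A diag by (simp add: alternating_mat_def)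
qed

lemma alternating_mat_carrier: "alternating_mat n A \<Longrightarrow> A \<in> carrier_mat n n"
  by (simp add: alternating_mat_def)

lemma alternating_mat_add:
  "alternating_mat n A \<Longrightarrow> alternating_mat n B \<Longrightarrow> alternating_mat n (A + B)"
  unfolding alternating_mat_def by (auto simp: transpose_add minus_add_distrib intro!: eq_matI)

lemma alternating_mat_smult: "alternating_mat n A \<Longrightarrow> alternating_mat n (c \<cdot>\<^sub>m A)"
  unfolding alternating_mat_def by (auto simp: intro!: eq_matI) (metis carrier_matD index_uminus_mat(1) mult_minus_right index_transpose_mat(1))

lemma mat_adjoint:
  fixes A :: "'a :: comm_ring_1 mat"
  assumes "A \<in> carrier_mat n m" "u \<in> carrier_vec n" "v \<in> carrier_vec m"
  shows "u \<bullet> (A *\<^sub>v v) = (transpose_mat A *\<^sub>v u) \<bullet> v"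
  by (rule transpose_vec_mult_scalar[OF assms(1,3,2), symmetric])

lemma alternating_mat_congruence:
  fixes A N :: "'a :: field mat"
  assumes A: "alternating_mat n A" and N: "N \<in> carrier_mat n m"
  shows "alternating_mat m (transpose_mat N * A * N)"
proof -
  have cA: "A \<in> carrier_mat n n" by (rule alternating_mat_carrier[OF A])
  have c: "transpose_mat N * A * N \<in> carrier_mat m m" using cA N by simp
  show ?thesis unfolding alternating_mat_iff[OF c]
  proof
    fix v :: "'a vec" assume v: "v \<in> carrier_vec m"
    have Nv: "N *\<^sub>v v \<in> carrier_vec n" using N v by simp
    have "v \<bullet> (transpose_mat N * A * N *\<^sub>v v) = v \<bullet> (transpose_mat N *\<^sub>v (A *\<^sub>v (N *\<^sub>v v)))"
      using cA N v by (simp add: assoc_mult_mat_vec[of _ m n _ m] assoc_mult_mat_vec[of _ m n _ n])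
    also have "\<dots> = (N *\<^sub>v v) \<bullet> (A *\<^sub>v (N *\<^sub>v v))"
      using mat_adjoint[of "transpose_mat N" m n v "A *\<^sub>v (N *\<^sub>v v)"] N v cA Nv by simp
    also have "\<dots> = 0" using A Nv unfolding alternating_mat_iff[OF cA] by blast
    finally show "v \<bullet> (transpose_mat N * A * N *\<^sub>v v) = 0" .
  qed
qed

section \<open>Polynomials over a field\<close>

text \<open>An element of least degree in the ideal generated by \<open>f\<close> and
  \<open>p\<close> divides both. It is then a unit, as otherwise irreducibility would make
  \<open>p\<close> divide it and hence \<open>f\<close>.\<close>

lemma irreducible_bezout:
  fixes p f :: "'a :: field poly"
  assumes p: "irreducible p" and f: "\<not> p dvd f"
  shows "\<exists>a b. a * f + b * p = 1"
proof -
  define I where "I = {a * f + b * p | a b. True}"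
  have "f \<in> I" unfolding I_def by (intro CollectI exI[of _ 1] exI[of _ 0]) simp
  moreover have "f \<noteq> 0" using f by auto
  ultimately obtain d where d: "d \<in> I" "d \<noteq> 0" and min: "\<And>h. h \<in> I \<Longrightarrow> h \<noteq> 0 \<Longrightarrow> degree d \<le> degree h"
    using arg_min_nat_lemma[of "\<lambda>h. h \<in> I \<and> h \<noteq> 0" f degree] by blast
  from d(1) obtain a b where ab: "d = a * f + b * p" unfolding I_def by blast
  have dvd: "d dvd h" if "h \<in> I" for h
  proof (rule ccontr)
    assume "\<not> d dvd h"
    then have nz: "h mod d \<noteq> 0" by (simp add: dvd_eq_mod_eq_0)
    from that obtain a' b' where h: "h = a' * f + b' * p" unfolding I_def by blast
    obtain q where q: "h mod d = h - q * d" by (metis minus_div_mult_eq_mod)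
    have "h - q * d = (a' - q * a) * f + (b' - q * b) * p"
      unfolding h ab by (simp add: algebra_simps)
    then have "h mod d = (a' - q * a) * f + (b' - q * b) * p" unfolding q .
    then have "h mod d \<in> I" unfolding I_def by blast
    then show False using min[OF _ nz] degree_mod_less'[OF d(2) nz] by simp
  qed
  have "d dvd f" using \<open>f \<in> I\<close> by (rule dvd)
  moreover have "p \<in> I" unfolding I_def by (intro CollectI exI[of _ 0] exI[of _ 1]) simp
  then have "d dvd p" by (rule dvd)
  ultimately have "d dvd 1" using irreducibleD'[OF p] f dvd_trans by blast
  then obtain c where "d * c = 1" by (metis dvdE)
  then have "(c * a) * f + (c * b) * p = 1" unfolding ab by (simp add: algebra_simps)
  then show ?thesis by blast
qed

lemma irreducible_power_bezout:
  fixes p f :: "'a :: field poly"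
  assumes "irreducible p" and "\<not> p dvd f"
  obtains a b where "a * f + b * p ^ e = 1"
proof -
  obtain a b where ab: "a * f + b * p = 1" using irreducible_bezout[OF assms] by blast
  have "\<exists>a b. a * f + b * p ^ e = 1"
  proof (induction e)
    case 0
    show ?case by (intro exI[of _ 0] exI[of _ 1]) simp
  next
    case (Suc e)
    then obtain a' b' where ab': "a' * f + b' * p ^ e = 1" by blast
    have "1 = (a * f + b * p) * (a' * f + b' * p ^ e)" using ab ab' by simp
    also have "\<dots> = (a * a' * f + a * b' * p ^ e + b * p * a') * f + (b * b') * p ^ Suc e"
      by (simp add: algebra_simps)
    finally show ?case by metis
  qed
  then show thesis using that by blast
qed

lemma exists_irreducible_dvd:
  fixes f :: "'a :: field poly"
  assumes "degree f > 0"
  obtains p where "irreducible p" "p dvd f"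
proof -
  define P where "P = (\<lambda>h. h dvd f \<and> degree h > 0)"
  have "P f" using assms by (simp add: P_def)
  then obtain p where p: "P p" and min: "\<And>h. P h \<Longrightarrow> degree p \<le> degree h"
    using arg_min_nat_lemma[of P f degree] by blast
  have "irreducible p"
  proof (rule irreducibleI)
    show "p \<noteq> 0" "\<not> p dvd 1" using p by (auto simp: P_def is_unit_iff_degree)
    fix a b assume ab: "p = a * b"
    have nz: "a \<noteq> 0" "b \<noteq> 0" using \<open>p \<noteq> 0\<close> ab by auto
    have "a dvd f" "b dvd f" using p unfolding P_def ab by (auto dest: dvd_mult_left dvd_mult_right)
    then have "degree a = 0 \<or> degree p \<le> degree a" "degree b = 0 \<or> degree p \<le> degree b"
      using min[of a] min[of b] unfolding P_def by auto
    moreover have "degree p = degree a + degree b" using nz ab by (simp add: degree_mult_eq)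
    moreover have "degree p > 0" using p by (simp add: P_def)
    ultimately show "a dvd 1 \<or> b dvd 1" using nz by (auto simp: is_unit_iff_degree)
  qed
  then show thesis using that p by (simp add: P_def)
qed

lemma split_power:
  fixes p f :: "'a :: field poly"
  assumes "degree p > 0" and "f \<noteq> 0"
  obtains e g where "f = p ^ e * g" "\<not> p dvd g"
proof -
  have "\<exists>e g. f = p ^ e * g \<and> \<not> p dvd g"
    using assms(2)
  proof (induction "degree f" arbitrary: f rule: less_induct)
    case less
    show ?case
    proof (cases "p dvd f")
      case True
      then obtain h where h: "f = p * h" by (rule dvdE)
      then have "h \<noteq> 0" "degree h < degree f" using less.prems assms(1) by (auto simp: degree_mult_eq)
      then obtain e g where "h = p ^ e * g" "\<not> p dvd g" using less.hyps by blast
      then show ?thesis unfolding h by (intro exI[of _ "Suc e"] exI[of _ g]) (simp add: mult_ac)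
    next
      case False
      then show ?thesis by (intro exI[of _ 0] exI[of _ f]) simp
    qed
  qed
  then show thesis using that by blast
qed

section \<open>Polynomials in a matrix\<close>

definition poly_mat :: "nat \<Rightarrow> 'a :: field mat \<Rightarrow> 'a poly \<Rightarrow> 'a mat" where
  "poly_mat n S f = fold_coeffs (\<lambda>a M. a \<cdot>\<^sub>m 1\<^sub>m n + S * M) f (0\<^sub>m n n)"

context
  fixes n :: nat and S :: "'a :: field mat"
  assumes S: "S \<in> carrier_mat n n"
begin

lemma poly_mat_0: "poly_mat n S 0 = 0\<^sub>m n n"
  by (simp add: poly_mat_def)

lemma poly_mat_pCons: "poly_mat n S (pCons a f) = a \<cdot>\<^sub>m 1\<^sub>m n + S * poly_mat n S f"
proof (cases "a = 0 \<and> f = 0")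
  case True
  then show ?thesis using S by (auto simp: poly_mat_0 intro!: eq_matI)
qed (auto simp: poly_mat_def)

lemma poly_mat_carrier: "poly_mat n S f \<in> carrier_mat n n"
  by (induction f) (use S in \<open>auto simp: poly_mat_0 poly_mat_pCons\<close>)

lemmas poly_mat_rules = poly_mat_carrier S
  mult_add_distrib_mat[of _ n n _ n] add_mult_distrib_mat[of _ n n _ _ n]
  mult_smult_distrib[of _ n n _ n] mult_smult_assoc_mat[of _ n n _ n] assoc_mult_mat[of _ n n _ n _ n]
  mult_carrier_mat[of _ n n _ n]

lemma poly_mat_add: "poly_mat n S (f + g) = poly_mat n S f + poly_mat n S g"
proof (induction f g rule: poly_induct2)
  case (pCons a f b g)
  have "poly_mat n S (pCons a f + pCons b g)
      = (a + b) \<cdot>\<^sub>m 1\<^sub>m n + (S * poly_mat n S f + S * poly_mat n S g)"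
    unfolding add_pCons poly_mat_pCons pCons by (simp add: poly_mat_rules)
  also have "\<dots> = a \<cdot>\<^sub>m 1\<^sub>m n + S * poly_mat n S f + (b \<cdot>\<^sub>m 1\<^sub>m n + S * poly_mat n S g)"
    using mult_carrier_mat[OF S poly_mat_carrier[of f]] mult_carrier_mat[OF S poly_mat_carrier[of g]]
    by (intro eq_matI) (auto simp: algebra_simps carrier_matD[OF S] carrier_matD[OF poly_mat_carrier] simp del: index_mult_mat(1))
  finally show ?case unfolding poly_mat_pCons .
qed (simp add: poly_mat_0)

lemma poly_mat_smult: "poly_mat n S (Polynomial.smult c f) = c \<cdot>\<^sub>m poly_mat n S f"
proof (induction f)
  case (pCons a f)
  have "poly_mat n S (Polynomial.smult c (pCons a f)) = (c * a) \<cdot>\<^sub>m 1\<^sub>m n + c \<cdot>\<^sub>m (S * poly_mat n S f)"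
    unfolding smult_pCons poly_mat_pCons pCons by (simp add: poly_mat_rules)
  also have "\<dots> = c \<cdot>\<^sub>m (a \<cdot>\<^sub>m 1\<^sub>m n + S * poly_mat n S f)"
    using mult_carrier_mat[OF S poly_mat_carrier[of f]]
    by (intro eq_matI) (auto simp: algebra_simps carrier_matD[OF S] carrier_matD[OF poly_mat_carrier] simp del: index_mult_mat(1))
  finally show ?case unfolding poly_mat_pCons .
qed (auto simp: poly_mat_0)

lemma poly_mat_mult: "poly_mat n S (f * g) = poly_mat n S f * poly_mat n S g"
proof (induction f)
  case (pCons a f)
  have "poly_mat n S (pCons a f * g) = a \<cdot>\<^sub>m poly_mat n S g + (0 \<cdot>\<^sub>m 1\<^sub>m n + S * (poly_mat n S f * poly_mat n S g))"
    unfolding mult_pCons_left poly_mat_add poly_mat_smult poly_mat_pCons pCons ..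
  also have "0 \<cdot>\<^sub>m 1\<^sub>m n + S * (poly_mat n S f * poly_mat n S g) = S * (poly_mat n S f * poly_mat n S g)"
    using mult_carrier_mat[OF S mult_carrier_mat[OF poly_mat_carrier[of f] poly_mat_carrier[of g]]]
    by (intro eq_matI) (auto simp: carrier_matD[OF S] carrier_matD[OF poly_mat_carrier] simp del: index_mult_mat(1))
  finally show ?case unfolding poly_mat_pCons
    by (simp add: poly_mat_rules left_mult_one_mat[OF poly_mat_carrier])
qed (simp add: poly_mat_0 left_mult_zero_mat[OF poly_mat_carrier])

lemma poly_mat_comm: "poly_mat n S f * poly_mat n S g = poly_mat n S g * poly_mat n S f"
  unfolding poly_mat_mult[symmetric] by (simp only: mult.commute)

lemma poly_mat_1: "poly_mat n S 1 = 1\<^sub>m n"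
  using poly_mat_pCons[of 1 0] S by (auto simp: poly_mat_0 pCons_one intro!: eq_matI)

lemma poly_mat_X: "poly_mat n S [:0, 1:] = S"
  using S poly_mat_pCons[of 0 1] by (auto simp: poly_mat_1 pCons_one intro!: eq_matI)

lemma poly_mat_S_comm: "S * poly_mat n S f = poly_mat n S f * S"
  using poly_mat_comm[of "[:0, 1:]" f] by (simp add: poly_mat_X)

text \<open>Applied below with \<open>L\<close> a matrix entry and with \<open>L\<close> a
  coordinate of the image of a fixed vector.\<close>

lemma linear_poly_mat_sum:
  fixes L :: "'a mat \<Rightarrow> 'a" and k :: nat
  assumes add: "\<And>A B. A \<in> carrier_mat n n \<Longrightarrow> B \<in> carrier_mat n n \<Longrightarrow> L (A + B) = L A + L B"
    and smult: "\<And>c A. A \<in> carrier_mat n n \<Longrightarrow> L (c \<cdot>\<^sub>m A) = c * L A"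
  shows "L (poly_mat n S (\<Sum>i<k. Polynomial.smult (c i) (q i))) = (\<Sum>i<k. c i * L (poly_mat n S (q i)))"
proof (induction k)
  case 0
  have "L (0\<^sub>m n n) = L (0 \<cdot>\<^sub>m 0\<^sub>m n n)" by (rule arg_cong[of _ _ L]) auto
  also have "\<dots> = 0" by (subst smult) auto
  finally show ?case by (simp add: poly_mat_0)
next
  case (Suc k)
  then show ?case by (simp add: poly_mat_add poly_mat_smult add smult poly_mat_carrier)
qed

text \<open>The \<open>n * n + 1\<close> powers of \<open>S\<close> are linearly dependent in a
  space of dimension \<open>n * n\<close>; the columns of \<open>M\<close> are these powers written
  out as vectors.\<close>

lemma exists_annihilator: "\<exists>f. f \<noteq> 0 \<and> poly_mat n S f = 0\<^sub>m n n"
proof -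
  define M where "M = mat (n * n) (Suc (n * n)) (\<lambda>(a, i). poly_mat n S (monom 1 i) $$ (a div n, a mod n))"
  have M: "M \<in> carrier_mat (n * n) (Suc (n * n))" by (simp add: M_def)
  obtain v where v: "v \<in> carrier_vec (Suc (n * n))" "v \<noteq> 0\<^sub>v (Suc (n * n))" "M *\<^sub>v v = 0\<^sub>v (n * n)"
    by (rule wide_mat_kernel[OF M]) auto
  define f where "f = (\<Sum>i<Suc (n * n). Polynomial.smult (v $ i) (monom 1 i))"
  have cf: "coeff f i = v $ i" if "i < Suc (n * n)" for i
    using that unfolding f_def by (simp add: coeff_sum sum.delta if_distrib[of "\<lambda>x. _ * x"] cong: if_cong del: sum.lessThan_Suc)
  obtain i where "i < Suc (n * n)" "v $ i \<noteq> 0" using v by (metis eq_vecI index_zero_vec carrier_vecD)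
  then have "f \<noteq> 0" using cf by force
  moreover have "poly_mat n S f = 0\<^sub>m n n"
  proof (rule eq_matI)
    fix a b assume "a < dim_row (0\<^sub>m n n :: 'a mat)" "b < dim_col (0\<^sub>m n n :: 'a mat)"
    then have ab: "a < n" "b < n" by auto
    define k where "k = a * n + b"
    have "b + a * n < n + a * n" using ab by simp
    also have "\<dots> = Suc a * n" by simp
    also have "\<dots> \<le> n * n" using ab by (intro mult_le_mono1) simp
    finally have k: "k < n * n" "k div n = a" "k mod n = b" using ab by (auto simp: k_def)
    have "poly_mat n S f $$ (a, b) = (\<Sum>i<Suc (n * n). v $ i * poly_mat n S (monom 1 i) $$ (a, b))"
      unfolding f_def by (rule linear_poly_mat_sum[where L = "\<lambda>A. A $$ (a, b)"]) (use ab in auto)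
    also have "\<dots> = (M *\<^sub>v v) $ k"
    proof -
      have "(M *\<^sub>v v) $ k = (\<Sum>i\<in>{0..<Suc (n * n)}. row M k $ i * v $ i)"
        using v(1) M k(1) by (simp only: index_mult_mat_vec carrier_matD scalar_prod_def carrier_vecD)
      also have "\<dots> = (\<Sum>i\<in>{0..<Suc (n * n)}. v $ i * poly_mat n S (monom 1 i) $$ (a, b))"
        using k by (intro sum.cong) (auto simp: M_def)
      finally show ?thesis by (simp only: lessThan_atLeast0)
    qed
    also have "\<dots> = 0" unfolding v(3) using k by simp
    finally show "poly_mat n S f $$ (a, b) = 0\<^sub>m n n $$ (a, b)" using ab by simp
  qed (use poly_mat_carrier[of f] in auto)
  ultimately show ?thesis by blast
qed

lemma exists_minimal_polynomial:
  obtains \<mu> where "lead_coeff \<mu> = 1" "\<And>f. poly_mat n S f = 0\<^sub>m n n \<longleftrightarrow> \<mu> dvd f"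
proof -
  define P where "P = (\<lambda>f. f \<noteq> 0 \<and> poly_mat n S f = 0\<^sub>m n n)"
  obtain f where "P f" using exists_annihilator unfolding P_def by blast
  then obtain m where m: "P m" and min: "\<And>h. P h \<Longrightarrow> degree m \<le> degree h"
    using arg_min_nat_lemma[of P f degree] by blast
  have 0: "poly_mat n S (m * f) = 0\<^sub>m n n" for f
    using m poly_mat_carrier[of f] unfolding poly_mat_mult P_def by auto
  have iff: "poly_mat n S f = 0\<^sub>m n n \<longleftrightarrow> m dvd f" for f
  proof
    assume f: "poly_mat n S f = 0\<^sub>m n n"
    have "poly_mat n S f = poly_mat n S (m * (f div m)) + poly_mat n S (f mod m)"
      unfolding poly_mat_add[symmetric] by simp
    then have "poly_mat n S (f mod m) = 0\<^sub>m n n"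
      unfolding f 0 using poly_mat_carrier[of "f mod m"] by simp
    then have "f mod m = 0" using min[of "f mod m"] degree_mod_less'[of m f] m unfolding P_def by fastforce
    then show "m dvd f" by (simp add: dvd_eq_mod_eq_0)
  qed (use 0 in auto)
  have "lead_coeff m \<noteq> 0" using m by (simp add: P_def)
  then show thesis
    by (intro that[of "Polynomial.smult (1 / lead_coeff m) m"]) (auto simp: iff smult_dvd_iff)
qed

end

section \<open>Normal form of an indecomposable sloped pair\<close>

text \<open>An idempotent that is self-adjoint for both forms is the projection of an orthogonal
  decomposition.\<close>

definition indecomposable :: "nat \<Rightarrow> 'a :: field mat \<times> 'a mat \<Rightarrow> bool" where
  "indecomposable n B \<longleftrightarrow> (\<forall>E\<in>carrier_mat n n. E * E = E \<and>
     transpose_mat E * fst B = fst B * E \<and> transpose_mat E * snd B = snd B * E \<longrightarrow>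
     E = 0\<^sub>m n n \<or> E = 1\<^sub>m n)"

text \<open>The rows of \<open>companion r f\<close> are the coordinates of \<open>t \<cdot> t\<^sup>i\<close> modulo \<open>f\<close>.\<close>

definition companion :: "nat \<Rightarrow> 'a :: field poly \<Rightarrow> 'a mat" where
  "companion r f = mat r r (\<lambda>(i, j). if Suc i < r then (if j = Suc i then 1 else 0) else - coeff f j)"

text \<open>Two matrices side by side, encoded as a block matrix with empty lower blocks so that the
  block multiplication rules apply.\<close>

definition hcat :: "nat \<Rightarrow> nat \<Rightarrow> 'a :: zero mat \<Rightarrow> 'a mat \<Rightarrow> 'a mat" where
  "hcat n r U W = four_block_mat U W (0\<^sub>m 0 r) (0\<^sub>m 0 r)"

lemma hcat_carrier:
  "U \<in> carrier_mat n r \<Longrightarrow> W \<in> carrier_mat n r \<Longrightarrow> hcat n r U W \<in> carrier_mat n (r + r)"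
  unfolding hcat_def using four_block_carrier_mat[of U n r "0\<^sub>m 0 r" 0 r W "0\<^sub>m 0 r"] by auto

lemma transpose_smult_mat: "transpose_mat (c \<cdot>\<^sub>m M) = c \<cdot>\<^sub>m transpose_mat M"
  by (rule eq_matI) auto

lemma mult_hcat:
  fixes M :: "'a :: comm_ring_1 mat"
  assumes M: "M \<in> carrier_mat m n" and U: "U \<in> carrier_mat n r" and W: "W \<in> carrier_mat n r"
  shows "M * hcat n r U W = hcat m r (M * U) (M * W)"
proof -
  have "M = four_block_mat M (0\<^sub>m m 0) (0\<^sub>m 0 n) (0\<^sub>m 0 0)" using M by (intro eq_matI) auto
  then have "M * hcat n r U W = four_block_mat M (0\<^sub>m m 0) (0\<^sub>m 0 n) (0\<^sub>m 0 0) * hcat n r U W" by simp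
  also have "\<dots> = hcat m r (M * U) (M * W)"
    unfolding hcat_def using M U W
    by (subst mult_four_block_mat[of _ m n _ 0 _ 0 _ _ r _ r]) (auto intro!: cong_four_block_mat)
  finally show ?thesis .
qed

lemma hcat_mult:
  fixes U :: "'a :: comm_ring_1 mat"
  assumes U: "U \<in> carrier_mat n r" and W: "W \<in> carrier_mat n r"
    and D: "A \<in> carrier_mat r r" "B \<in> carrier_mat r r" "C \<in> carrier_mat r r" "D \<in> carrier_mat r r"
  shows "hcat n r U W * four_block_mat A B C D = hcat n r (U * A + W * C) (U * B + W * D)"
  unfolding hcat_def using assms
  by (subst mult_four_block_mat[of _ n r _ r _ 0 _ _ r _ r]) (auto intro!: cong_four_block_mat)

lemma transpose_hcat_mult_hcat:
  fixes U :: "'a :: comm_ring_1 mat"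
  assumes U: "U \<in> carrier_mat n r" "W \<in> carrier_mat n r" and V: "U' \<in> carrier_mat n r" "W' \<in> carrier_mat n r"
  shows "transpose_mat (hcat n r U W) * hcat n r U' W' = four_block_mat
    (transpose_mat U * U') (transpose_mat U * W') (transpose_mat W * U') (transpose_mat W * W')"
proof -
  have "transpose_mat (hcat n r U W)
      = four_block_mat (transpose_mat U) (0\<^sub>m r 0) (transpose_mat W) (0\<^sub>m r 0)"
    unfolding hcat_def using U by (subst transpose_four_block_mat[of _ n r _ r _ 0]) auto
  then show ?thesis unfolding hcat_def using U V
    by simp (subst mult_four_block_mat[of _ r n _ 0 _ r _ _ r _ r], auto intro!: cong_four_block_mat)
qed

lemma hyperbolic_one_square:
  "hyperbolic r (1\<^sub>m r) * hyperbolic r (1\<^sub>m r) = - (1\<^sub>m (r + r) :: 'a :: field mat)"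
  unfolding hyperbolic_def
  by (subst mult_four_block_mat[of _ r r _ r _ r _ _ r _ r]) (auto intro!: eq_matI)

lemma hyperbolic_carrier: "A \<in> carrier_mat r r \<Longrightarrow> hyperbolic r A \<in> carrier_mat (r + r) (r + r)"
  unfolding hyperbolic_def by simp

lemma transpose_hyperbolic:
  "A \<in> carrier_mat r r \<Longrightarrow> transpose_mat (hyperbolic r A) = - hyperbolic r A"
  unfolding hyperbolic_def by (auto intro!: eq_matI)

text \<open>The sign of \<open>S\<close> is chosen so that \<open>A * S = - B\<close>, that is
  \<open>x A + y B = A (x - y S)\<close>. The submodules for \<open>S\<close> then carry the
  structure of the whole pair.\<close>

locale sloped_pair =
  fixes n :: nat and A B A' S :: "'a :: field mat"
  assumes A: "alternating_mat n A" and B: "alternating_mat n B"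
    and A': "A' \<in> carrier_mat n n" "A * A' = 1\<^sub>m n" "A' * A = 1\<^sub>m n"
    and indec: "indecomposable n (A, B)" and n: "n > 0"
    and S_def: "S = - (A' * B)"
begin

lemma cA: "A \<in> carrier_mat n n" using A by (rule alternating_mat_carrier)
lemma cB: "B \<in> carrier_mat n n" using B by (rule alternating_mat_carrier)
lemma S: "S \<in> carrier_mat n n" unfolding S_def using A'(1) cB by simp

abbreviation pm :: "'a poly \<Rightarrow> 'a mat" where "pm \<equiv> poly_mat n S"

lemmas pm = poly_mat_carrier[OF S]

lemma transpose_A: "transpose_mat A = - A" and transpose_B: "transpose_mat B = - B"
  using A B by (auto simp: alternating_mat_def)

lemma A_mult_S: "A * S = - B"
proof -
  have "A * S = - (A * A' * B)" unfolding S_def using cA cB A'(1)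
    by (simp add: mult_minus_distrib_mat uminus_mult_right_mat assoc_mult_mat[of _ n n _ n _ n])
  then show ?thesis using A'(2) cB by simp
qed

lemma S_adjoint: "transpose_mat S * A = A * S"
proof -
  have "transpose_mat (A * S) = transpose_mat S * (- A)"
    using transpose_mult[OF cA S] by (simp add: transpose_A)
  also have "\<dots> = - (transpose_mat S * A)" using S cA by simp
  finally have "- (transpose_mat S * A) = B" unfolding A_mult_S by (simp add: transpose_uminus transpose_B)
  then have "transpose_mat S * A = - B" by (metis uminus_uminus_mat)
  then show ?thesis unfolding A_mult_S .
qed

lemmas form_rules = cA cB S pm A'(1)
  mult_add_distrib_mat[of _ n n _ n] add_mult_distrib_mat[of _ n n _ _ n]
  mult_smult_distrib[of _ n n _ n] mult_smult_assoc_mat[of _ n n _ n] assoc_mult_mat[of _ n n _ n _ n]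
  mult_carrier_mat[of _ n n _ n]

lemma poly_adjoint_A: "transpose_mat (pm f) * A = A * pm f"
proof (induction f)
  case 0
  then show ?case using cA by (simp add: poly_mat_0[OF S])
next
  case (pCons a f)
  have "transpose_mat (pm (pCons a f)) * A = a \<cdot>\<^sub>m A + transpose_mat (pm f) * (transpose_mat S * A)"
    unfolding poly_mat_pCons[OF S] using pm[of f] S cA
    by (simp add: transpose_add[of _ n n] transpose_mult[of _ n n _ n] transpose_smult_mat
        add_mult_distrib_mat[of _ n n _ _ n] mult_smult_assoc_mat[of _ n n _ n] assoc_mult_mat[of _ n n _ n _ n])
  also have "transpose_mat (pm f) * (transpose_mat S * A) = (transpose_mat (pm f) * A) * S"
    unfolding S_adjoint using pm[of f] S cA by (simp add: assoc_mult_mat[of _ n n _ n _ n])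
  also have "\<dots> = A * (S * pm f)"
    unfolding pCons poly_mat_S_comm[OF S] using pm[of f] S cA by (simp add: assoc_mult_mat[of _ n n _ n _ n])
  also have "a \<cdot>\<^sub>m A + A * (S * pm f) = A * pm (pCons a f)"
    unfolding poly_mat_pCons[OF S] using pm[of f] S cA by (simp add: form_rules right_mult_one_mat[OF cA])
  finally show ?case .
qed

text \<open>\<open>B = - (A * S)\<close> and polynomials in \<open>S\<close> commute with
  \<open>S\<close>. Together with the statement for \<open>A\<close>, idempotents among these
  polynomials become subject to \<open>indecomposable\<close>.\<close>

lemma poly_adjoint_B: "transpose_mat (pm f) * B = B * pm f"
proof -
  have B: "B = - (A * S)" unfolding A_mult_S by simp
  have "transpose_mat (pm f) * B = - (transpose_mat (pm f) * A * S)"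
    unfolding B using pm[of f] cA S by (simp add: assoc_mult_mat[of _ n n _ n _ n])
  also have "\<dots> = - (A * (S * pm f))"
    unfolding poly_adjoint_A poly_mat_S_comm[OF S] using pm[of f] cA S by (simp add: assoc_mult_mat[of _ n n _ n _ n])
  also have "\<dots> = B * pm f"
    unfolding B using pm[of f] cA S by (simp add: assoc_mult_mat[of _ n n _ n _ n])
  finally show ?thesis .
qed

text \<open>Self-adjointness yields skew symmetry, but characteristic 2 also requires a zero
  diagonal. The two claims support each other: \<open>A * S * (a + S f)\<close> is a multiple of
  \<open>B\<close> plus the congruence transform of \<open>A * f\<close> by \<open>S\<close>, and
  congruence preserves alternating forms.\<close>

lemma alternating_A_pm: "alternating_mat n (A * pm f) \<and> alternating_mat n (A * (S * pm f))"
proof (induction f)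
  case 0
  have "alternating_mat n (0\<^sub>m n n)" by (auto simp: alternating_mat_def)
  then show ?case using cA S by (simp add: poly_mat_0[OF S])
next
  case (pCons a f)
  have "A * pm (pCons a f) = a \<cdot>\<^sub>m A + A * (S * pm f)"
    unfolding poly_mat_pCons[OF S] using pm[of f] S cA by (simp add: form_rules right_mult_one_mat[OF cA])
  moreover have "A * (S * pm (pCons a f)) = a \<cdot>\<^sub>m (- B) + transpose_mat S * (A * pm f) * S"
  proof -
    have "A * (S * pm (pCons a f)) = a \<cdot>\<^sub>m (A * S) + (A * S) * (S * pm f)"
      unfolding poly_mat_pCons[OF S] using pm[of f] S cA by (simp add: form_rules right_mult_one_mat[OF S])
    also have "(A * S) * (S * pm f) = transpose_mat S * (A * pm f) * S"
      unfolding S_adjoint[symmetric] poly_mat_S_comm[OF S] using pm[of f] S cA by (simp add: assoc_mult_mat[of _ n n _ n _ n])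
    finally show ?thesis unfolding A_mult_S .
  qed
  moreover have "alternating_mat n (- B)"
    using B unfolding alternating_mat_def by (auto simp: transpose_uminus)
  ultimately show ?case
    using pCons A alternating_mat_add alternating_mat_smult alternating_mat_congruence[OF _ S] by metis
qed

lemma form_pm:
  assumes "u \<in> carrier_vec n" "v \<in> carrier_vec n"
  shows "(pm f *\<^sub>v u) \<bullet> (A *\<^sub>v (pm g *\<^sub>v v)) = u \<bullet> (A *\<^sub>v (pm (f * g) *\<^sub>v v))"
proof -
  have "(pm f *\<^sub>v u) \<bullet> (A *\<^sub>v (pm g *\<^sub>v v)) = u \<bullet> (transpose_mat (pm f) *\<^sub>v (A *\<^sub>v (pm g *\<^sub>v v)))"
    using mat_adjoint[of "transpose_mat (pm f)" n n u "A *\<^sub>v (pm g *\<^sub>v v)"] pm[of f] pm[of g] cA assms by simp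
  also have "transpose_mat (pm f) *\<^sub>v (A *\<^sub>v (pm g *\<^sub>v v)) = (transpose_mat (pm f) * A) *\<^sub>v (pm g *\<^sub>v v)"
    using pm[of f] pm[of g] cA assms by (subst assoc_mult_mat_vec[of _ n n _ n]) auto
  also have "\<dots> = A *\<^sub>v (pm (f * g) *\<^sub>v v)"
    unfolding poly_adjoint_A poly_mat_mult[OF S] using pm[of f] pm[of g] cA assms
    by (simp add: assoc_mult_mat_vec[of _ n n _ n])
  finally show ?thesis .
qed

text \<open>Moving \<open>f\<close> across the form turns the value into the diagonal value at
  \<open>u\<close> of the alternating form \<open>A * pm (f * g)\<close>. Hence cyclic modules are
  totally isotropic.\<close>

lemma form_isotropic:
  assumes "u \<in> carrier_vec n"
  shows "(pm f *\<^sub>v u) \<bullet> (A *\<^sub>v (pm g *\<^sub>v u)) = 0"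
proof -
  have "u \<bullet> (A *\<^sub>v (pm (f * g) *\<^sub>v u)) = u \<bullet> ((A * pm (f * g)) *\<^sub>v u)"
    using cA pm[of "f * g"] assms by (simp add: assoc_mult_mat_vec[of _ n n _ n])
  also have "\<dots> = 0"
    using alternating_A_pm[of "f * g"] alternating_mat_iff[of "A * pm (f * g)" n] cA pm[of "f * g"] assms by auto
  finally show ?thesis using form_pm[OF assms assms] by simp
qed

text \<open>If \<open>\<mu> = p ^ e * g\<close> with \<open>p\<close> not dividing \<open>g\<close>,
  a Bezout relation \<open>a * g + b * p ^ e = 1\<close> makes \<open>pm (a * g)\<close> a
  self-adjoint idempotent. It cannot vanish, since \<open>p\<close> does not divide
  \<open>a * g\<close>; so it is the identity, and then \<open>g\<close> is a unit.\<close>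

lemma minimal_polynomial_primary:
  obtains \<mu> p e c where "lead_coeff \<mu> = 1" "\<And>f. pm f = 0\<^sub>m n n \<longleftrightarrow> \<mu> dvd f"
    "irreducible p" "e > 0" "c \<noteq> 0" "\<mu> = Polynomial.smult c (p ^ e)"
proof -
  obtain \<mu> where \<mu>: "lead_coeff \<mu> = 1" "\<And>f. pm f = 0\<^sub>m n n \<longleftrightarrow> \<mu> dvd f"
    using exists_minimal_polynomial[OF S] by blast
  have one: "1\<^sub>m n \<noteq> (0\<^sub>m n n :: 'a mat)"
    using n by (metis index_one_mat(1) index_zero_mat(1) zero_neq_one)
  have "\<not> \<mu> dvd 1" using \<mu>(2)[of 1] one by (simp add: poly_mat_1[OF S])
  moreover have nz: "\<mu> \<noteq> 0" using \<mu>(1) by auto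
  ultimately have "degree \<mu> > 0" by (simp add: is_unit_iff_degree)
  then obtain p where p: "irreducible p" "p dvd \<mu>" by (rule exists_irreducible_dvd)
  have pdeg: "degree p > 0" using p(1) by (metis irreducible_def is_unit_iff_degree neq0_conv)
  obtain e g where eg: "\<mu> = p ^ e * g" "\<not> p dvd g" using split_power[OF pdeg nz] by blast
  have e: "e > 0" using eg p(2) by (cases e) auto
  obtain a b where ab: "a * g + b * p ^ e = 1" using irreducible_power_bezout[OF p(1) eg(2)] by blast
  let ?E = "pm (a * g)"
  have pe: "p dvd p ^ e" using e by (metis dvd_power)
  have "?E = 0\<^sub>m n n \<or> ?E = 1\<^sub>m n"
  proof -
    have "a * g * (a * g) = a * g + Polynomial.smult (- 1) (a * b * \<mu>)"
    proof -
      have "a * g * (a * g) = a * g * (1 - b * p ^ e)" using ab by (metis add_diff_cancel_right')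
      then show ?thesis unfolding eg(1) by (simp add: algebra_simps)
    qed
    then have "?E * ?E = ?E + pm (Polynomial.smult (- 1) (a * b * \<mu>))"
      unfolding poly_mat_mult[OF S, symmetric] poly_mat_add[OF S, symmetric] by simp
    also have "pm (Polynomial.smult (- 1) (a * b * \<mu>)) = 0\<^sub>m n n" unfolding \<mu>(2) by simp
    finally have "?E * ?E = ?E" using pm[of "a * g"] by simp
    then show ?thesis
      using indec pm[of "a * g"] poly_adjoint_A[of "a * g"] poly_adjoint_B[of "a * g"] unfolding indecomposable_def by simp
  qed
  moreover have "?E \<noteq> 0\<^sub>m n n"
  proof
    assume "?E = 0\<^sub>m n n"
    then have "p dvd a * g" unfolding \<mu>(2) using p(2) dvd_trans by blast
    then have "p dvd a * g + b * p ^ e" using pe by (intro dvd_add dvd_mult[of p "p ^ e"])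
    then have "p dvd 1" unfolding ab .
    with p(1) show False using irreducible_not_unit by blast
  qed
  moreover have "g dvd 1" if "?E = 1\<^sub>m n"
  proof -
    have "pm (a * g) + pm (b * p ^ e) = pm 1" unfolding poly_mat_add[OF S, symmetric] ab ..
    then have eq: "1\<^sub>m n + pm (b * p ^ e) = 1\<^sub>m n" unfolding that poly_mat_1[OF S] .
    have "pm (b * p ^ e) = 0\<^sub>m n n"
    proof (rule eq_matI)
      fix i j assume "i < dim_row (0\<^sub>m n n :: 'a mat)" "j < dim_col (0\<^sub>m n n :: 'a mat)"
      then have ij: "i < n" "j < n" by auto
      have "(1\<^sub>m n + pm (b * p ^ e)) $$ (i, j) = 1\<^sub>m n $$ (i, j)" unfolding eq ..
      then show "pm (b * p ^ e) $$ (i, j) = 0\<^sub>m n n $$ (i, j)"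
        using ij pm[of "b * p ^ e"] by simp
    qed (use pm[of "b * p ^ e"] in auto)
    then have "g dvd b * p ^ e" unfolding \<mu>(2) eg(1) by (rule dvd_mult_right)
    then have "g dvd a * g + b * p ^ e" by (intro dvd_add) auto
    then show ?thesis unfolding ab .
  qed
  ultimately have "g dvd 1" by blast
  then obtain c where "g = [:c:]" "c dvd 1" by (metis is_unit_poly_iff)
  then have c: "g = [:c:]" "c \<noteq> 0" by auto
  show thesis
    by (rule that[OF \<mu> p(1) e c(2)]) (simp add: eg(1) c(1))
qed

end

context sloped_pair
begin

section \<open>Bases \<open>u, S u, S^2 u, ...\<close> of cyclic submodules\<close>

definition krylov :: "nat \<Rightarrow> 'a vec \<Rightarrow> 'a mat" where
  "krylov r u = mat n r (\<lambda>(a, i). (pm (monom 1 i) *\<^sub>v u) $ a)"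

lemma krylov_carrier: "krylov r u \<in> carrier_mat n r"
  by (simp add: krylov_def)

lemma krylov_col: "i < r \<Longrightarrow> u \<in> carrier_vec n \<Longrightarrow> col (krylov r u) i = pm (monom 1 i) *\<^sub>v u"
  using pm[of "monom 1 i"] by (intro eq_vecI) (auto simp: krylov_def)

lemma krylov_mult_vec:
  assumes u: "u \<in> carrier_vec n" and f: "\<And>i. i \<ge> r \<Longrightarrow> coeff f i = 0"
  shows "krylov r u *\<^sub>v vec r (coeff f) = pm f *\<^sub>v u"
proof (rule eq_vecI)
  fix a assume "a < dim_vec (pm f *\<^sub>v u)"
  then have a: "a < n" using pm[of f] by simp
  have sum: "f = (\<Sum>i<r. Polynomial.smult (coeff f i) (monom 1 i))"
    by (rule poly_eqI) (use f in \<open>auto simp: coeff_sum smult_monom not_less\<close>)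
  have add: "((M + N) *\<^sub>v u) $ a = (M *\<^sub>v u) $ a + (N *\<^sub>v u) $ a"
    if "M \<in> carrier_mat n n" "N \<in> carrier_mat n n" for M N :: "'a mat"
    using that u a by (simp add: add_scalar_prod_distrib[of _ n])
  have smult: "((x \<cdot>\<^sub>m M) *\<^sub>v u) $ a = x * (M *\<^sub>v u) $ a" if "M \<in> carrier_mat n n" for x and M :: "'a mat"
    using that u a by simp
  have "(pm f *\<^sub>v u) $ a = (\<Sum>i<r. coeff f i * (pm (monom 1 i) *\<^sub>v u) $ a)"
    by (subst (1) sum, rule linear_poly_mat_sum[OF S, where L = "\<lambda>M. (M *\<^sub>v u) $ a"], rule add, assumption+, rule smult)
  moreover have "(krylov r u *\<^sub>v vec r (coeff f)) $ a = (\<Sum>i<r. (pm (monom 1 i) *\<^sub>v u) $ a * coeff f i)"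
  proof -
    have "(krylov r u *\<^sub>v vec r (coeff f)) $ a = (\<Sum>i\<in>{0..<r}. row (krylov r u) a $ i * vec r (coeff f) $ i)"
      using a krylov_carrier[of r u] by (simp only: index_mult_mat_vec carrier_matD scalar_prod_def dim_vec)
    also have "\<dots> = (\<Sum>i\<in>{0..<r}. (pm (monom 1 i) *\<^sub>v u) $ a * coeff f i)"
      using a by (intro sum.cong) (auto simp: krylov_def)
    finally show ?thesis by (simp only: lessThan_atLeast0)
  qed
  ultimately show "(krylov r u *\<^sub>v vec r (coeff f)) $ a = (pm f *\<^sub>v u) $ a" by (simp only: mult.commute)
qed (use pm[of f] krylov_carrier[of r u] in auto)

lemma S_krylov:
  assumes u: "u \<in> carrier_vec n" and \<mu>: "lead_coeff \<mu> = 1" "pm \<mu> = 0\<^sub>m n n" and r: "degree \<mu> = r"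
  shows "S * krylov r u = krylov r u * transpose_mat (companion r \<mu>)"
proof (rule mat_col_eqI)
  have cC: "transpose_mat (companion r \<mu>) \<in> carrier_mat r r" by (simp add: companion_def)
  fix j assume "j < dim_col (krylov r u * transpose_mat (companion r \<mu>))"
  then have j: "j < r" using cC by simp
  have "col (S * krylov r u) j = S *\<^sub>v (pm (monom 1 j) *\<^sub>v u)"
    by (simp only: col_mult2[OF S krylov_carrier j] krylov_col[OF j u])
  also have "\<dots> = pm (monom 1 (Suc j)) *\<^sub>v u"
  proof -
    have "pm (monom 1 (Suc j)) = pm ([:0, 1:] * monom 1 j)"
      by (rule arg_cong[of _ _ pm]) (simp add: monom_Suc)
    then show ?thesis unfolding poly_mat_mult[OF S] poly_mat_X[OF S]
      using S pm[of "monom 1 j"] u by (simp add: assoc_mult_mat_vec[of _ n n _ n])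
  qed
  finally have L: "col (S * krylov r u) j = pm (monom 1 (Suc j)) *\<^sub>v u" .
  \<comment> \<open>The remainder of \<open>t ^ (j + 1)\<close> modulo the monic
    \<open>\<mu>\<close>. Its coefficient vector is row \<open>j\<close> of the companion matrix,
    hence column \<open>j\<close> of the transpose.\<close>
  define f where "f = (if Suc j < r then monom 1 (Suc j) else monom 1 r - \<mu>)"
  have cf: "coeff f i = 0" if "i \<ge> r" for i
    using that \<mu>(1) r by (auto simp: f_def coeff_eq_0 le_less)
  have "col (transpose_mat (companion r \<mu>)) j = vec r (coeff f)"
    using j by (intro eq_vecI) (auto simp: companion_def f_def)
  then have "col (krylov r u * transpose_mat (companion r \<mu>)) j = krylov r u *\<^sub>v vec r (coeff f)"
    using j cC krylov_carrier[of r u] by (subst col_mult2) auto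
  also have "\<dots> = pm f *\<^sub>v u" by (rule krylov_mult_vec[OF u cf])
  also have "pm f = pm (monom 1 (Suc j))"
  proof (cases "Suc j < r")
    case False
    then have "Suc j = r" using j by simp
    then have "monom 1 (Suc j) = f + \<mu>" by (auto simp: f_def)
    then have "pm (monom 1 (Suc j)) = pm f + pm \<mu>" by (simp add: poly_mat_add[OF S])
    then show ?thesis unfolding \<mu>(2) using pm[of f] by simp
  qed (simp add: f_def)
  finally show "col (S * krylov r u) j = col (krylov r u * transpose_mat (companion r \<mu>)) j"
    using L by simp
qed (use S krylov_carrier[of r u] in \<open>auto simp: companion_def\<close>)

lemma krylov_form:
  assumes "u \<in> carrier_vec n" "v \<in> carrier_vec n" "i < r" "j < r"
  shows "(transpose_mat (krylov r u) * A * krylov r v) $$ (i, j)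
    = (pm (monom 1 i) *\<^sub>v u) \<bullet> (A *\<^sub>v (pm (monom 1 j) *\<^sub>v v))"
proof -
  have c: "krylov r u \<in> carrier_mat n r" "krylov r v \<in> carrier_mat n r" by (rule krylov_carrier)+
  have "transpose_mat (krylov r u) * A * krylov r v = transpose_mat (krylov r u) * (A * krylov r v)"
    using c cA by (intro assoc_mult_mat[of _ r n _ n _ r]) auto
  then have "(transpose_mat (krylov r u) * A * krylov r v) $$ (i, j) = col (krylov r u) i \<bullet> col (A * krylov r v) j"
    using c cA assms by simp
  also have "col (A * krylov r v) j = A *\<^sub>v col (krylov r v) j" using c cA assms by (intro col_mult2) auto
  finally show ?thesis using assms by (simp add: krylov_col)
qed

lemma krylov_isotropic:
  assumes "u \<in> carrier_vec n"
  shows "transpose_mat (krylov r u) * A * krylov r u = 0\<^sub>m r r"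
proof (rule eq_matI)
  fix i j assume "i < dim_row (0\<^sub>m r r :: 'a mat)" "j < dim_col (0\<^sub>m r r :: 'a mat)"
  then show "(transpose_mat (krylov r u) * A * krylov r u) $$ (i, j) = 0\<^sub>m r r $$ (i, j)"
    using krylov_form[OF assms assms, of i r j] form_isotropic[OF assms] by simp
qed (use krylov_carrier[of r u] in auto)

text \<open>The form \<open>(f, g) \<mapsto> \<langle>f u, g v\<rangle>\<close> on \<open>k[t]/(p\<^sup>e)\<close> is nondegenerate as soon as \<open>\<langle>p\<^sup>e\<^sup>-\<^sup>1 u, v\<rangle> \<noteq> 0\<close>,
  because every nonzero ideal contains the class of \<open>p\<^sup>e\<^sup>-\<^sup>1\<close>.\<close>

lemma krylov_nondegenerate:
  assumes \<mu>: "lead_coeff \<mu> = 1" "pm \<mu> = 0\<^sub>m n n" "degree \<mu> = r"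
    and p: "irreducible p" "e > 0" "c \<noteq> 0" "\<mu> = Polynomial.smult c (p ^ e)"
    and uv: "u \<in> carrier_vec n" "v \<in> carrier_vec n" "u \<bullet> (A *\<^sub>v (pm (p ^ (e - 1)) *\<^sub>v v)) \<noteq> 0"
  shows "det (transpose_mat (krylov r u) * A * krylov r v) \<noteq> 0"
proof
  let ?H = "transpose_mat (krylov r u) * A * krylov r v"
  have c: "krylov r u \<in> carrier_mat n r" "krylov r v \<in> carrier_mat n r" by (rule krylov_carrier)+
  have H: "?H \<in> carrier_mat r r" using c cA by simp
  assume "det ?H = 0"
  then obtain w where w: "w \<in> carrier_vec r" "w \<noteq> 0\<^sub>v r" "?H *\<^sub>v w = 0\<^sub>v r"
    using det_0_iff_vec_prod_zero_field[OF H] by blast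
  define f where "f = (\<Sum>i<r. monom (w $ i) i)"
  have cf: "coeff f i = (if i < r then w $ i else 0)" for i
    by (auto simp: f_def coeff_sum)
  have wf: "w = vec r (coeff f)" using w(1) by (intro eq_vecI) (auto simp: cf)
  have "f \<noteq> 0"
  proof
    assume "f = 0"
    then have "w = 0\<^sub>v r" unfolding wf by (intro eq_vecI) auto
    with w(2) show False by simp
  qed
  let ?y = "A *\<^sub>v (pm f *\<^sub>v v)"
  have y: "?y \<in> carrier_vec n" "pm f *\<^sub>v v \<in> carrier_vec n" using cA pm[of f] uv by auto
  have "?H *\<^sub>v w = transpose_mat (krylov r u) *\<^sub>v (A *\<^sub>v (krylov r v *\<^sub>v w))"
    using c cA w(1) by (simp add: assoc_mult_mat_vec[of _ r n _ r] assoc_mult_mat_vec[of _ r n _ n])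
  also have "krylov r v *\<^sub>v w = pm f *\<^sub>v v"
    using krylov_mult_vec[OF uv(2), of r f] by (simp add: cf wf[symmetric])
  finally have Hw: "transpose_mat (krylov r u) *\<^sub>v ?y = 0\<^sub>v r" using w(3) by simp
  \<comment> \<open>Orthogonality is known for the first \<open>r\<close> powers only; reducing
    \<open>g\<close> modulo \<open>\<mu>\<close> extends it to all polynomials.\<close>
  have orth: "(pm g *\<^sub>v u) \<bullet> ?y = 0" for g
  proof -
    have "pm g = pm (g mod \<mu>)"
    proof -
      have "pm g = pm (g div \<mu> * \<mu>) + pm (g mod \<mu>)"
        unfolding poly_mat_add[OF S, symmetric] by simp
      then show ?thesis
        unfolding poly_mat_mult[OF S] \<mu>(2) using pm[of "g div \<mu>"] pm[of "g mod \<mu>"] by simp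
    qed
    moreover have "coeff (g mod \<mu>) i = 0" if "i \<ge> r" for i
    proof (cases "g mod \<mu> = 0")
      case False
      have "\<mu> \<noteq> 0" using \<mu>(1) by auto
      then have "degree (g mod \<mu>) < i" using degree_mod_less'[OF _ False] that \<mu>(3) by fastforce
      then show ?thesis by (rule coeff_eq_0)
    qed simp
    ultimately have "pm g *\<^sub>v u = krylov r u *\<^sub>v vec r (coeff (g mod \<mu>))"
      using krylov_mult_vec[OF uv(1), of r "g mod \<mu>"] by simp
    then have "(pm g *\<^sub>v u) \<bullet> ?y = ?y \<bullet> (krylov r u *\<^sub>v vec r (coeff (g mod \<mu>)))"
      using y(1) c by (simp add: comm_scalar_prod[of _ n])
    also have "\<dots> = (transpose_mat (krylov r u) *\<^sub>v ?y) \<bullet> vec r (coeff (g mod \<mu>))"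
      using c y by (intro mat_adjoint[of _ n r]) auto
    finally show ?thesis unfolding Hw by simp
  qed
  have pdeg: "degree p > 0" using p(1) by (metis irreducible_def is_unit_iff_degree neq0_conv)
  obtain j g where jg: "f = p ^ j * g" "\<not> p dvd g" using split_power[OF pdeg \<open>f \<noteq> 0\<close>] by blast
  have g0: "g \<noteq> 0" using jg(2) by auto
  have p0: "p \<noteq> 0" using pdeg by auto
  have "j < e"
  proof (rule ccontr)
    assume "\<not> j < e"
    then have "p ^ e dvd f" unfolding jg(1) by (intro dvd_mult2 le_imp_power_dvd) simp
    then have "\<mu> dvd f" using p(3) unfolding p(4) by (simp add: smult_dvd_iff)
    then have "degree \<mu> \<le> degree f" using \<open>f \<noteq> 0\<close> by (rule dvd_imp_degree_le)
    moreover have "degree \<mu> > 0" using p p0 pdeg by (simp add: degree_power_eq)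
    then have "degree f < r" using \<mu>(3) cf by (intro degree_lessI) auto
    ultimately show False using \<mu>(3) by simp
  qed
  obtain a b where ab: "a * g + b * p ^ e = 1" using irreducible_power_bezout[OF p(1) jg(2)] by blast
  \<comment> \<open>\<open>a\<close> inverts \<open>g\<close> modulo \<open>p ^ e\<close>, and the
    power of \<open>p\<close> raises the exponent \<open>j\<close> to \<open>e - 1\<close>. Thus
    \<open>h * f\<close> is \<open>p ^ (e - 1)\<close> modulo \<open>\<mu>\<close>, the element on
    which the form is known not to vanish.\<close>
  define h where "h = a * p ^ (e - 1 - j)"
  have "h * f = p ^ (e - 1) * (a * g)"
  proof -
    have "p ^ (e - 1) = p ^ (e - 1 - j) * p ^ j" using \<open>j < e\<close> by (simp flip: power_add)
    then show ?thesis by (simp add: h_def jg(1) mult_ac)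
  qed
  also have "a * g = 1 - b * p ^ e" using ab by (simp add: algebra_simps)
  also have "p ^ (e - 1) * (1 - b * p ^ e) = p ^ (e - 1) + Polynomial.smult (- 1 / c) (p ^ (e - 1) * b) * \<mu>"
    using p(3) unfolding p(4) by (simp add: algebra_simps)
  finally have "pm (h * f) = pm (p ^ (e - 1)) + pm (Polynomial.smult (- 1 / c) (p ^ (e - 1) * b)) * pm \<mu>"
    by (simp only: poly_mat_add[OF S] poly_mat_mult[OF S])
  then have "pm (h * f) = pm (p ^ (e - 1))"
    unfolding \<mu>(2) using pm[of "p ^ (e - 1)"] pm[of "Polynomial.smult (- 1 / c) (p ^ (e - 1) * b)"] by simp
  then have "u \<bullet> (A *\<^sub>v (pm (p ^ (e - 1)) *\<^sub>v v)) = (pm h *\<^sub>v u) \<bullet> ?y"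
    using form_pm[OF uv(1,2), of h f] by simp
  with orth[of h] uv(3) show False by simp
qed

end

lemma neg_square_ne_zero:
  assumes J: "J \<in> carrier_mat m m" "J * J = - (1\<^sub>m m :: 'a :: field mat)" and m: "m > 0"
  shows "J \<noteq> 0\<^sub>m m m"
proof
  assume "J = 0\<^sub>m m m"
  then have "- (1\<^sub>m m :: 'a mat) = 0\<^sub>m m m" using J by simp
  then have "(- (1\<^sub>m m :: 'a mat)) $$ (0, 0) = 0\<^sub>m m m $$ (0, 0)" by simp
  with m show False by simp
qed

context sloped_pair
begin

text \<open>Vectors \<open>u\<close>, \<open>v\<close> with
  \<open>\<langle>p^(e-1) u, v\<rangle>\<close> nonzero generate isotropic cyclic modules paired
  nondegenerately by the Gram matrix \<open>H\<close>. Replacing the basis \<open>W\<close> of the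
  second by the dual basis \<open>W * G\<close>, with \<open>G\<close> inverse to \<open>H\<close>,
  makes the form hyperbolic; on the dual basis \<open>S\<close> acts by the transpose of its action
  on \<open>U\<close>. That these vectors span the space is left to
  \<open>normal_form\<close>.\<close>

lemma hyperbolic_basis:
  obtains r \<mu> p e c R where "lead_coeff \<mu> = 1" "degree \<mu> = r" "r > 0"
    "irreducible p" "e > 0" "c \<noteq> 0" "\<mu> = Polynomial.smult c (p ^ e)"
    "R \<in> carrier_mat n (r + r)" "transpose_mat R * A * R = hyperbolic r (1\<^sub>m r)"
    "S * R = R * four_block_mat (transpose_mat (companion r \<mu>)) (0\<^sub>m r r) (0\<^sub>m r r) (companion r \<mu>)"
proof -
  obtain \<mu> p e c where \<mu>: "lead_coeff \<mu> = 1" "\<And>f. pm f = 0\<^sub>m n n \<longleftrightarrow> \<mu> dvd f"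
    and p: "irreducible p" "e > 0" "c \<noteq> 0" "\<mu> = Polynomial.smult c (p ^ e)"
    by (rule minimal_polynomial_primary) blast
  define r where "r = degree \<mu>"
  have \<mu>0: "pm \<mu> = 0\<^sub>m n n" using \<mu>(2) by simp
  have pdeg: "degree p > 0" using p(1) by (metis irreducible_def is_unit_iff_degree neq0_conv)
  then have p0: "p \<noteq> 0" by auto
  have r: "r > 0" using p p0 pdeg by (simp add: r_def degree_power_eq)
  have "pm (p ^ (e - 1)) \<noteq> 0\<^sub>m n n"
  proof
    assume "pm (p ^ (e - 1)) = 0\<^sub>m n n"
    then have "degree \<mu> \<le> degree (p ^ (e - 1))" unfolding \<mu>(2) using p0 by (intro dvd_imp_degree_le) auto
    then have "e * degree p \<le> (e - 1) * degree p" using p p0 by (simp add: degree_power_eq)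
    with pdeg p(2) show False by simp
  qed
  moreover have "A' * (A * pm (p ^ (e - 1))) = pm (p ^ (e - 1))"
    using A' cA pm[of "p ^ (e - 1)"] by (simp add: assoc_mult_mat[of _ n n _ n _ n, symmetric])
  ultimately have "A * pm (p ^ (e - 1)) \<noteq> 0\<^sub>m n n" using A'(1) by auto
  moreover have cAp: "A * pm (p ^ (e - 1)) \<in> carrier_mat n n" using cA pm by simp
  ultimately obtain i j where ij: "i < n" "j < n" "(A * pm (p ^ (e - 1))) $$ (i, j) \<noteq> 0"
    by (metis carrier_matD eq_matI index_zero_mat)
  \<comment> \<open>A nonzero entry of \<open>A * pm (p ^ (e - 1))\<close> exists because
    \<open>\<mu>\<close> does not divide \<open>p ^ (e - 1)\<close> and \<open>A\<close> is
    invertible; its position names two suitable unit vectors.\<close>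
  define u v :: "'a vec" where "u = unit_vec n i" and "v = unit_vec n j"
  have uv: "u \<in> carrier_vec n" "v \<in> carrier_vec n" by (auto simp: u_def v_def)
  have uAv: "u \<bullet> (A *\<^sub>v (pm (p ^ (e - 1)) *\<^sub>v v)) \<noteq> 0"
    using bilinear_unit_vec[OF cAp ij(1,2)] ij(3) cA pm[of "p ^ (e - 1)"] uv
    by (simp add: u_def v_def assoc_mult_mat_vec[of _ n n _ n])
  define U W where "U = krylov r u" and "W = krylov r v"
  have UW: "U \<in> carrier_mat n r" "W \<in> carrier_mat n r" by (auto simp: U_def W_def krylov_carrier)
  define C where "C = companion r \<mu>"
  have C: "C \<in> carrier_mat r r" by (simp add: C_def companion_def)
  have SU: "S * U = U * transpose_mat C" and SW: "S * W = W * transpose_mat C"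
    unfolding U_def W_def C_def by (rule S_krylov[OF _ \<mu>(1) \<mu>0 r_def[symmetric]], rule uv)+
  define H where "H = transpose_mat U * A * W"
  have H: "H \<in> carrier_mat r r" using UW cA by (simp add: H_def)
  have "det H \<noteq> 0"
    unfolding H_def U_def W_def by (rule krylov_nondegenerate[OF \<mu>(1) \<mu>0 r_def[symmetric] p uv uAv])
  then obtain G where G: "G \<in> carrier_mat r r" "H * G = 1\<^sub>m r" "G * H = 1\<^sub>m r"
    using invertible_mat_iff_det[OF H] invertible_matE[OF H] by metis
  note asc = assoc_mult_mat[of _ r n _ n _ n] assoc_mult_mat[of _ r n _ n _ r] assoc_mult_mat[of _ r n _ r _ r]
    assoc_mult_mat[of _ n n _ n _ r] assoc_mult_mat[of _ n n _ r _ r] assoc_mult_mat[of _ n r _ r _ r]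
    assoc_mult_mat[of _ r r _ r _ r] assoc_mult_mat[of _ r r _ n _ n] assoc_mult_mat[of _ r r _ n _ r] assoc_mult_mat[of _ r r _ r _ n]
  \<comment> \<open>Self-adjointness of \<open>S\<close> read in the bases \<open>U\<close> and
    \<open>W\<close>. It implies that passing to the dual basis replaces the transposed companion
    matrix by \<open>C\<close> itself.\<close>
  have HC: "H * transpose_mat C = C * H"
  proof -
    have "H * transpose_mat C = transpose_mat U * (A * (S * W))"
      unfolding SW H_def using UW cA C S by (simp add: asc)
    also have "\<dots> = transpose_mat U * ((A * S) * W)" using UW cA S by (simp add: asc)
    also have "\<dots> = (transpose_mat U * transpose_mat S) * A * W"
      unfolding S_adjoint[symmetric] using UW cA S by (simp add: asc)
    also have "transpose_mat U * transpose_mat S = C * transpose_mat U"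
      using arg_cong[OF SU, of transpose_mat] UW C S by (simp add: transpose_mult[of _ n n _ r] transpose_mult[of _ n r _ r])
    also have "C * transpose_mat U * A * W = C * H"
      unfolding H_def using UW cA C by (simp add: asc)
    finally show ?thesis .
  qed
  have CG: "transpose_mat C * G = G * C"
  proof -
    have "transpose_mat C * G = (G * H) * transpose_mat C * G" unfolding G(3) using C G by simp
    also have "\<dots> = G * (H * transpose_mat C) * G" using C G(1) H by (simp add: asc)
    also have "\<dots> = (G * C) * (H * G)" unfolding HC using C G(1) H by (simp add: asc)
    finally show ?thesis unfolding G(2) using C G by simp
  qed
  define R where "R = hcat n r U (W * G)"
  have WG: "W * G \<in> carrier_mat n r" using UW G by simp
  have R: "R \<in> carrier_mat n (r + r)" unfolding R_def by (rule hcat_carrier[OF UW(1) WG])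
  have form: "transpose_mat R * A * R = hyperbolic r (1\<^sub>m r)"
  proof -
    have UAWG: "transpose_mat U * (A * (W * G)) = 1\<^sub>m r"
      using G(2) unfolding H_def using UW cA G(1) by (simp add: asc)
    have "transpose_mat R * A * R = transpose_mat R * (A * R)"
      using R cA by (intro assoc_mult_mat[of _ "r + r" n _ n]) auto
    also have "\<dots> = four_block_mat (transpose_mat U * (A * U)) (transpose_mat U * (A * (W * G)))
        (transpose_mat (W * G) * (A * U)) (transpose_mat (W * G) * (A * (W * G)))"
      unfolding R_def mult_hcat[OF cA UW(1) WG]
      using UW WG cA by (intro transpose_hcat_mult_hcat) auto
    also have "transpose_mat U * (A * U) = 0\<^sub>m r r"
      using krylov_isotropic[OF uv(1), of r] UW(1) cA by (simp add: U_def asc krylov_carrier)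
    also have "transpose_mat U * (A * (W * G)) = 1\<^sub>m r" by (rule UAWG)
    also have "transpose_mat (W * G) * (A * U) = - 1\<^sub>m r"
    proof -
      have "transpose_mat (transpose_mat U * (A * (W * G))) = transpose_mat (A * (W * G)) * U"
        using UW WG cA by (subst transpose_mult[of _ r n _ r]) auto
      also have "transpose_mat (A * (W * G)) = transpose_mat (W * G) * (- A)"
        using transpose_mult[OF cA WG] by (simp add: transpose_A)
      also have "transpose_mat (W * G) * (- A) * U = - (transpose_mat (W * G) * (A * U))"
        using UW WG cA by (simp add: asc)
      finally have "- (transpose_mat (W * G) * (A * U)) = 1\<^sub>m r" unfolding UAWG by simp
      then show ?thesis by (metis uminus_uminus_mat)
    qed
    also have "transpose_mat (W * G) * (A * (W * G)) = 0\<^sub>m r r"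
    proof -
      have "transpose_mat (W * G) * (A * (W * G)) = transpose_mat G * (transpose_mat W * A * W) * G"
        using UW cA G by (simp add: asc transpose_mult[of _ n r _ r])
      also have "transpose_mat W * A * W = 0\<^sub>m r r"
        using krylov_isotropic[OF uv(2), of r] by (simp add: W_def)
      finally show ?thesis using G by simp
    qed
    finally show ?thesis unfolding hyperbolic_def by simp
  qed
  have SR: "S * R = R * four_block_mat (transpose_mat C) (0\<^sub>m r r) (0\<^sub>m r r) C"
  proof -
    have "S * (W * G) = (S * W) * G"
      using S UW G(1) by (intro assoc_mult_mat[symmetric, of _ n n _ r _ r]) auto
    also have "\<dots> = W * (transpose_mat C * G)"
      unfolding SW using UW G(1) C by (intro assoc_mult_mat[of _ n r _ r _ r]) auto
    also have "\<dots> = (W * G) * C" unfolding CG using UW G(1) C by (simp add: asc)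
    finally have SWG: "S * (W * G) = (W * G) * C" .
    have "S * R = hcat n r (U * transpose_mat C) ((W * G) * C)"
      unfolding R_def mult_hcat[OF S UW(1) WG] SU SWG ..
    also have "\<dots> = R * four_block_mat (transpose_mat C) (0\<^sub>m r r) (0\<^sub>m r r) C"
      unfolding R_def using UW WG C by (subst hcat_mult[OF UW(1) WG]) auto
    finally show ?thesis .
  qed
  show thesis
    by (rule that[OF \<mu>(1) r_def[symmetric] r p R form SR[unfolded C_def]])
qed

text \<open>The span of the columns of \<open>R\<close> is nondegenerate and invariant under
  \<open>S\<close>, so the orthogonal projection onto it is a self-adjoint idempotent.
  Indecomposability makes this nonzero projection the identity, and \<open>R\<close> is a
  basis.\<close>

lemma normal_form:
  obtains r \<mu> p e c P where "n = r + r" "lead_coeff \<mu> = 1" "degree \<mu> = r" "r > 0"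
    "irreducible p" "e > 0" "c \<noteq> 0" "\<mu> = Polynomial.smult c (p ^ e)"
    "P \<in> carrier_mat n n" "invertible_mat P" "P * A * transpose_mat P = hyperbolic r (1\<^sub>m r)"
    "P * B * transpose_mat P = hyperbolic r (- companion r \<mu>)"
proof -
  obtain r \<mu> p e c R where \<mu>: "lead_coeff \<mu> = 1" "degree \<mu> = r" "r > 0"
    and p: "irreducible p" "e > 0" "c \<noteq> 0" "\<mu> = Polynomial.smult c (p ^ e)"
    and R: "R \<in> carrier_mat n (r + r)" and form: "transpose_mat R * A * R = hyperbolic r (1\<^sub>m r)"
    and SR: "S * R = R * four_block_mat (transpose_mat (companion r \<mu>)) (0\<^sub>m r r) (0\<^sub>m r r) (companion r \<mu>)"
    by (rule hyperbolic_basis)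
  let ?m = "r + r"
  define C where "C = companion r \<mu>"
  have C: "C \<in> carrier_mat r r" by (simp add: C_def companion_def)
  define D where "D = four_block_mat (transpose_mat C) (0\<^sub>m r r) (0\<^sub>m r r) C"
  have D: "D \<in> carrier_mat ?m ?m" using C by (simp add: D_def)
  have tD: "transpose_mat D = four_block_mat C (0\<^sub>m r r) (0\<^sub>m r r) (transpose_mat C)"
    unfolding D_def using C by (subst transpose_four_block_mat[of _ r r _ r _ r]) auto
  define J :: "'a mat" where "J = hyperbolic r (1\<^sub>m r)"
  have J: "J \<in> carrier_mat ?m ?m" by (simp add: J_def hyperbolic_carrier)
  have JJ: "J * J = - 1\<^sub>m ?m" unfolding J_def by (rule hyperbolic_one_square)
  have tJ: "transpose_mat J = - J" unfolding J_def by (rule transpose_hyperbolic) simp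
  have JD: "J * D = hyperbolic r C"
    unfolding J_def hyperbolic_def D_def using C
    by (simp add: mult_four_block_mat[of _ r r _ r _ r _ _ r _ r])
  \<comment> \<open>Expresses that \<open>D\<close>, the matrix of \<open>S\<close> on the columns
    of \<open>R\<close>, is self-adjoint for the hyperbolic form; the projection \<open>E\<close>
    commutes with \<open>S\<close> for this reason.\<close>
  have DJ: "J * transpose_mat D = D * J"
  proof -
    have "- 0\<^sub>m r r = (0\<^sub>m r r :: 'a mat)" by (rule eq_matI) auto
    then show ?thesis unfolding J_def hyperbolic_def tD unfolding D_def using C
      by (simp add: mult_four_block_mat[of _ r r _ r _ r _ _ r _ r])
  qed
  have SR: "S * R = R * D" using SR by (simp add: D_def C_def)
  define G where "G = transpose_mat R * A"
  have G: "G \<in> carrier_mat ?m n" using R cA by (simp add: G_def)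
  have GR: "G * R = J" using form by (simp add: G_def J_def)
  note asc = assoc_mult_mat[of _ n ?m _ ?m _ ?m] assoc_mult_mat[of _ n ?m _ ?m _ n] assoc_mult_mat[of _ n ?m _ n _ n]
    assoc_mult_mat[of _ n ?m _ n _ ?m] assoc_mult_mat[of _ n n _ ?m _ ?m] assoc_mult_mat[of _ n n _ ?m _ n]
    assoc_mult_mat[of _ n n _ n _ n] assoc_mult_mat[of _ n n _ n _ ?m]
    assoc_mult_mat[of _ ?m ?m _ ?m _ ?m] assoc_mult_mat[of _ ?m ?m _ ?m _ n] assoc_mult_mat[of _ ?m ?m _ n _ n]
    assoc_mult_mat[of _ ?m ?m _ n _ ?m] assoc_mult_mat[of _ ?m n _ ?m _ ?m] assoc_mult_mat[of _ ?m n _ ?m _ n]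
    assoc_mult_mat[of _ ?m n _ n _ n] assoc_mult_mat[of _ ?m n _ n _ ?m]
  \<comment> \<open>The orthogonal projection \<open>R (R^T A R)^-1 R^T A\<close>. The inverse is
    \<open>- J\<close>, since \<open>R^T A R = J\<close> and \<open>J * J = - 1\<close>.\<close>
  define E where "E = - (R * (J * G))"
  have E: "E \<in> carrier_mat n n" using R J G by (simp add: E_def)
  have JJG: "J * (J * X) = - X" if "X \<in> carrier_mat ?m k" for X k
  proof -
    have "J * (J * X) = (J * J) * X" using J that by (intro assoc_mult_mat[symmetric, of _ ?m ?m _ ?m _ k]) auto
    then show ?thesis unfolding JJ using that by simp
  qed
  have ER: "E * R = R"
  proof -
    have "E * R = - (R * (J * (G * R)))" unfolding E_def using R J G by (simp add: asc)
    also have "\<dots> = R" unfolding GR JJ using R by simp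
    finally show ?thesis .
  qed
  have "E * E = - ((E * R) * (J * G))"
    using R J G E unfolding E_def by (simp add: asc)
  then have EE: "E * E = E" unfolding ER by (simp add: E_def)
  have tG: "transpose_mat G = - (A * R)"
    unfolding G_def using R cA by (simp add: transpose_mult[of _ ?m n _ n] transpose_A)
  have tE: "transpose_mat E = - (A * (R * (J * transpose_mat R)))"
  proof -
    have "transpose_mat E = - (transpose_mat G * transpose_mat J * transpose_mat R)"
      unfolding E_def transpose_uminus using R J G
      by (simp add: transpose_mult[of _ n ?m _ n] transpose_mult[of _ ?m ?m _ n])
    also have "\<dots> = - (A * (R * (J * transpose_mat R)))"
      unfolding tG tJ using R J cA by (simp add: asc)
    finally show ?thesis .
  qed
  have EA: "transpose_mat E * A = A * E"
    unfolding tE unfolding E_def G_def using R J cA by (simp add: asc)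
  have SE: "S * E = E * S"
  proof -
    have GS: "G * S = transpose_mat D * G"
    proof -
      have "G * S = (transpose_mat R * transpose_mat S) * A"
        unfolding G_def using R cA S S_adjoint by (simp add: asc)
      also have "transpose_mat R * transpose_mat S = transpose_mat D * transpose_mat R"
        using arg_cong[OF SR, of transpose_mat] R S D by (simp add: transpose_mult[of _ n n _ ?m] transpose_mult[of _ n ?m _ ?m])
      finally show ?thesis unfolding G_def using R cA D by (simp add: asc)
    qed
    have "S * E = - ((S * R) * (J * G))" unfolding E_def using R J G S by (simp add: asc)
    also have "\<dots> = - (R * ((D * J) * G))" unfolding SR using R J G D by (simp add: asc)
    also have "\<dots> = - (R * (J * (transpose_mat D * G)))" unfolding DJ[symmetric] using R J G D by (simp add: asc)
    also have "\<dots> = E * S" unfolding GS[symmetric] E_def using R J G S by (simp add: asc)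
    finally show ?thesis .
  qed
  have Beq: "B = - (A * S)" unfolding A_mult_S by simp
  have EB: "transpose_mat E * B = B * E"
  proof -
    have "transpose_mat E * B = - ((transpose_mat E * A) * S)" unfolding Beq using E cA S by (simp add: asc)
    also have "\<dots> = - (A * (S * E))" unfolding EA SE using E cA S by (simp add: asc)
    also have "\<dots> = B * E" unfolding Beq using E cA S by (simp add: asc)
    finally show ?thesis .
  qed
  have "E \<noteq> 0\<^sub>m n n"
  proof
    assume "E = 0\<^sub>m n n"
    then have "R = 0\<^sub>m n ?m" using ER R by simp
    then have "J = 0\<^sub>m ?m ?m" using GR G by simp
    then show False using neg_square_ne_zero[OF J JJ] \<mu>(3) by simp
  qed
  then have E1: "E = 1\<^sub>m n" using indec E EE EA EB unfolding indecomposable_def by auto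
  have RL: "R * (- (J * G)) = 1\<^sub>m n" using E1 R J G by (simp add: E_def)
  have "(- (J * G)) * R = - (J * (G * R))" using R J G by (simp add: asc)
  then have LR: "(- (J * G)) * R = 1\<^sub>m ?m" unfolding GR JJ by simp
  have JG: "- (J * G) \<in> carrier_mat ?m n" using J G by simp
  have nm: "n = ?m" using right_inverse_dim_le[OF R JG RL] right_inverse_dim_le[OF JG R LR] by simp
  have inv: "invertible_mat (transpose_mat R)"
    using invertible_mat_right_inverseI[of R n "- (J * G)"] R JG RL nm invertible_mat_transpose[of R n] by simp
  have "transpose_mat R * B * transpose_mat (transpose_mat R) = - (G * (S * R))"
    unfolding Beq G_def using R cA S by (simp add: asc)
  also have "\<dots> = - (J * D)" unfolding SR GR[symmetric] using R G D by (simp add: asc)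
  also have "\<dots> = hyperbolic r (- C)"
    unfolding JD hyperbolic_def using C by (auto intro!: eq_matI)
  finally have formB: "transpose_mat R * B * transpose_mat (transpose_mat R) = hyperbolic r (- companion r \<mu>)"
    unfolding C_def .
  show thesis
    by (rule that[OF nm \<mu> p _ inv _ formB]) (use R nm form in auto)
qed

end

section \<open>The pencil of a companion matrix\<close>

lemma homog_eq_sum_Y:
  "homog (Suc s) q X Y = const_xy (coeff q (Suc s)) * X ^ Suc s + Y * (\<Sum>i\<le>s. const_xy (coeff q i) * X ^ i * Y ^ (s - i))"
proof -
  have "(\<Sum>i\<le>s. const_xy (coeff q i) * X ^ i * Y ^ (Suc s - i))
      = Y * (\<Sum>i\<le>s. const_xy (coeff q i) * X ^ i * Y ^ (s - i))"
    unfolding sum_distrib_left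
  proof (rule sum.cong)
    fix i assume "i \<in> {..s}"
    then have "Y ^ (Suc s - i) = Y * Y ^ (s - i)" by (simp add: Suc_diff_le)
    then show "const_xy (coeff q i) * X ^ i * Y ^ (Suc s - i) = Y * (const_xy (coeff q i) * X ^ i * Y ^ (s - i))"
      by (simp only: ac_simps)
  qed simp
  then show ?thesis unfolding homog_def sum.atMost_Suc by (simp only: diff_self_eq_0 power_0 mult_1_right add.commute)
qed

text \<open>The matrix \<open>X - Y C\<close> for the companion matrix \<open>C\<close> of
  \<open>\<mu>\<close>, with general ring elements in place of the variables so that linear forms
  can be inserted.\<close>

definition companion_pencil :: "nat \<Rightarrow> 'a :: field poly \<Rightarrow> 'a poly poly \<Rightarrow> 'a poly poly \<Rightarrow> 'a poly poly mat" where
  "companion_pencil r \<mu> X Y = mat r r (\<lambda>(i, j). (if i = j then X else 0) +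
     Y * (if Suc i < r then (if j = Suc i then - 1 else 0) else const_xy (coeff \<mu> j)))"

text \<open>The last column of this matrix is \<open>(Y\<^sup>s, X Y\<^sup>s\<^sup>-\<^sup>1, \<dots>, X\<^sup>s)\<close>, on which all rows of the companion
  pencil but the last one vanish.\<close>

definition krylov_columns :: "nat \<Rightarrow> 'b \<Rightarrow> 'b \<Rightarrow> 'b :: comm_ring_1 mat" where
  "krylov_columns s X Y = mat (Suc s) (Suc s) (\<lambda>(i, j). if j < s then (if i = Suc j then 1 else 0) else X ^ i * Y ^ (s - i))"

text \<open>What remains of the companion pencil after deleting its first column and its last
  row.\<close>

definition lower_band :: "nat \<Rightarrow> 'b \<Rightarrow> 'b \<Rightarrow> 'b :: comm_ring_1 mat" where
  "lower_band s X Y = mat s s (\<lambda>(i, j). (if i = Suc j then X else 0) + (if i = j then - Y else 0))"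

lemma companion_pencil_mult_krylov_columns:
  fixes X Y :: "'a :: field poly poly"
  assumes \<mu>: "lead_coeff \<mu> = 1" "degree \<mu> = Suc s"
  obtains c where "c \<in> carrier_mat 1 s"
    "companion_pencil (Suc s) \<mu> X Y * krylov_columns s X Y
      = four_block_mat (lower_band s X Y) (0\<^sub>m s 1) c (homog (Suc s) \<mu> X Y \<cdot>\<^sub>m 1\<^sub>m 1)"
proof -
  let ?M = "companion_pencil (Suc s) \<mu> X Y" and ?K = "krylov_columns s X Y"
  define c where "c = mat 1 s (\<lambda>(i, j). ?M $$ (s, Suc j))"
  have c: "c \<in> carrier_mat 1 s" by (simp add: c_def)
  have MK: "?M \<in> carrier_mat (Suc s) (Suc s)" "?K \<in> carrier_mat (Suc s) (Suc s)"
    by (auto simp: companion_pencil_def krylov_columns_def)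
  have ent: "(?M * ?K) $$ (i, j) = (\<Sum>k<Suc s. ?M $$ (i, k) * ?K $$ (k, j))" if "i < Suc s" "j < Suc s" for i j
  proof -
    have "(?M * ?K) $$ (i, j) = (\<Sum>k\<in>{0..<Suc s}. row ?M i $ k * col ?K j $ k)"
      using MK that by (simp only: index_mult_mat carrier_matD scalar_prod_def dim_col)
    also have "\<dots> = (\<Sum>k\<in>{0..<Suc s}. ?M $$ (i, k) * ?K $$ (k, j))"
      using MK that by (intro sum.cong) auto
    finally show ?thesis by (simp only: lessThan_atLeast0)
  qed
  have unit: "(?M * ?K) $$ (i, j) = ?M $$ (i, Suc j)" if "i < Suc s" "j < s" for i j
  proof -
    have "(?M * ?K) $$ (i, j) = (\<Sum>k<Suc s. if k = Suc j then ?M $$ (i, k) else 0)"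
      unfolding ent[OF that(1) less_SucI[OF that(2)]]
      by (rule sum.cong) (use that in \<open>auto simp: krylov_columns_def\<close>)
    also have "\<dots> = ?M $$ (i, Suc j)" using that(2) by (simp del: sum.lessThan_Suc)
    finally show ?thesis .
  qed
  have K: "?K $$ (k, s) = X ^ k * Y ^ (s - k)" if "k < Suc s" for k
    using that by (simp add: krylov_columns_def)
  have zero: "(?M * ?K) $$ (i, s) = 0" if "i < s" for i
  proof -
    have "(?M * ?K) $$ (i, s) = (\<Sum>k<Suc s. (if k = i then X * ?K $$ (k, s) else 0)
        + (if k = Suc i then - Y * ?K $$ (k, s) else 0))"
      unfolding ent[OF less_SucI[OF that] lessI]
      by (rule sum.cong) (use that in \<open>auto simp: companion_pencil_def\<close>)
    also have "\<dots> = X * ?K $$ (i, s) + - Y * ?K $$ (Suc i, s)"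
      unfolding sum.distrib using that by (simp del: sum.lessThan_Suc)
    also have "\<dots> = 0"
    \<comment> \<open>The two surviving terms are \<open>X * X^i * Y^(s-i)\<close> and
      \<open>- Y * X^(i+1) * Y^(s-i-1)\<close>, which cancel.\<close>
    proof -
      have "s - i = Suc (s - Suc i)" using that by simp
      then have "Y ^ (s - i) = Y * Y ^ (s - Suc i)" by simp
      then show ?thesis using that by (simp add: K ac_simps)
    qed
    finally show ?thesis .
  qed
  have last: "(?M * ?K) $$ (s, s) = homog (Suc s) \<mu> X Y"
  proof -
    have "(?M * ?K) $$ (s, s) = (\<Sum>k<Suc s. (if k = s then X * ?K $$ (k, s) else 0)
        + Y * (const_xy (coeff \<mu> k) * X ^ k * Y ^ (s - k)))"
      unfolding ent[OF lessI lessI]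
    proof (rule sum.cong)
      fix k assume "k \<in> {..<Suc s}"
      then have k: "k < Suc s" by simp
      have "?M $$ (s, k) = (if k = s then X else 0) + Y * const_xy (coeff \<mu> k)"
        using k by (auto simp: companion_pencil_def)
      then show "?M $$ (s, k) * ?K $$ (k, s) = (if k = s then X * ?K $$ (k, s) else 0)
          + Y * (const_xy (coeff \<mu> k) * X ^ k * Y ^ (s - k))"
        unfolding K[OF k] by (cases "k = s") (simp_all only: if_True if_False simp_thms ring_distribs ac_simps add_0_left)
    qed simp
    also have "\<dots> = X * ?K $$ (s, s) + Y * (\<Sum>k\<le>s. const_xy (coeff \<mu> k) * X ^ k * Y ^ (s - k))"
      unfolding sum.distrib sum_distrib_left lessThan_Suc_atMost by simp
    also have "X * ?K $$ (s, s) = const_xy (coeff \<mu> (Suc s)) * X ^ Suc s"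
      using \<mu> by (simp add: K pCons_one)
    finally show ?thesis unfolding homog_eq_sum_Y .
  qed
  have "?M * ?K = four_block_mat (lower_band s X Y) (0\<^sub>m s 1) c (homog (Suc s) \<mu> X Y \<cdot>\<^sub>m 1\<^sub>m 1)"
  proof (rule eq_matI)
    fix i j assume "i < dim_row (four_block_mat (lower_band s X Y) (0\<^sub>m s 1) c (homog (Suc s) \<mu> X Y \<cdot>\<^sub>m 1\<^sub>m 1))"
      "j < dim_col (four_block_mat (lower_band s X Y) (0\<^sub>m s 1) c (homog (Suc s) \<mu> X Y \<cdot>\<^sub>m 1\<^sub>m 1))"
    then have ij: "i < Suc s" "j < Suc s" by (auto simp: lower_band_def)
    consider "i < s" "j < s" | "i < s" "j = s" | "i = s" "j < s" | "i = s" "j = s" using ij by linarith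
    then show "(?M * ?K) $$ (i, j)
        = four_block_mat (lower_band s X Y) (0\<^sub>m s 1) c (homog (Suc s) \<mu> X Y \<cdot>\<^sub>m 1\<^sub>m 1) $$ (i, j)"
    proof cases
      case 1
      then show ?thesis using unit[of i j] by (auto simp: lower_band_def companion_pencil_def)
    next
      case 2
      then show ?thesis using zero[of i] by (simp add: lower_band_def)
    next
      case 3
      then show ?thesis using unit[of i j] by (simp add: lower_band_def c_def)
    next
      case 4
      then show ?thesis using last by (simp add: lower_band_def)
    qed
  qed (auto simp: lower_band_def companion_pencil_def krylov_columns_def)
  with c show thesis by (rule that)
qed

lemma det_lower_band: "det (lower_band s X Y) = (- Y) ^ s"
proof -
  have "det (lower_band s X Y) = prod_list (diag_mat (lower_band s X Y))"
    by (rule det_lower_triangular[of s]) (auto simp: lower_band_def)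
  also have "diag_mat (lower_band s X Y) = replicate s (- Y)"
    by (rule nth_equalityI) (auto simp: diag_mat_def lower_band_def)
  finally show ?thesis by (simp add: prod_list_replicate)
qed

text \<open>Moving the last column to the front with \<open>W\<close> leaves a block triangular
  matrix with diagonal blocks \<open>Y ^ s\<close> and the identity. The determinant of the
  permutation matrix \<open>W\<close> is a sign; recording it as a unit \<open>u\<close> avoids
  computing it.\<close>

lemma det_krylov_columns:
  fixes X Y :: "'b :: idom"
  shows "\<exists>u v. u * v = 1 \<and> det (krylov_columns s X Y) * u = Y ^ s"
proof -
  define z where "z = mat s 1 (\<lambda>(i, j). X ^ Suc i * Y ^ (s - Suc i))"
  define W :: "'b mat" where "W = four_block_mat (0\<^sub>m s 1) (1\<^sub>m s) (1\<^sub>m 1) (0\<^sub>m 1 s)"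
  have z: "z \<in> carrier_mat s 1" by (simp add: z_def)
  have W: "W \<in> carrier_mat (Suc s) (Suc s)" by (auto simp: W_def)
  have K: "krylov_columns s X Y = four_block_mat (0\<^sub>m 1 s) (Y ^ s \<cdot>\<^sub>m 1\<^sub>m 1) (1\<^sub>m s) z"
    by (rule eq_matI) (auto simp: krylov_columns_def z_def power_eq_if mult.commute)
  have "krylov_columns s X Y * W = four_block_mat (Y ^ s \<cdot>\<^sub>m 1\<^sub>m 1) (0\<^sub>m 1 s) z (1\<^sub>m s)"
    unfolding K W_def using z
    by (subst mult_four_block_mat[of _ 1 s _ 1 _ s _ _ 1 _ s]) (auto intro!: cong_four_block_mat)
  then have "det (krylov_columns s X Y * W) = det (Y ^ s \<cdot>\<^sub>m 1\<^sub>m 1) * det (1\<^sub>m s)"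
    using z by (subst det_four_block_mat_upper_right_zero[symmetric, of _ 1 _ s]) auto
  then have 1: "det (krylov_columns s X Y) * det W = Y ^ s"
    using W by (simp add: det_mult[of _ "Suc s"] krylov_columns_def)
  have "W * transpose_mat W = 1\<^sub>m (Suc s)"
    unfolding W_def
    by (subst transpose_four_block_mat[of _ s 1 _ s _ 1], auto)
      (subst mult_four_block_mat[of _ s 1 _ s _ 1 _ _ s _ 1], auto intro!: eq_matI)
  then have "det W * det (transpose_mat W) = 1"
    using W by (metis det_mult det_one transpose_carrier_mat)
  with 1 show ?thesis by blast
qed

lemma companion_pencil_carrier: "companion_pencil r \<mu> X Y \<in> carrier_mat r r"
  by (simp add: companion_pencil_def)

text \<open>Taking determinants in the product with \<open>krylov_columns\<close> gives
  \<open>\<plusminus> Y ^ s\<close> on both sides as extra factors, and these cancel as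
  \<open>Y\<close> is nonzero. The unit left over is a sign.\<close>

lemma det_companion_pencil:
  fixes X Y :: "'a :: field poly poly"
  assumes \<mu>: "lead_coeff \<mu> = 1" "degree \<mu> = r" "r > 0" and Y: "Y \<noteq> 0"
  shows "equiv_units (det (companion_pencil r \<mu> X Y)) (homog r \<mu> X Y)"
proof -
  obtain s where s: "r = Suc s" using \<mu>(3) by (cases r) auto
  let ?M = "companion_pencil (Suc s) \<mu> X Y" and ?K = "krylov_columns s X Y" and ?f = "homog (Suc s) \<mu> X Y"
  obtain c where c: "c \<in> carrier_mat 1 s"
    and eq: "?M * ?K = four_block_mat (lower_band s X Y) (0\<^sub>m s 1) c (?f \<cdot>\<^sub>m 1\<^sub>m 1)"
    using companion_pencil_mult_krylov_columns[OF \<mu>(1) \<mu>(2)[unfolded s]] by blast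
  have "det (?M * ?K) = det (lower_band s X Y) * det (?f \<cdot>\<^sub>m 1\<^sub>m 1)"
    unfolding eq by (rule det_four_block_mat_upper_right_zero) (use c in \<open>auto simp: lower_band_def\<close>)
  then have 1: "det ?M * det ?K = (- Y) ^ s * ?f"
    unfolding det_lower_band by (simp add: det_mult[of _ "Suc s"] companion_pencil_carrier krylov_columns_def)
  obtain u v where uv: "u * v = 1" "det ?K * u = Y ^ s" using det_krylov_columns by blast
  have "det ?M * Y ^ s = (- 1) ^ s * ?f * u * Y ^ s"
  proof -
    have "det ?M * Y ^ s = (det ?M * det ?K) * u" unfolding uv(2)[symmetric] by (simp only: ac_simps)
    also have "\<dots> = (- 1) ^ s * ?f * u * Y ^ s" unfolding 1 power_minus[of Y] by (simp only: ac_simps)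
    finally show ?thesis .
  qed
  then have 2: "det ?M = (- 1) ^ s * ?f * u" using Y by simp
  have "?f dvd det ?M" unfolding 2 by simp
  moreover have "?f = det ?M * ((- 1) ^ s * v)"
  proof -
    have "det ?M * ((- 1) ^ s * v) = ((- 1) ^ s * (- 1) ^ s) * ?f * (u * v)" unfolding 2 by (simp only: ac_simps)
    then show ?thesis unfolding uv(1) by (simp flip: power_mult_distrib)
  qed
  then have "det ?M dvd ?f" by (metis dvd_triv_left)
  ultimately show ?thesis unfolding s equiv_units_iff_dvd by blast
qed

text \<open>After multiplication by \<open>krylov_columns\<close> the matrix is block triangular,
  with a band of determinant \<open>(- Y) ^ s\<close>, prime to \<open>p\<close>, and the corner
  entry \<open>homog r \<mu> X Y\<close>. The adjugate of the band clears the row \<open>c\<close>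
  at the cost of the factor \<open>d\<close>, the determinant of the band.\<close>

lemma loc_diag_companion_pencil:
  fixes X Y :: "'a :: field poly poly"
  assumes \<mu>: "lead_coeff \<mu> = 1" "degree \<mu> = r" "r > 0" and p: "prime_elem p" "\<not> p dvd Y"
  obtains d where "\<not> p dvd d" "loc_diag p (companion_pencil r \<mu> X Y) (replicate (r - 1) d @ [d * homog r \<mu> X Y])"
proof -
  obtain s where s: "r = Suc s" using \<mu>(3) by (cases r) auto
  let ?M = "companion_pencil (Suc s) \<mu> X Y" and ?K = "krylov_columns s X Y" and ?f = "homog (Suc s) \<mu> X Y"
  let ?T = "lower_band s X Y"
  obtain c where c: "c \<in> carrier_mat 1 s"
    and eq: "?M * ?K = four_block_mat ?T (0\<^sub>m s 1) c (?f \<cdot>\<^sub>m 1\<^sub>m 1)"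
    using companion_pencil_mult_krylov_columns[OF \<mu>(1) \<mu>(2)[unfolded s]] by blast
  have T: "?T \<in> carrier_mat s s" by (simp add: lower_band_def)
  have adj: "adj_mat ?T \<in> carrier_mat s s" by (rule adj_mat(1)[OF T])
  define d where "d = det ?T"
  have pd: "\<not> p dvd d"
    unfolding d_def det_lower_band using p prime_elem_dvd_power[OF p(1)] by fastforce
  define P where "P = four_block_mat (adj_mat ?T) (0\<^sub>m s 1) (- (c * adj_mat ?T)) (d \<cdot>\<^sub>m 1\<^sub>m 1)"
  have P: "P \<in> carrier_mat (Suc s) (Suc s)" using adj by (auto simp: P_def)
  have ca: "c * adj_mat ?T \<in> carrier_mat 1 s" using c adj by simp
  have cT: "(c * adj_mat ?T) * ?T = d \<cdot>\<^sub>m c"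
  proof -
    have "(c * adj_mat ?T) * ?T = c * (adj_mat ?T * ?T)" using c adj T by (intro assoc_mult_mat) auto
    also have "\<dots> = d \<cdot>\<^sub>m c" unfolding adj_mat(3)[OF T] d_def
      using mult_smult_distrib[OF c, of "1\<^sub>m s" s] c by simp
    finally show ?thesis .
  qed
  have "P * (?M * ?K) = four_block_mat (d \<cdot>\<^sub>m 1\<^sub>m s) (0\<^sub>m s 1) (0\<^sub>m 1 s) ((d * ?f) \<cdot>\<^sub>m 1\<^sub>m 1)"
  proof -
    have b1: "adj_mat ?T * ?T + 0\<^sub>m s 1 * c = d \<cdot>\<^sub>m 1\<^sub>m s"
      using c unfolding adj_mat(3)[OF T] d_def by simp
    have b2: "adj_mat ?T * 0\<^sub>m s 1 + 0\<^sub>m s 1 * (?f \<cdot>\<^sub>m 1\<^sub>m 1) = 0\<^sub>m s 1" using adj by simp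
    have "- (c * adj_mat ?T) * ?T = - (d \<cdot>\<^sub>m c)"
      unfolding cT[symmetric] by (rule uminus_mult_left_mat) (use adj T in simp)
    moreover have "(d \<cdot>\<^sub>m 1\<^sub>m 1) * c = d \<cdot>\<^sub>m c" using c by (simp add: mult_smult_assoc_mat[of _ 1 1 _ s])
    ultimately have b3: "- (c * adj_mat ?T) * ?T + (d \<cdot>\<^sub>m 1\<^sub>m 1) * c = 0\<^sub>m 1 s"
      using c by (simp add: uminus_l_inv_mat[of _ 1 s])
    have b4: "- (c * adj_mat ?T) * 0\<^sub>m s 1 + (d \<cdot>\<^sub>m 1\<^sub>m 1) * (?f \<cdot>\<^sub>m 1\<^sub>m 1) = (d * ?f) \<cdot>\<^sub>m 1\<^sub>m 1"
      using ca by (auto intro!: eq_matI simp: scalar_prod_def)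
    show ?thesis unfolding eq P_def
      by (subst mult_four_block_mat[of _ s s _ 1 _ 1 _ _ s _ 1]) (use adj c ca T b1 b2 b3 b4 in simp_all)
  qed
  moreover have "four_block_mat (d \<cdot>\<^sub>m 1\<^sub>m s) (0\<^sub>m s 1) (0\<^sub>m 1 s) ((d * ?f) \<cdot>\<^sub>m 1\<^sub>m 1)
      = mat_diag (Suc s) (\<lambda>i. (replicate s d @ [d * ?f]) ! i)"
    by (rule eq_matI) (auto simp: mat_diag_def nth_append)
  ultimately have diag: "P * ?M * ?K = mat_diag (Suc s) (\<lambda>i. (replicate s d @ [d * ?f]) ! i)"
    using P by (simp add: assoc_mult_mat[of _ "Suc s" "Suc s" _ "Suc s" _ "Suc s"] companion_pencil_carrier krylov_columns_def)
  have "det P = det (adj_mat ?T) * d"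
    unfolding P_def using adj ca by (subst det_four_block_mat_upper_right_zero[of _ s _ 1]) auto
  then have "\<not> p dvd det P"
    using prime_not_dvd_det_adj_mat[OF p(1) T] pd by (simp add: prime_elem_dvd_mult_iff[OF p(1)] d_def)
  moreover have "\<not> p dvd det ?K"
  proof
    assume "p dvd det ?K"
    then have "p dvd Y ^ s" using det_krylov_columns[of s X Y] by (metis dvd_mult2)
    then show False using p prime_elem_dvd_power[OF p(1)] by blast
  qed
  ultimately have "loc_diag p ?M (replicate s d @ [d * ?f])"
    by (intro loc_diagI[of _ "Suc s" _ P ?K]) (use P diag companion_pencil_carrier in \<open>auto simp: krylov_columns_def\<close>)
  then show thesis using that[OF pd] unfolding s by simp
qed

section \<open>Change of basis and normal forms\<close>

lemma equiv_units_sym: "equiv_units f g \<Longrightarrow> equiv_units g f"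
  unfolding equiv_units_iff_dvd by blast

lemma equiv_units_trans: "equiv_units f g \<Longrightarrow> equiv_units g h \<Longrightarrow> equiv_units f h"
  unfolding equiv_units_iff_dvd by (meson dvd_trans)

lemma equiv_units_refl: "equiv_units f f"
  unfolding equiv_units_iff_dvd by simp

lemma mult_2_2_index:
  fixes M N :: "'a :: comm_ring_1 mat"
  assumes "M \<in> carrier_mat 2 2" and "N \<in> carrier_mat 2 2" and "i < 2" and "j < 2"
  shows "(N * M) $$ (i, j) = N $$ (i, 0) * M $$ (0, j) + N $$ (i, 1) * M $$ (1, j)"
proof -
  have "{0..<2::nat} = {0, 1}" by auto
  then show ?thesis using assms by (simp add: scalar_prod_def)
qed

lemma change_basis_carrier:
  "fst B \<in> carrier_mat n m \<Longrightarrow> snd B \<in> carrier_mat n m \<Longrightarrow>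
   fst (change_basis g B) \<in> carrier_mat n m \<and> snd (change_basis g B) \<in> carrier_mat n m"
  by (simp add: change_basis_def)

lemma change_basis_mult:
  assumes g: "g \<in> carrier_mat 2 2" "q \<in> carrier_mat 2 2"
    and B: "fst B \<in> carrier_mat n m" "snd B \<in> carrier_mat n m"
  shows "change_basis q (change_basis g B) = change_basis (g * q) B"
  unfolding change_basis_def using B
  by (auto intro!: eq_matI simp: mult_2_2_index[OF g(2,1)] algebra_simps simp del: index_mult_mat(1))

lemma change_basis_one:
  assumes "fst B \<in> carrier_mat n m" "snd B \<in> carrier_mat n m"
  shows "change_basis (1\<^sub>m 2) B = B"
  using assms unfolding change_basis_def by (auto intro!: prod_eqI eq_matI)

lemma change_basis_congruence:
  fixes P :: "'a :: field mat"
  assumes P: "P \<in> carrier_mat k n" "Q \<in> carrier_mat n l"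
    and B: "A \<in> carrier_mat n n" "B \<in> carrier_mat n n"
  shows "change_basis g (P * A * Q, P * B * Q)
    = (P * fst (change_basis g (A, B)) * Q, P * snd (change_basis g (A, B)) * Q)"
proof -
  have "a \<cdot>\<^sub>m (P * A * Q) + b \<cdot>\<^sub>m (P * B * Q) = P * (a \<cdot>\<^sub>m A + b \<cdot>\<^sub>m B) * Q" for a b
    using P B by (simp add: mult_add_distrib_mat[of _ k n _ n] add_mult_distrib_mat[of _ k n _ _ l]
        mult_smult_distrib[of _ k n _ n] mult_smult_assoc_mat[of _ k n _ l])
  then show ?thesis by (simp add: change_basis_def)
qed

lemma hyperbolic_linear:
  fixes A B :: "'a :: field mat"
  assumes "A \<in> carrier_mat r r" "B \<in> carrier_mat r r"
  shows "a \<cdot>\<^sub>m hyperbolic r A + b \<cdot>\<^sub>m hyperbolic r B = hyperbolic r (a \<cdot>\<^sub>m A + b \<cdot>\<^sub>m B)"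
  using assms unfolding hyperbolic_def by (intro eq_matI) (auto simp: algebra_simps)

lemma change_basis_hyperbolic:
  fixes A B :: "'a :: field mat"
  assumes "A \<in> carrier_mat r r" "B \<in> carrier_mat r r"
  shows "change_basis g (hyperbolic r A, hyperbolic r B)
    = (hyperbolic r (fst (change_basis g (A, B))), hyperbolic r (snd (change_basis g (A, B))))"
  unfolding change_basis_def using assms by (simp add: hyperbolic_linear)

lemma pencil_change_basis:
  fixes A B :: "'a :: field mat"
  assumes "A \<in> carrier_mat n m" "B \<in> carrier_mat n m"
  shows "pencil (change_basis q (A, B)) = mat n m (\<lambda>(i, j).
    lin_form q 0 * const_xy (A $$ (i, j)) + lin_form q 1 * const_xy (B $$ (i, j)))"
proof (rule eq_matI)
  interpret c: comm_ring_hom "const_xy :: 'a \<Rightarrow> 'a poly poly" by (rule comm_ring_hom_const_xy)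
  fix i j assume "i < dim_row (mat n m (\<lambda>(i, j). lin_form q 0 * const_xy (A $$ (i, j)) + lin_form q 1 * const_xy (B $$ (i, j))))"
    "j < dim_col (mat n m (\<lambda>(i, j). lin_form q 0 * const_xy (A $$ (i, j)) + lin_form q 1 * const_xy (B $$ (i, j))))"
  then have ij: "i < n" "j < m" by auto
  have "pencil (change_basis q (A, B)) $$ (i, j)
      = var_x * const_xy (q $$ (0,0) * A $$ (i,j) + q $$ (1,0) * B $$ (i,j))
      + var_y * const_xy (q $$ (0,1) * A $$ (i,j) + q $$ (1,1) * B $$ (i,j))"
    using assms ij unfolding pencil_def change_basis_def by (simp del: mult_pCons_left mult_pCons_right)
  also have "\<dots> = lin_form q 0 * const_xy (A $$ (i, j)) + lin_form q 1 * const_xy (B $$ (i, j))"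
    unfolding lin_form_def c.hom_add c.hom_mult by (simp only: ring_distribs ac_simps)
  finally show "pencil (change_basis q (A, B)) $$ (i, j) = mat n m (\<lambda>(i, j).
    lin_form q 0 * const_xy (A $$ (i, j)) + lin_form q 1 * const_xy (B $$ (i, j))) $$ (i, j)"
    using ij by simp
qed (use assms in \<open>auto simp: pencil_def change_basis_def\<close>)

lemma pencil_companion:
  assumes "r > 0"
  shows "pencil (change_basis q (1\<^sub>m r, - companion r \<mu>)) = companion_pencil r \<mu> (lin_form q 0) (lin_form q 1)"
proof -
  interpret c: comm_ring_hom "const_xy :: 'a \<Rightarrow> 'a poly poly" by (rule comm_ring_hom_const_xy)
  have m: "[:- 1 :: 'a:] = - 1" by (metis minus_pCons minus_zero pCons_one)
  show ?thesis
    by (subst pencil_change_basis[of _ r r])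
      (auto simp: m companion_def companion_pencil_def pCons_one intro!: eq_matI)
qed

section \<open>Sloped summands, their normal forms and their Pfaffians\<close>

definition sloped_summand :: "nat \<Rightarrow> 'a :: field mat \<times> 'a mat \<Rightarrow> bool" where
  "sloped_summand n B \<longleftrightarrow> alternating_pair n B \<and> indecomposable n B \<and> n > 0 \<and> sloped B"

text \<open>The negated companion matrix makes the pencil of the off-diagonal blocks
  \<open>x - y C\<close>, whose determinant is the homogenisation of \<open>\<mu>\<close> up to a
  unit.\<close>

definition normal_at :: "'a :: field mat \<Rightarrow> nat \<Rightarrow> 'a mat \<times> 'a mat \<Rightarrow> nat \<Rightarrow> 'a poly \<Rightarrow> bool" where
  "normal_at g n B r \<mu> \<longleftrightarrow> n = r + r \<and> r > 0 \<and> lead_coeff \<mu> = 1 \<and> degree \<mu> = r \<and>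
     (\<exists>P\<in>carrier_mat n n. invertible_mat P \<and>
        P * fst (change_basis g B) * transpose_mat P = hyperbolic r (1\<^sub>m r) \<and>
        P * snd (change_basis g B) * transpose_mat P = hyperbolic r (- companion r \<mu>))"

lemma alternating_pair_carrier:
  "alternating_pair n B \<Longrightarrow> fst B \<in> carrier_mat n n \<and> snd B \<in> carrier_mat n n"
  by (simp add: alternating_pair_def alternating_mat_def)

lemma sloped_summand_carrier: "sloped_summand n B \<Longrightarrow> fst B \<in> carrier_mat n n" "sloped_summand n B \<Longrightarrow> snd B \<in> carrier_mat n n"
  using alternating_pair_carrier[of n B] by (auto simp: sloped_summand_def)

lemma alternating_pair_change_basis: "alternating_pair n B \<Longrightarrow> alternating_pair n (change_basis g B)"
  unfolding alternating_pair_def change_basis_def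
  by (simp add: alternating_mat_add alternating_mat_smult)

lemma self_adjoint_change_basis:
  fixes E :: "'a :: field mat"
  assumes E: "E \<in> carrier_mat n n" and B: "fst B \<in> carrier_mat n n" "snd B \<in> carrier_mat n n"
    and "transpose_mat E * fst B = fst B * E" "transpose_mat E * snd B = snd B * E"
  shows "transpose_mat E * fst (change_basis g B) = fst (change_basis g B) * E"
    and "transpose_mat E * snd (change_basis g B) = snd (change_basis g B) * E"
  using assms unfolding change_basis_def
  by (simp_all add: mult_add_distrib_mat[of _ n n _ n] add_mult_distrib_mat[of _ n n _ _ n]
      mult_smult_distrib[of _ n n _ n] mult_smult_assoc_mat[of _ n n _ n])

lemma indecomposable_change_basis:
  assumes B: "indecomposable n B" "fst B \<in> carrier_mat n n" "snd B \<in> carrier_mat n n"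
    and g: "g \<in> carrier_mat 2 2" "invertible_mat g"
  shows "indecomposable n (change_basis g B)"
  unfolding indecomposable_def
proof (intro ballI impI)
  obtain q where q: "q \<in> carrier_mat 2 2" "g * q = 1\<^sub>m 2" using invertible_matE[OF g] by blast
  fix E :: "'a mat" assume E: "E \<in> carrier_mat n n"
    and *: "E * E = E \<and> transpose_mat E * fst (change_basis g B) = fst (change_basis g B) * E \<and>
      transpose_mat E * snd (change_basis g B) = snd (change_basis g B) * E"
  have "change_basis q (change_basis g B) = B"
    unfolding change_basis_mult[OF g(1) q(1) B(2,3)] q(2) by (rule change_basis_one[OF B(2,3)])
  moreover have "fst (change_basis g B) \<in> carrier_mat n n" "snd (change_basis g B) \<in> carrier_mat n n"
    using change_basis_carrier[OF B(2,3)] by auto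
  ultimately have "transpose_mat E * fst B = fst B * E" "transpose_mat E * snd B = snd B * E"
    using self_adjoint_change_basis[OF E, of "change_basis g B" q] * by auto
  then show "E = 0\<^sub>m n n \<or> E = 1\<^sub>m n" using B(1) E * unfolding indecomposable_def by blast
qed

lemma sloped_summand_normal_at:
  assumes B: "sloped_summand n B" and g: "g \<in> carrier_mat 2 2" "invertible_mat g" "invertible_mat (fst (change_basis g B))"
  obtains r \<mu> p e c where "normal_at g n B r \<mu>" "irreducible p" "e > 0" "c \<noteq> 0" "\<mu> = Polynomial.smult c (p ^ e)"
proof -
  have c: "fst (change_basis g B) \<in> carrier_mat n n"
    using change_basis_carrier sloped_summand_carrier[OF B] by blast
  obtain A' where A': "A' \<in> carrier_mat n n" "fst (change_basis g B) * A' = 1\<^sub>m n" "A' * fst (change_basis g B) = 1\<^sub>m n"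
    by (rule invertible_matE[OF c g(3)])
  interpret sloped_pair n "fst (change_basis g B)" "snd (change_basis g B)" A' "- (A' * snd (change_basis g B))"
  proof
    show "alternating_mat n (fst (change_basis g B))" "alternating_mat n (snd (change_basis g B))"
      using alternating_pair_change_basis[of n B g] B by (auto simp: sloped_summand_def alternating_pair_def)
    show "indecomposable n (fst (change_basis g B), snd (change_basis g B))"
      using indecomposable_change_basis[of n B g] B g sloped_summand_carrier[OF B] by (simp add: sloped_summand_def)
    show "n > 0" using B by (simp add: sloped_summand_def)
  qed (use A' in auto)
  obtain r \<mu> p e c P where "n = r + r" "lead_coeff \<mu> = 1" "degree \<mu> = r" "r > 0"
    "irreducible p" "e > 0" "c \<noteq> 0" "\<mu> = Polynomial.smult c (p ^ e)"
    "P \<in> carrier_mat n n" "invertible_mat P"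
    "P * fst (change_basis g B) * transpose_mat P = hyperbolic r (1\<^sub>m r)"
    "P * snd (change_basis g B) * transpose_mat P = hyperbolic r (- companion r \<mu>)"
    by (rule normal_form)
  then show thesis by (intro that[of r \<mu> p e c]) (auto simp: normal_at_def)
qed

text \<open>Congruence commutes with change of basis of k^2. Applying the inverse \<open>q\<close>
  of \<open>g\<close> to the normal form therefore keeps it hyperbolic and replaces the variables in
  its pencil by the linear forms of \<open>q\<close>.\<close>

lemma normal_at_inverse:
  assumes nf: "normal_at g n B r \<mu>" and B: "fst B \<in> carrier_mat n n" "snd B \<in> carrier_mat n n"
    and g: "g \<in> carrier_mat 2 2" "q \<in> carrier_mat 2 2" "g * q = 1\<^sub>m 2"
  obtains P \<Psi>\<^sub>1 \<Psi>\<^sub>2 where "P \<in> carrier_mat n n" "invertible_mat P"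
    "\<Psi>\<^sub>1 \<in> carrier_mat r r" "\<Psi>\<^sub>2 \<in> carrier_mat r r"
    "P * fst B * transpose_mat P = hyperbolic r \<Psi>\<^sub>1" "P * snd B * transpose_mat P = hyperbolic r \<Psi>\<^sub>2"
    "pencil (\<Psi>\<^sub>1, \<Psi>\<^sub>2) = companion_pencil r \<mu> (lin_form q 0) (lin_form q 1)"
proof -
  obtain P where P: "P \<in> carrier_mat n n" "invertible_mat P"
    "P * fst (change_basis g B) * transpose_mat P = hyperbolic r (1\<^sub>m r)"
    "P * snd (change_basis g B) * transpose_mat P = hyperbolic r (- companion r \<mu>)"
    and r: "r > 0"
    using nf unfolding normal_at_def by blast
  define \<Psi> where "\<Psi> = change_basis q (1\<^sub>m r, - companion r \<mu>)"
  have C: "1\<^sub>m r \<in> carrier_mat r r" "- companion r \<mu> \<in> carrier_mat r r" by (auto simp: companion_def)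
  have \<Psi>: "fst \<Psi> \<in> carrier_mat r r" "snd \<Psi> \<in> carrier_mat r r"
    using change_basis_carrier[of "(1\<^sub>m r, - companion r \<mu>)" r r q] C by (auto simp: \<Psi>_def)
  have Bg: "change_basis q (change_basis g B) = B"
    unfolding change_basis_mult[OF g(1,2) B] g(3) by (rule change_basis_one[OF B])
  have cg: "fst (change_basis g B) \<in> carrier_mat n n" "snd (change_basis g B) \<in> carrier_mat n n"
    using change_basis_carrier[OF B] by auto
  have "(P * fst B * transpose_mat P, P * snd B * transpose_mat P)
      = change_basis q (hyperbolic r (1\<^sub>m r), hyperbolic r (- companion r \<mu>))"
    using change_basis_congruence[OF P(1) transpose_carrier_mat[THEN iffD2, OF P(1)] cg, of q] P(3,4) Bg by simp
  also have "\<dots> = (hyperbolic r (fst \<Psi>), hyperbolic r (snd \<Psi>))"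
    unfolding change_basis_hyperbolic[OF C] \<Psi>_def ..
  finally have "P * fst B * transpose_mat P = hyperbolic r (fst \<Psi>)" "P * snd B * transpose_mat P = hyperbolic r (snd \<Psi>)"
    by auto
  moreover have "pencil (fst \<Psi>, snd \<Psi>) = companion_pencil r \<mu> (lin_form q 0) (lin_form q 1)"
    using pencil_companion[OF r] by (simp add: \<Psi>_def)
  ultimately show thesis using that P(1,2) \<Psi> by blast
qed

text \<open>If the second form vanished, the first would divide both and be a unit, but it is prime
  as the image of a variable under an invertible substitution.\<close>

lemma lin_form_nonzero:
  assumes "q \<in> carrier_mat 2 2" "g \<in> carrier_mat 2 2" "q * g = 1\<^sub>m 2"
  shows "lin_form q 1 \<noteq> 0"
proof
  assume "lin_form q 1 = 0"
  then have "lin_form q 0 dvd lin_form q 1" by simp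
  then have "lin_form q 0 dvd 1" using dvd_lin_forms_imp_unit[OF assms, of "lin_form q 0"] by simp
  moreover have "prime_elem (lin_form q 0)"
  proof -
    have "irreducible [:0, 1 :: 'a:]" by (rule irreducible_linear_field_poly) simp
    from prime_elem_homog_lin_form[OF this assms mat_mult_left_right_inverse[OF assms]]
    have "prime_elem (homog 1 [:0, 1 :: 'a:] (lin_form q 0) (lin_form q 1))" by simp
    then show ?thesis by (simp add: homog_def pCons_one)
  qed
  ultimately show False using prime_elem_not_unit by blast
qed

text \<open>The normal form supplies a witness for the choice in \<open>Pf\<close>; uniqueness up to
  scalars then relates the chosen value to the homogenised \<open>\<mu>\<close>.\<close>

lemma normal_at_is_Pf:
  assumes nf: "normal_at g n B r \<mu>" and B: "fst B \<in> carrier_mat n n" "snd B \<in> carrier_mat n n"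
    and g: "g \<in> carrier_mat 2 2" "q \<in> carrier_mat 2 2" "g * q = 1\<^sub>m 2"
  shows "is_Pf B (Pf B)" and "equiv_units (Pf B) (homog r \<mu> (lin_form q 0) (lin_form q 1))"
proof -
  have n: "n = r + r" "r > 0" "lead_coeff \<mu> = 1" "degree \<mu> = r" using nf by (auto simp: normal_at_def)
  let ?f = "det (companion_pencil r \<mu> (lin_form q 0) (lin_form q 1))"
  obtain P \<Psi>\<^sub>1 \<Psi>\<^sub>2 where P: "P \<in> carrier_mat n n" "invertible_mat P"
    "\<Psi>\<^sub>1 \<in> carrier_mat r r" "\<Psi>\<^sub>2 \<in> carrier_mat r r"
    "P * fst B * transpose_mat P = hyperbolic r \<Psi>\<^sub>1" "P * snd B * transpose_mat P = hyperbolic r \<Psi>\<^sub>2"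
    "pencil (\<Psi>\<^sub>1, \<Psi>\<^sub>2) = companion_pencil r \<mu> (lin_form q 0) (lin_form q 1)"
    by (rule normal_at_inverse[OF assms])
  have f: "is_Pf B ?f"
    unfolding is_Pf_def by (rule exI[of _ r], intro exI[of _ P] exI[of _ \<Psi>\<^sub>1] exI[of _ \<Psi>\<^sub>2])
      (use P B n in \<open>auto simp: disc_def\<close>)
  then show Pf: "is_Pf B (Pf B)" unfolding Pf_def by (rule someI)
  have "lin_form q 1 \<noteq> 0" by (rule lin_form_nonzero[OF g(2,1) mat_mult_left_right_inverse[OF g]])
  then show "equiv_units (Pf B) (homog r \<mu> (lin_form q 0) (lin_form q 1))"
    using is_Pf_unique[OF Pf f] det_companion_pencil[OF n(3,4,2)] equiv_units_trans by blast
qed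

lemma sloped_summand_is_Pf:
  assumes "sloped_summand n B"
  shows "is_Pf B (Pf B)"
proof -
  obtain g where g: "g \<in> carrier_mat 2 2" "invertible_mat g" "invertible_mat (fst (change_basis g B))"
    using assms by (auto simp: sloped_summand_def sloped_def)
  obtain q where q: "q \<in> carrier_mat 2 2" "g * q = 1\<^sub>m 2" using invertible_matE[OF g(1,2)] by blast
  obtain r \<mu> where "normal_at g n B r \<mu>" by (rule sloped_summand_normal_at[OF assms g])
  from normal_at_is_Pf(1)[OF this sloped_summand_carrier[OF assms] g(1) q] show ?thesis .
qed

lemma sloped_summand_Pf_primary:
  assumes "sloped_summand n B"
  obtains p e where "prime_elem p" "e > 0" "equiv_units (Pf B) (p ^ e)"
proof -
  obtain g where g: "g \<in> carrier_mat 2 2" "invertible_mat g" "invertible_mat (fst (change_basis g B))"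
    using assms by (auto simp: sloped_summand_def sloped_def)
  obtain q where q: "q \<in> carrier_mat 2 2" "g * q = 1\<^sub>m 2" "q * g = 1\<^sub>m 2" using invertible_matE[OF g(1,2)] by blast
  obtain r \<mu> p e c where nf: "normal_at g n B r \<mu>" and p: "irreducible p" "e > 0" "c \<noteq> 0" "\<mu> = Polynomial.smult c (p ^ e)"
    by (rule sloped_summand_normal_at[OF assms g])
  let ?X = "lin_form q 0" and ?Y = "lin_form q 1"
  \<comment> \<open>The degree of homogenisation is exactly \<open>e\<close> times the degree of
    \<open>p\<close>, so \<open>homog\<close> of the power is the power of \<open>homog\<close>
    without surplus factors of \<open>?Y\<close>.\<close>
  have r: "r = degree p * e"
    using nf p irreducible_imp_prime_elem by (auto simp: normal_at_def degree_power_eq irreducible_def)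
  have "homog r \<mu> ?X ?Y = const_xy c * homog (degree p) p ?X ?Y ^ e"
    unfolding p(4) homog_smult r by (simp only: homog_power[OF order_refl])
  then have "equiv_units (homog r \<mu> ?X ?Y) (homog (degree p) p ?X ?Y ^ e)"
    using p(3) unfolding equiv_units_def by blast
  then have "equiv_units (Pf B) (homog (degree p) p ?X ?Y ^ e)"
    using normal_at_is_Pf(2)[OF nf sloped_summand_carrier[OF assms] g(1) q(1,2)] equiv_units_trans by blast
  with prime_elem_homog_lin_form[OF p(1) q(1) g(1) q(3,2)] p(2) show thesis using that by blast
qed

section \<open>Local diagonal form of the pencil of one summand\<close>

lemma pencil_congruence:
  fixes P :: "'a :: field mat"
  assumes P: "P \<in> carrier_mat k n" and Q: "Q \<in> carrier_mat n l"
    and A: "A \<in> carrier_mat n n" and B: "B \<in> carrier_mat n n"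
  shows "pencil (P * A * Q, P * B * Q) = map_mat const_xy P * pencil (A, B) * map_mat const_xy Q"
proof -
  interpret h: comm_ring_hom "const_xy :: 'a \<Rightarrow> 'a poly poly" by (rule comm_ring_hom_const_xy)
  let ?c = "map_mat const_xy :: 'a mat \<Rightarrow> 'a poly poly mat"
  have cP: "?c P \<in> carrier_mat k n" "?c Q \<in> carrier_mat n l" "?c A \<in> carrier_mat n n" "?c B \<in> carrier_mat n n"
    using P Q A B by auto
  have hom: "?c (P * C * Q) = ?c P * ?c C * ?c Q" if "C \<in> carrier_mat n n" for C
    using h.mat_hom_mult[OF mult_carrier_mat[OF P that] Q] h.mat_hom_mult[OF P that] by simp
  show ?thesis
    unfolding pencil_def fst_conv snd_conv hom[OF A] hom[OF B]
    using cP by (simp add: mult_add_distrib_mat[of _ k n _ n] add_mult_distrib_mat[of _ k n _ _ l]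
        mult_smult_distrib[of _ k n _ n] mult_smult_assoc_mat[of _ k n _ l])
qed

lemma pencil_hyperbolic:
  fixes A B :: "'a :: field mat"
  assumes A: "A \<in> carrier_mat n n" and B: "B \<in> carrier_mat n n"
  shows "pencil (hyperbolic n A, hyperbolic n B)
    = four_block_mat (0\<^sub>m n n) (pencil (A, B)) (- transpose_mat (pencil (A, B))) (0\<^sub>m n n)"
  by (rule eq_matI) (use A B in \<open>auto simp: pencil_def hyperbolic_def\<close>)

lemma prime_not_dvd_det_const:
  fixes P :: "'a :: field mat"
  assumes p: "prime_elem p" and P: "P \<in> carrier_mat n n" "invertible_mat P"
  shows "\<not> p dvd det (map_mat const_xy P)"
proof
  interpret h: comm_ring_hom "const_xy :: 'a \<Rightarrow> 'a poly poly" by (rule comm_ring_hom_const_xy)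
  assume "p dvd det (map_mat const_xy P)"
  then have "p dvd const_xy (det P)" by (simp only: h.hom_det)
  moreover have "const_xy (det P) dvd 1"
    using P invertible_mat_iff_det[OF P(1)] by (simp add: is_unit_const_poly_iff)
  ultimately show False using p prime_elem_not_unit dvd_trans by blast
qed

text \<open>If \<open>p\<close> does not divide \<open>?Y\<close>, the diagonal form of the
  companion pencil has a single entry that can be divisible by \<open>p\<close>, and the hyperbolic
  shape doubles it. If \<open>p\<close> divides \<open>?Y\<close>, then the homogenised
  \<open>\<mu>\<close> is congruent to \<open>?X ^ r\<close>, so \<open>p\<close> cannot divide it
  without dividing both linear forms; every diagonal entry is then prime to
  \<open>p\<close>.\<close>

lemma loc_diag_sloped_summand:
  fixes B :: "'a :: field mat \<times> 'a mat"
  assumes B: "sloped_summand n B" and p: "prime_elem p"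
  shows "\<exists>ds. loc_diag p (pencil B) ds \<and>
    (\<forall>k>0. length (filter (\<lambda>d. p ^ k dvd d) ds) = (if p ^ k dvd Pf B then 2 else 0))"
proof -
  obtain g where g: "g \<in> carrier_mat 2 2" "invertible_mat g" "invertible_mat (fst (change_basis g B))"
    using B by (auto simp: sloped_summand_def sloped_def)
  obtain q where q: "q \<in> carrier_mat 2 2" "g * q = 1\<^sub>m 2" "q * g = 1\<^sub>m 2" using invertible_matE[OF g(1,2)] by blast
  obtain r \<mu> where nf: "normal_at g n B r \<mu>" by (rule sloped_summand_normal_at[OF B g])
  let ?X = "lin_form q 0" and ?Y = "lin_form q 1"
  let ?M = "companion_pencil r \<mu> ?X ?Y" and ?f = "homog r \<mu> ?X ?Y"
  have n: "n = r + r" "r > 0" "lead_coeff \<mu> = 1" "degree \<mu> = r" using nf by (auto simp: normal_at_def)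
  note Pf = normal_at_is_Pf(2)[OF nf sloped_summand_carrier[OF B] g(1) q(1,2)]
  obtain P \<Psi>\<^sub>1 \<Psi>\<^sub>2 where P: "P \<in> carrier_mat n n" "invertible_mat P"
    "\<Psi>\<^sub>1 \<in> carrier_mat r r" "\<Psi>\<^sub>2 \<in> carrier_mat r r"
    "P * fst B * transpose_mat P = hyperbolic r \<Psi>\<^sub>1" "P * snd B * transpose_mat P = hyperbolic r \<Psi>\<^sub>2"
    "pencil (\<Psi>\<^sub>1, \<Psi>\<^sub>2) = ?M"
    by (rule normal_at_inverse[OF nf sloped_summand_carrier[OF B] g(1) q(1,2)])
  have tP: "transpose_mat P \<in> carrier_mat n n" "invertible_mat (transpose_mat P)"
    using P invertible_mat_transpose by auto
  have pB: "pencil B \<in> carrier_mat n n" using pencil_carrier[of "fst B" n n "snd B"] sloped_summand_carrier[OF B] by simp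
  have eq: "four_block_mat (0\<^sub>m r r) ?M (- transpose_mat ?M) (0\<^sub>m r r)
      = map_mat const_xy P * pencil B * map_mat const_xy (transpose_mat P)"
    using pencil_congruence[OF P(1) tP(1) sloped_summand_carrier[OF B]] pencil_hyperbolic[OF P(3,4)] P(5-7) by simp
  have *: "loc_diag p (pencil B) (ds @ ds)" if "loc_diag p ?M ds" "length ds = r" for ds
    using loc_diag_mult[OF p loc_diag_hyperbolic[OF p that] _ _ _ pB
        prime_not_dvd_det_const[OF p P(1,2)] prime_not_dvd_det_const[OF p tP] eq] P(1) that(2) n(1)
    by simp
  have dvdPf: "x dvd Pf B \<longleftrightarrow> x dvd ?f" for x
    using Pf unfolding equiv_units_iff_dvd by (meson dvd_trans)
  show ?thesis
  proof (cases "p dvd ?Y")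
    case True
    have "\<not> p dvd ?f"
    proof
      assume pf: "p dvd ?f"
      obtain s where s: "r = Suc s" using n(2) by (cases r) auto
      define Z where "Z = (\<Sum>i\<le>s. const_xy (coeff \<mu> i) * ?X ^ i * ?Y ^ (s - i))"
      have "?f = ?X ^ r + ?Y * Z"
        unfolding s homog_eq_sum_Y Z_def using n(3,4) s by (simp add: pCons_one)
      moreover have "p dvd ?Y * Z" using True by (rule dvd_mult2)
      ultimately have "p dvd ?X ^ r" using pf by (metis dvd_add_left_iff)
      then have "p dvd ?X" using prime_elem_dvd_power[OF p] by blast
      then have "p dvd 1" using True dvd_lin_forms_imp_unit[OF q(1) g(1) q(3)] by blast
      with p show False using prime_elem_not_unit by blast
    qed
    moreover have "equiv_units (det ?M) ?f"
      by (rule det_companion_pencil[OF n(3,4,2) lin_form_nonzero[OF q(1) g(1) q(3)]])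
    ultimately have det: "\<not> p dvd det ?M" unfolding equiv_units_iff_dvd by (meson dvd_trans)
    have k: "\<not> p ^ k dvd x" if "\<not> p dvd x" "k > 0" for k x
      using that by (meson dvd_power dvd_trans)
    have "loc_diag p (pencil B) (replicate r (det ?M) @ replicate r (det ?M))"
      by (rule *[OF loc_diag_adj[OF p companion_pencil_carrier det]]) simp
    then show ?thesis
      using k[OF det] k[OF \<open>\<not> p dvd ?f\<close>] unfolding dvdPf
      by (intro exI[of _ "replicate r (det ?M) @ replicate r (det ?M)"]) (simp add: filter_replicate)
  next
    case False
    obtain d where d: "\<not> p dvd d" "loc_diag p ?M (replicate (r - 1) d @ [d * ?f])"
      by (rule loc_diag_companion_pencil[OF n(3,4,2) p False])
    let ?ds = "replicate (r - 1) d @ [d * ?f]"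
    have k: "\<not> p ^ k dvd d" if "k > 0" for k using d(1) that by (meson dvd_power dvd_trans)
    have f: "p ^ k dvd d * ?f \<longleftrightarrow> p ^ k dvd ?f" if "k > 0" for k
      using prime_power_dvd_multD[OF p _ that d(1)] by (meson dvd_mult)
    have "loc_diag p (pencil B) (?ds @ ?ds)" by (rule *[OF d(2)]) (use n(2) in simp)
    moreover have "length (filter (\<lambda>x. p ^ k dvd x) ((replicate (r - 1) d @ [d * F]) @ (replicate (r - 1) d @ [d * F])))
        = (if p ^ k dvd F then 2 else 0)" if "k > 0" "p ^ k dvd d * F \<longleftrightarrow> p ^ k dvd F" for k F
      using that k[OF that(1)] by (simp add: filter_replicate)
    ultimately show ?thesis unfolding dvdPf using f by blast
  qed
qed

section \<open>Congruence and twisting\<close>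

definition congruent :: "nat \<Rightarrow> 'a :: field mat \<times> 'a mat \<Rightarrow> 'a mat \<times> 'a mat \<Rightarrow> bool" where
  "congruent n B B' \<longleftrightarrow> (\<exists>N\<in>carrier_mat n n. invertible_mat N \<and>
     fst B = transpose_mat N * fst B' * N \<and> snd B = transpose_mat N * snd B' * N)"

text \<open>Arranged so that \<open>bimap (twist h B)\<close> at the \<tau>-images of
  \<open>u\<close> and \<open>v\<close> is \<open>act_vec h (bimap B u v)\<close>. Pseudo-isometries
  over \<open>h\<close> thereby become congruences of the twisted pair.\<close>

definition twist :: "'a :: field mat \<times> ('a \<Rightarrow> 'a) \<Rightarrow> 'a mat \<times> 'a mat \<Rightarrow> 'a mat \<times> 'a mat" where
  "twist h B = change_basis (fst h) (map_mat (snd h) (fst B), map_mat (snd h) (snd B))"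

lemma is_Pf_square:
  fixes B :: "'a :: field mat \<times> 'a mat"
  assumes "is_Pf B f"
  obtains c where "c \<noteq> 0" "f\<^sup>2 = const_xy c * det (pencil B)"
proof -
  obtain n P \<Psi>\<^sub>1 \<Psi>\<^sub>2 where *:
    "fst B \<in> carrier_mat (n + n) (n + n)" "snd B \<in> carrier_mat (n + n) (n + n)"
    "P \<in> carrier_mat (n + n) (n + n)" "invertible_mat P"
    "\<Psi>\<^sub>1 \<in> carrier_mat n n" "\<Psi>\<^sub>2 \<in> carrier_mat n n"
    "P * fst B * transpose_mat P = hyperbolic n \<Psi>\<^sub>1"
    "P * snd B * transpose_mat P = hyperbolic n \<Psi>\<^sub>2"
    "f = disc (\<Psi>\<^sub>1, \<Psi>\<^sub>2)"
    using assms unfolding is_Pf_def by blast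
  have "det P \<noteq> 0" using * invertible_mat_iff_det by blast
  moreover have "f\<^sup>2 = const_xy ((det P)\<^sup>2) * det (pencil B)"
    using det_pencil_hyperbolic[OF *(5,6)] det_pencil_congruence[OF *(3,1,2)] *(7-9) by simp
  ultimately show thesis by (intro that[of "(det P)\<^sup>2"]) auto
qed

text \<open>The first form after the change of basis is the pencil at
  \<open>x = g $$ (0, 0)\<close>, \<open>y = g $$ (1, 0)\<close>; the inner evaluation sets
  \<open>y\<close>, the outer one \<open>x\<close>.\<close>

lemma det_change_basis_eq_eval:
  fixes B :: "'a :: field mat \<times> 'a mat"
  assumes "fst B \<in> carrier_mat n n" "snd B \<in> carrier_mat n n"
  shows "det (fst (change_basis g B)) = poly (poly (det (pencil B)) [:g $$ (1, 0):]) (g $$ (0, 0))"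
proof -
  let ?ev = "\<lambda>f :: 'a poly poly. poly (poly f [:g $$ (1, 0):]) (g $$ (0, 0))"
  interpret ev: comm_ring_hom ?ev by unfold_locales auto
  have "fst (change_basis g B) = map_mat ?ev (pencil B)"
    using assms by (intro eq_matI) (auto simp: change_basis_def pencil_def mult.commute)
  then show ?thesis by (simp only: ev.hom_det)
qed

text \<open>The squared Pfaffian is a scalar times the determinant of the pencil, so the
  \<open>g\<close> that makes the first form of \<open>B\<close> invertible does the same for
  \<open>B'\<close>. In these common coordinates both Pfaffians are homogenisations of monic
  polynomials; being proportional they come from the same polynomial, and both pairs share one
  normal form.\<close>

lemma sloped_summand_congruent_of_Pf:
  fixes B B' :: "'a :: field mat \<times> 'a mat"
  assumes B: "sloped_summand n B" and B': "sloped_summand m B'" and eq: "equiv_units (Pf B) (Pf B')"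
  shows "n = m \<and> congruent n B B'"
proof -
  note c = sloped_summand_carrier[OF B] and c' = sloped_summand_carrier[OF B']
  obtain g where g: "g \<in> carrier_mat 2 2" "invertible_mat g" "invertible_mat (fst (change_basis g B))"
    using B by (auto simp: sloped_summand_def sloped_def)
  obtain q where q: "q \<in> carrier_mat 2 2" "g * q = 1\<^sub>m 2" "q * g = 1\<^sub>m 2" using invertible_matE[OF g(1,2)] by blast
  have cg: "fst (change_basis g B) \<in> carrier_mat n n" "snd (change_basis g B) \<in> carrier_mat n n"
    using change_basis_carrier[OF c] by auto
  have cg': "fst (change_basis g B') \<in> carrier_mat m m" "snd (change_basis g B') \<in> carrier_mat m m"
    using change_basis_carrier[OF c'] by auto
  obtain a where a: "a \<noteq> 0" "Pf B = const_xy a * Pf B'" using eq unfolding equiv_units_def by blast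
  obtain b where b: "b \<noteq> 0" "(Pf B)\<^sup>2 = const_xy b * det (pencil B)" using sloped_summand_is_Pf[OF B] by (rule is_Pf_square)
  obtain b' where b': "b' \<noteq> 0" "(Pf B')\<^sup>2 = const_xy b' * det (pencil B')" using sloped_summand_is_Pf[OF B'] by (rule is_Pf_square)
  let ?ev = "\<lambda>f :: 'a poly poly. poly (poly f [:g $$ (1, 0):]) (g $$ (0, 0))"
  have "b * ?ev (det (pencil B)) = ?ev ((Pf B)\<^sup>2)" unfolding b(2) by simp
  also have "\<dots> = a\<^sup>2 * ?ev ((Pf B')\<^sup>2)" unfolding a(2) by (simp add: power2_eq_square)
  also have "\<dots> = a\<^sup>2 * b' * ?ev (det (pencil B'))" unfolding b'(2) by simp
  finally have "det (fst (change_basis g B')) \<noteq> 0"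
    using g(3) b(1) unfolding invertible_mat_iff_det[OF cg(1)] det_change_basis_eq_eval[OF c] det_change_basis_eq_eval[OF c']
    by auto
  then have g': "invertible_mat (fst (change_basis g B'))" by (simp add: invertible_mat_iff_det[OF cg'(1)])
  obtain r \<mu> where nf: "normal_at g n B r \<mu>" by (rule sloped_summand_normal_at[OF B g])
  obtain r' \<mu>' where nf': "normal_at g m B' r' \<mu>'" by (rule sloped_summand_normal_at[OF B' g(1,2) g'])
  have "equiv_units (homog r \<mu> (lin_form q 0) (lin_form q 1)) (homog r' \<mu>' (lin_form q 0) (lin_form q 1))"
    using normal_at_is_Pf(2)[OF nf c g(1) q(1,2)] normal_at_is_Pf(2)[OF nf' c' g(1) q(1,2)] eq
    by (meson equiv_units_sym equiv_units_trans)
  then obtain k where k: "k \<noteq> 0" "homog r \<mu> (lin_form q 0) (lin_form q 1)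
      = const_xy k * homog r' \<mu>' (lin_form q 0) (lin_form q 1)"
    unfolding equiv_units_def by blast
  interpret s: comm_ring_hom "subst_lin g" by (rule comm_ring_hom_subst_lin)
  \<comment> \<open>Substituting by \<open>g\<close> undoes the linear forms of its inverse
    \<open>q\<close>; setting \<open>y = 1\<close> afterwards recovers the polynomials
    themselves.\<close>
  have sub: "subst_lin g (homog l f (lin_form q 0) (lin_form q 1)) = homog l f var_x var_y" for l and f :: "'a poly"
    using subst_lin_lin_form[OF g(1) q(1), of 0] subst_lin_lin_form[OF g(1) q(1), of 1] q(3)
    by (subst hom_homog[OF comm_ring_hom_subst_lin]) (simp_all add: subst_lin_simps lin_form_one[simplified])
  have "homog r \<mu> var_x var_y = const_xy k * homog r' \<mu>' var_x var_y"
    using arg_cong[OF k(2), of "subst_lin g"] unfolding s.hom_mult sub subst_lin_simps .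
  then have "poly (homog r \<mu> var_x var_y) 1 = Polynomial.smult k (poly (homog r' \<mu>' var_x var_y) 1)" by simp
  moreover have deg: "degree \<mu> = r" "degree \<mu>' = r'" and lead: "lead_coeff \<mu> = 1" "lead_coeff \<mu>' = 1"
    and n: "n = r + r" "m = r' + r'"
    using nf nf' by (auto simp: normal_at_def)
  ultimately have \<mu>: "\<mu> = Polynomial.smult k \<mu>'" by (simp add: poly_homog_1)
  then have "k = 1" using lead k(1) by simp
  then have \<mu>: "\<mu> = \<mu>'" using \<mu> by simp
  then have r: "r' = r" and m: "m = n" using deg n by auto
  obtain P where P: "P \<in> carrier_mat n n" "invertible_mat P"
    "P * fst (change_basis g B) * transpose_mat P = hyperbolic r (1\<^sub>m r)"
    "P * snd (change_basis g B) * transpose_mat P = hyperbolic r (- companion r \<mu>)"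
    using nf unfolding normal_at_def by blast
  obtain P' where P': "P' \<in> carrier_mat n n" "invertible_mat P'"
    "P' * fst (change_basis g B') * transpose_mat P' = hyperbolic r (1\<^sub>m r)"
    "P' * snd (change_basis g B') * transpose_mat P' = hyperbolic r (- companion r \<mu>)"
    using nf' unfolding normal_at_def m r \<mu>[symmetric] by blast
  obtain Q where Q: "Q \<in> carrier_mat n n" "P * Q = 1\<^sub>m n" "Q * P = 1\<^sub>m n" by (rule invertible_matE[OF P(1,2)])
  \<comment> \<open>The transpose of \<open>P^-1 P'\<close>: go to the common normal form through
    one basis and return through the other.\<close>
  define N where "N = transpose_mat (Q * P')"
  have N: "N \<in> carrier_mat n n" using Q P' by (simp add: N_def)
  have tN: "transpose_mat N = Q * P'" by (simp add: N_def)
  have "invertible_mat Q" by (rule invertible_matI[OF Q(1) P(1) Q(3,2)])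
  then have invN: "invertible_mat N"
    unfolding N_def using Q(1) P'(1,2) by (intro invertible_mat_transpose[of _ n] invertible_mat_mult[of _ n]) auto
  have *: "X = transpose_mat N * X' * N"
    if "X \<in> carrier_mat n n" "X' \<in> carrier_mat n n" "P * X * transpose_mat P = P' * X' * transpose_mat P'" for X X'
  proof -
    have tQ: "transpose_mat P * transpose_mat Q = 1\<^sub>m n"
      using transpose_mult[OF Q(1) P(1)] Q(3) by simp
    have "X = (Q * P) * X * (transpose_mat P * transpose_mat Q)" unfolding Q(3) tQ using that(1) by simp
    also have "\<dots> = Q * (P * X * transpose_mat P) * transpose_mat Q"
      using that(1) Q(1) P(1) by (simp add: assoc_mult_mat[of _ n n _ n _ n] mult_carrier_mat[of _ n n _ n])
    also have "\<dots> = (Q * P') * X' * (transpose_mat P' * transpose_mat Q)"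
      unfolding that(3) using that(2) Q(1) P'(1) by (simp add: assoc_mult_mat[of _ n n _ n _ n] mult_carrier_mat[of _ n n _ n])
    also have "transpose_mat P' * transpose_mat Q = N" unfolding N_def using transpose_mult[OF Q(1) P'(1)] by simp
    finally show ?thesis unfolding tN .
  qed
  have Bg: "change_basis q (change_basis g B) = B"
    unfolding change_basis_mult[OF g(1) q(1) c] q(2) by (rule change_basis_one[OF c])
  have Bg': "change_basis q (change_basis g B') = B'"
    unfolding change_basis_mult[OF g(1) q(1) c'] q(2) by (rule change_basis_one[OF c'])
  have "change_basis g B = (transpose_mat N * fst (change_basis g B') * N, transpose_mat N * snd (change_basis g B') * N)"
    using *[OF cg(1) cg'(1)[unfolded m]] *[OF cg(2) cg'(2)[unfolded m]] P(3,4) P'(3,4) by (simp add: prod_eq_iff)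
  then have "B = (transpose_mat N * fst B' * N, transpose_mat N * snd B' * N)"
    using change_basis_congruence[OF transpose_carrier_mat[THEN iffD2, OF N] N cg'[unfolded m], of q] Bg Bg' by simp
  then show ?thesis using N invN m unfolding congruent_def by (metis fst_conv snd_conv)
qed

section \<open>The action of \<open>GammaL2\<close> on pairs, Pfaffians and
  indecomposability\<close>

lemma map_mat_hyperbolic:
  assumes "comm_ring_hom \<tau>" and "A \<in> carrier_mat n n"
  shows "map_mat \<tau> (hyperbolic n A) = hyperbolic n (map_mat \<tau> A)"
proof -
  interpret comm_ring_hom \<tau> by fact
  show ?thesis using assms(2) unfolding hyperbolic_def by (intro eq_matI) (auto simp: hom_uminus)
qed

context
  fixes h :: "'a :: field mat \<times> ('a \<Rightarrow> 'a)"
  assumes h: "h \<in> GammaL2"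
begin

lemma fst_GammaL2: "fst h \<in> carrier_mat 2 2" "invertible_mat (fst h)"
  and snd_GammaL2: "field_isom (snd h)"
  using h by (auto simp: GammaL2_def)

interpretation \<tau>: field_isom "snd h" by (rule snd_GammaL2)

lemma comm_ring_hom_snd: "comm_ring_hom (snd h)" ..

lemma invertible_map_mat:
  assumes "A \<in> carrier_mat n n" "invertible_mat A"
  shows "invertible_mat (map_mat (snd h) A)"
  using assms by (simp add: invertible_mat_iff_det[of _ n] \<tau>.hom_det)

lemma twist_carrier:
  assumes "fst B \<in> carrier_mat n m" "snd B \<in> carrier_mat n m"
  shows "fst (twist h B) \<in> carrier_mat n m" "snd (twist h B) \<in> carrier_mat n m"
  using assms by (auto simp: twist_def change_basis_def)

lemma comm_ring_hom_act_poly: "comm_ring_hom (act_poly h)"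
proof -
  interpret m: map_poly_comm_ring_hom "snd h" ..
  interpret mm: map_poly_comm_ring_hom "map_poly (snd h)" ..
  interpret s: comm_ring_hom "subst_lin (fst h)" by (rule comm_ring_hom_subst_lin)
  have eq: "act_poly h = (\<lambda>f. subst_lin (fst h) (map_poly (map_poly (snd h)) f))"
    by (rule ext) (simp add: act_poly_def subst_lin_def lin_form_def Let_def)
  show ?thesis unfolding eq by unfold_locales (simp_all add: mm.hom_add mm.hom_mult s.hom_add s.hom_mult)
qed

lemma act_poly_simps:
  "act_poly h (const_xy c) = const_xy (snd h c)"
  "act_poly h var_x = lin_form (fst h) 0" "act_poly h var_y = lin_form (fst h) 1"
proof -
  interpret m: map_poly_comm_ring_hom "snd h" ..
  have eq: "act_poly h f = subst_lin (fst h) (map_poly (map_poly (snd h)) f)" for f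
    by (simp add: act_poly_def subst_lin_def lin_form_def Let_def)
  have "map_poly (map_poly (snd h)) (const_xy c) = const_xy (snd h c)"
    "map_poly (map_poly (snd h)) var_x = var_x" "map_poly (map_poly (snd h)) var_y = var_y"
    by (simp_all add: m.map_poly_pCons_hom \<tau>.map_poly_pCons_hom)
  then show "act_poly h (const_xy c) = const_xy (snd h c)"
    "act_poly h var_x = lin_form (fst h) 0" "act_poly h var_y = lin_form (fst h) 1"
    by (simp_all only: eq subst_lin_simps)
qed

text \<open>\<open>act_poly h\<close> is a ring homomorphism and commutes with determinants. On the
  pencil it agrees with \<open>twist\<close>, because the row of the matrix substituted for a
  variable collects the coefficients with which that form enters the two new forms.\<close>

lemma disc_twist:
  assumes \<Psi>: "fst \<Psi> \<in> carrier_mat n n" "snd \<Psi> \<in> carrier_mat n n"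
  shows "disc (twist h \<Psi>) = act_poly h (disc \<Psi>)"
proof -
  interpret a: comm_ring_hom "act_poly h" by (rule comm_ring_hom_act_poly)
  have "pencil (twist h \<Psi>) = map_mat (act_poly h) (pencil \<Psi>)"
    unfolding twist_def using \<Psi>
    by (subst pencil_change_basis[of _ n n])
      (auto intro!: eq_matI simp: pencil_def a.hom_add a.hom_mult act_poly_simps
        simp del: mult_pCons_left mult_pCons_right One_nat_def)
  then show ?thesis unfolding disc_def by (simp add: a.hom_det)
qed

lemma is_Pf_twist:
  assumes f: "is_Pf B f"
  shows "is_Pf (twist h B) (act_poly h f)"
proof -
  obtain n P \<Psi>\<^sub>1 \<Psi>\<^sub>2 where *:
    "fst B \<in> carrier_mat (n + n) (n + n)" "snd B \<in> carrier_mat (n + n) (n + n)"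
    "P \<in> carrier_mat (n + n) (n + n)" "invertible_mat P"
    "\<Psi>\<^sub>1 \<in> carrier_mat n n" "\<Psi>\<^sub>2 \<in> carrier_mat n n"
    "P * fst B * transpose_mat P = hyperbolic n \<Psi>\<^sub>1"
    "P * snd B * transpose_mat P = hyperbolic n \<Psi>\<^sub>2"
    "f = disc (\<Psi>\<^sub>1, \<Psi>\<^sub>2)"
    using f unfolding is_Pf_def by blast
  let ?m = "n + n"
  let ?t = "map_mat (snd h)"
  define \<Psi> where "\<Psi> = twist h (\<Psi>\<^sub>1, \<Psi>\<^sub>2)"
  have \<Psi>: "fst \<Psi> \<in> carrier_mat n n" "snd \<Psi> \<in> carrier_mat n n"
    using twist_carrier[of "(\<Psi>\<^sub>1, \<Psi>\<^sub>2)" n n] *(5,6) by (auto simp: \<Psi>_def)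
  have t: "?t P * ?t X * transpose_mat (?t P) = ?t (P * X * transpose_mat P)" if "X \<in> carrier_mat ?m ?m" for X
    using that *(3) by (simp add: \<tau>.mat_hom_mult[of _ ?m ?m _ ?m] map_mat_transpose)
  have "(?t P * fst (twist h B) * transpose_mat (?t P), ?t P * snd (twist h B) * transpose_mat (?t P))
      = change_basis (fst h) (?t P * ?t (fst B) * transpose_mat (?t P), ?t P * ?t (snd B) * transpose_mat (?t P))"
    unfolding twist_def using *(1-3) by (subst change_basis_congruence[of _ ?m ?m _ ?m]) auto
  also have "\<dots> = change_basis (fst h) (hyperbolic n (?t \<Psi>\<^sub>1), hyperbolic n (?t \<Psi>\<^sub>2))"
    unfolding t[OF *(1)] t[OF *(2)] *(7,8) map_mat_hyperbolic[OF comm_ring_hom_snd *(5)] map_mat_hyperbolic[OF comm_ring_hom_snd *(6)] ..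
  also have "\<dots> = (hyperbolic n (fst \<Psi>), hyperbolic n (snd \<Psi>))"
    unfolding \<Psi>_def twist_def fst_conv snd_conv using *(5,6) by (intro change_basis_hyperbolic) auto
  finally have "?t P * fst (twist h B) * transpose_mat (?t P) = hyperbolic n (fst \<Psi>)"
    "?t P * snd (twist h B) * transpose_mat (?t P) = hyperbolic n (snd \<Psi>)" by auto
  moreover have "act_poly h f = disc (fst \<Psi>, snd \<Psi>)"
    using disc_twist[of "(\<Psi>\<^sub>1, \<Psi>\<^sub>2)" n] *(5,6,9) by (simp add: \<Psi>_def)
  moreover have "?t P \<in> carrier_mat ?m ?m" using *(3) by simp
  ultimately show ?thesis
    unfolding is_Pf_def using \<Psi> twist_carrier[OF *(1,2)] invertible_map_mat[OF *(3,4)] by blast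
qed

lemma alternating_map_mat:
  assumes "alternating_mat n A"
  shows "alternating_mat n (map_mat (snd h) A)"
proof -
  have "transpose_mat (map_mat (snd h) A) = map_mat (snd h) (transpose_mat A)"
    by (simp add: map_mat_transpose)
  also have "\<dots> = - map_mat (snd h) A"
    using assms by (auto simp: alternating_mat_def \<tau>.hom_uminus intro!: eq_matI)
  finally show ?thesis using assms by (auto simp: alternating_mat_def)
qed

lemma alternating_pair_twist: "alternating_pair n B \<Longrightarrow> alternating_pair n (twist h B)"
  unfolding twist_def
  by (rule alternating_pair_change_basis) (simp add: alternating_pair_def alternating_map_mat)

lemma indecomposable_map_mat:
  assumes B: "indecomposable n B" "fst B \<in> carrier_mat n n" "snd B \<in> carrier_mat n n"
  shows "indecomposable n (map_mat (snd h) (fst B), map_mat (snd h) (snd B))"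
  unfolding indecomposable_def
proof (intro ballI impI)
  let ?t = "map_mat (snd h)"
  fix E :: "'a mat" assume E: "E \<in> carrier_mat n n"
    and *: "E * E = E \<and> transpose_mat E * fst (?t (fst B), ?t (snd B)) = fst (?t (fst B), ?t (snd B)) * E \<and>
      transpose_mat E * snd (?t (fst B), ?t (snd B)) = snd (?t (fst B), ?t (snd B)) * E"
  \<comment> \<open>The idempotent is pulled back entrywise along the inverse automorphism, where
    indecomposability of \<open>B\<close> applies.\<close>
  define F where "F = map_mat (inv_into UNIV (snd h)) E"
  have F: "F \<in> carrier_mat n n" using E by (simp add: F_def)
  have EF: "E = ?t F"
    using E \<tau>.surj by (intro eq_matI) (auto simp: F_def surj_f_inv_f)
  have mult: "?t X * ?t Y = ?t (X * Y)" if "X \<in> carrier_mat n n" "Y \<in> carrier_mat n n" for X Y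
    using that by (simp add: \<tau>.mat_hom_mult[of _ n n _ n])
  have "?t (F * F) = ?t F" using conjunct1[OF *] unfolding EF mult[OF F F] .
  then have FF: "F * F = F" by (rule \<tau>.mat_hom_inj)
  have adj: "transpose_mat F * X = X * F"
    if X: "X \<in> carrier_mat n n" and "transpose_mat E * ?t X = ?t X * E" for X
  proof (rule \<tau>.mat_hom_inj)
    have "?t (transpose_mat F * X) = transpose_mat E * ?t X"
      unfolding EF map_mat_transpose using X F by (intro mult[symmetric]) auto
    then show "?t (transpose_mat F * X) = ?t (X * F)" using that(2) unfolding EF mult[OF X F] by (rule trans)
  qed
  have "transpose_mat F * fst B = fst B * F" "transpose_mat F * snd B = snd B * F"
    using adj[OF B(2)] adj[OF B(3)] * by (simp_all only: fst_conv snd_conv)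
  then have "F = 0\<^sub>m n n \<or> F = 1\<^sub>m n"
    using B(1) F FF unfolding indecomposable_def by blast
  then show "E = 0\<^sub>m n n \<or> E = 1\<^sub>m n"
  proof
    assume "F = 0\<^sub>m n n"
    then show ?thesis unfolding EF by (auto intro!: eq_matI)
  next
    assume "F = 1\<^sub>m n"
    then show ?thesis unfolding EF by (simp only: \<tau>.mat_hom_one simp_thms)
  qed
qed

lemma sloped_summand_twist:
  assumes B: "sloped_summand n B"
  shows "sloped_summand n (twist h B)"
proof -
  let ?t = "map_mat (snd h)"
  let ?B = "(?t (fst B), ?t (snd B))"
  note c = sloped_summand_carrier[OF B]
  have ct: "fst ?B \<in> carrier_mat n n" "snd ?B \<in> carrier_mat n n" using c by auto
  have "indecomposable n (twist h B)"
    unfolding twist_def using indecomposable_map_mat[OF _ c] B fst_GammaL2 ct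
    by (intro indecomposable_change_basis) (auto simp: sloped_summand_def)
  moreover have "alternating_pair n (twist h B)" using alternating_pair_twist B by (simp add: sloped_summand_def)
  moreover have "sloped (twist h B)"
  proof -
    obtain g where g: "g \<in> carrier_mat 2 2" "invertible_mat g" "invertible_mat (fst (change_basis g B))"
      using B by (auto simp: sloped_summand_def sloped_def)
    obtain M where M: "M \<in> carrier_mat 2 2" "fst h * M = 1\<^sub>m 2" "M * fst h = 1\<^sub>m 2"
      using invertible_matE[OF fst_GammaL2] by blast
    have tg: "?t g \<in> carrier_mat 2 2" "invertible_mat (?t g)" using g invertible_map_mat by auto
    \<comment> \<open>The change of basis for the twisted pair is \<open>M * ?t g\<close>: the
      inverse \<open>M\<close> first undoes \<open>fst h\<close>, and then the image of
      \<open>g\<close> under the automorphism acts.\<close>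
    have "fst h * (M * ?t g) = ?t g"
      using M tg fst_GammaL2 by (simp add: assoc_mult_mat[of _ 2 2 _ 2 _ 2, symmetric])
    moreover have "M * ?t g \<in> carrier_mat 2 2" using M tg by simp
    ultimately have "change_basis (M * ?t g) (twist h B) = change_basis (?t g) ?B"
      unfolding twist_def by (subst change_basis_mult[OF fst_GammaL2(1) _ ct]) auto
    also have "fst \<dots> = ?t (fst (change_basis g B))"
      unfolding change_basis_def using c g by (auto intro!: eq_matI simp: \<tau>.hom_add \<tau>.hom_mult)
    finally have "fst (change_basis (M * ?t g) (twist h B)) = ?t (fst (change_basis g B))" .
    moreover have "invertible_mat (?t (fst (change_basis g B)))"
      using change_basis_carrier[OF c, of g] g(3) by (intro invertible_map_mat[of _ n]) auto
    moreover have "invertible_mat (M * ?t g)"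
      by (rule invertible_mat_mult[OF M(1) tg(1) invertible_matI[OF M(1) fst_GammaL2(1) M(3,2)] tg(2)])
    moreover have "M * ?t g \<in> carrier_mat 2 2" using M tg by simp
    ultimately show ?thesis unfolding sloped_def by (metis fst_conv)
  qed
  ultimately show ?thesis using B by (simp add: sloped_summand_def)
qed

lemma Pf_twist:
  assumes "sloped_summand n B"
  shows "equiv_units (act_poly h (Pf B)) (Pf (twist h B))"
  by (rule is_Pf_unique[OF is_Pf_twist[OF sloped_summand_is_Pf[OF assms]] sloped_summand_is_Pf[OF sloped_summand_twist[OF assms]]])

end

section \<open>Fully refined decompositions\<close>

definition block_embed :: "nat \<Rightarrow> nat \<Rightarrow> 'a :: field vec \<Rightarrow> 'a vec" where
  "block_embed a c w = 0\<^sub>v a @\<^sub>v (w @\<^sub>v 0\<^sub>v c)"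

lemma embed_carrier: "w \<in> carrier_vec n \<Longrightarrow> block_embed a c w \<in> carrier_vec (a + (n + c))"
  by (simp add: block_embed_def)

lemma index_embed:
  "w \<in> carrier_vec n \<Longrightarrow> j < a + (n + c) \<Longrightarrow>
   block_embed a c w $ j = (if a \<le> j \<and> j < a + n then w $ (j - a) else 0)"
  by (auto simp: block_embed_def)

lemma embed_inject:
  assumes "v \<in> carrier_vec n" "w \<in> carrier_vec n" "block_embed a c v = block_embed a c w"
  shows "v = w"
proof (rule eq_vecI)
  fix i assume "i < dim_vec w"
  then have "i < n" using assms by simp
  then show "v $ i = w $ i"
    using arg_cong[OF assms(3), of "\<lambda>x. x $ (a + i)"] index_embed[OF assms(1), of "a + i" a c]
      index_embed[OF assms(2), of "a + i" a c] by simp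
qed (use assms in auto)

lemma embed_add:
  "v \<in> carrier_vec n \<Longrightarrow> w \<in> carrier_vec n \<Longrightarrow> block_embed a c v + block_embed a c w = block_embed a c (v + w)"
  by (intro eq_vecI) (auto simp: block_embed_def)

lemma embed_smult: "v \<in> carrier_vec n \<Longrightarrow> k \<cdot>\<^sub>v block_embed a c v = block_embed a c (k \<cdot>\<^sub>v v)"
  by (intro eq_vecI) (auto simp: block_embed_def)

lemma embed_zero: "block_embed a c (0\<^sub>v n) = 0\<^sub>v (a + (n + c))"
  by (intro eq_vecI) (auto simp: block_embed_def)

lemma mult_mat_zero_vec: "M \<in> carrier_mat m n \<Longrightarrow> M *\<^sub>v 0\<^sub>v n = (0\<^sub>v m :: 'a :: comm_ring_1 vec)"
  by (intro eq_vecI) auto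

lemma embed_form:
  fixes A :: "'a :: field mat"
  assumes X: "X \<in> carrier_mat a a" and A: "A \<in> carrier_mat n n" and Y: "Y \<in> carrier_mat c c"
    and u: "u \<in> carrier_vec n" and v: "v \<in> carrier_vec n"
  shows "block_embed a c u \<bullet> (four_block_mat X (0\<^sub>m a (n + c)) (0\<^sub>m (n + c) a)
      (four_block_mat A (0\<^sub>m n c) (0\<^sub>m c n) Y) *\<^sub>v block_embed a c v) = u \<bullet> (A *\<^sub>v v)"
proof -
  let ?D = "four_block_mat A (0\<^sub>m n c) (0\<^sub>m c n) Y"
  have D: "?D \<in> carrier_mat (n + c) (n + c)" using A Y by auto
  have z: "0\<^sub>m i j *\<^sub>v x = (0\<^sub>v i :: 'a vec)" if "x \<in> carrier_vec j" for i j x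
    using that by (intro eq_vecI) auto
  have Dv: "?D *\<^sub>v (v @\<^sub>v 0\<^sub>v c) = (A *\<^sub>v v) @\<^sub>v 0\<^sub>v c"
    using four_block_mat_mult_vec[OF A zero_carrier_mat zero_carrier_mat Y v, of "0\<^sub>v c"] A v
    by (simp add: z[OF v] z[OF zero_carrier_vec] mult_mat_zero_vec[OF Y])
  have v0: "v @\<^sub>v 0\<^sub>v c \<in> carrier_vec (n + c)" "(A *\<^sub>v v) @\<^sub>v 0\<^sub>v c \<in> carrier_vec (n + c)" using A v by auto
  have "four_block_mat X (0\<^sub>m a (n + c)) (0\<^sub>m (n + c) a) ?D *\<^sub>v block_embed a c v
      = (X *\<^sub>v 0\<^sub>v a + 0\<^sub>m a (n + c) *\<^sub>v (v @\<^sub>v 0\<^sub>v c)) @\<^sub>v (0\<^sub>m (n + c) a *\<^sub>v 0\<^sub>v a + ?D *\<^sub>v (v @\<^sub>v 0\<^sub>v c))"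
    unfolding block_embed_def by (rule four_block_mat_mult_vec[OF X zero_carrier_mat zero_carrier_mat D zero_carrier_vec v0(1)])
  also have "\<dots> = 0\<^sub>v a @\<^sub>v ((A *\<^sub>v v) @\<^sub>v 0\<^sub>v c)"
    unfolding Dv mult_mat_zero_vec[OF X] z[OF v0(1)] z[OF zero_carrier_vec] using v0(2) by simp
  finally have "four_block_mat X (0\<^sub>m a (n + c)) (0\<^sub>m (n + c) a) ?D *\<^sub>v block_embed a c v = 0\<^sub>v a @\<^sub>v ((A *\<^sub>v v) @\<^sub>v 0\<^sub>v c)" .
  then show ?thesis unfolding block_embed_def
    using A u v by (simp add: scalar_prod_append[of _ a _ "n + c"] scalar_prod_append[of _ n _ c])
qed

lemma subspace_embed:
  assumes I: "I \<subseteq> carrier_vec n" "0\<^sub>v n \<in> I" "\<And>u v. u \<in> I \<Longrightarrow> v \<in> I \<Longrightarrow> u + v \<in> I"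
    "\<And>k u. u \<in> I \<Longrightarrow> k \<cdot>\<^sub>v u \<in> I"
  shows "VectorSpace.subspace class_ring (block_embed a c ` I :: 'a :: field vec set) (module_vec TYPE('a) (a + (n + c)))"
proof (rule VectorSpace.subspace.intro)
  show "vectorspace class_ring (module_vec TYPE('a) (a + (n + c)))" by (rule vec_vs)
  then have m: "Module.module class_ring (module_vec TYPE('a) (a + (n + c)))"
    by (simp add: vectorspace_def)
  show "submodule class_ring (block_embed a c ` I) (module_vec TYPE('a) (a + (n + c)))"
  proof (rule submodule.intro[OF m])
    show "block_embed a c ` I \<subseteq> carrier (module_vec TYPE('a) (a + (n + c)))"
      using I(1) embed_carrier[of _ n a c] by (auto simp: module_vec_simps)
    show "\<zero>\<^bsub>module_vec TYPE('a) (a + (n + c))\<^esub> \<in> block_embed a c ` I"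
      unfolding module_vec_simps embed_zero[of a c n, symmetric] using I(2) by (rule imageI)
    fix v w assume "v \<in> block_embed a c ` I" "w \<in> block_embed a c ` I"
    then obtain x y where xy: "x \<in> I" "y \<in> I" "v = block_embed a c x" "w = block_embed a c y" by blast
    then have "v + w = block_embed a c (x + y)" using I(1) embed_add[of x n y a c] by blast
    then show "v \<oplus>\<^bsub>module_vec TYPE('a) (a + (n + c))\<^esub> w \<in> block_embed a c ` I"
      unfolding module_vec_simps using I(3)[OF xy(1,2)] by (metis imageI)
  next
    fix k v assume "v \<in> block_embed a c ` I"
    then obtain x where x: "x \<in> I" "v = block_embed a c x" by blast
    then have "k \<cdot>\<^sub>v v = block_embed a c (k \<cdot>\<^sub>v x)" using I(1) embed_smult[of x n k a c] by blast
    then show "k \<odot>\<^bsub>module_vec TYPE('a) (a + (n + c))\<^esub> v \<in> block_embed a c ` I"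
      unfolding module_vec_simps using I(4)[OF x(1)] by (metis imageI)
  qed
qed

lemma diag_block_mat_carrier:
  assumes "\<And>B. B \<in> set Bs \<Longrightarrow> f B \<in> carrier_mat (k B) (k B)"
  shows "diag_block_mat (map f Bs) \<in> carrier_mat (\<Sum>B\<leftarrow>Bs. k B) (\<Sum>B\<leftarrow>Bs. k B)"
  using assms by (induction Bs) (auto simp: Let_def)

lemma bimap_eq_zero_iff:
  "bimap \<Phi> u v = 0\<^sub>v 2 \<longleftrightarrow> u \<bullet> (fst \<Phi> *\<^sub>v v) = 0 \<and> u \<bullet> (snd \<Phi> *\<^sub>v v) = 0"
proof
  assume "bimap \<Phi> u v = 0\<^sub>v 2"
  then have "bimap \<Phi> u v $ 0 = 0" "bimap \<Phi> u v $ 1 = 0" by auto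
  then show "u \<bullet> (fst \<Phi> *\<^sub>v v) = 0 \<and> u \<bullet> (snd \<Phi> *\<^sub>v v) = 0" by (simp_all add: bimap_def)
next
  assume "u \<bullet> (fst \<Phi> *\<^sub>v v) = 0 \<and> u \<bullet> (snd \<Phi> *\<^sub>v v) = 0"
  then show "bimap \<Phi> u v = 0\<^sub>v 2" by (intro eq_vecI) (auto simp: bimap_def less_Suc_eq numeral_2_eq_2)
qed

text \<open>Translates between the coordinate subspace of a block inside k^d and the smaller space
  on which the block acts, so that properties of the decomposition become properties of the matrices
  in \<open>Bs ! i\<close>.\<close>

lemma block_embedding:
  fixes \<Phi> :: "'a :: field mat \<times> 'a mat"
  assumes fr: "fully_refined_blocks d \<Phi> Bs" and d: "fst \<Phi> \<in> carrier_mat d d" and i: "i < length Bs"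
  obtains a c n where "fst (Bs ! i) \<in> carrier_mat n n" "snd (Bs ! i) \<in> carrier_mat n n" "d = a + (n + c)"
    "block_space d Bs i = block_embed a c ` carrier_vec n"
    "\<forall>u\<in>carrier_vec n. \<forall>v\<in>carrier_vec n.
      block_embed a c u \<bullet> (fst \<Phi> *\<^sub>v block_embed a c v) = u \<bullet> (fst (Bs ! i) *\<^sub>v v)"
    "\<forall>u\<in>carrier_vec n. \<forall>v\<in>carrier_vec n.
      block_embed a c u \<bullet> (snd \<Phi> *\<^sub>v block_embed a c v) = u \<bullet> (snd (Bs ! i) *\<^sub>v v)"
proof -
  define k where "k = (\<lambda>B :: 'a mat \<times> 'a mat. dim_row (fst B))"
  have sq: "fst B \<in> carrier_mat (k B) (k B)" "snd B \<in> carrier_mat (k B) (k B)" if "B \<in> set Bs" for B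
    using fr that unfolding fully_refined_blocks_def k_def by auto
  define a c n where "a = (\<Sum>B\<leftarrow>take i Bs. k B)" and "c = (\<Sum>B\<leftarrow>drop (Suc i) Bs. k B)" and "n = k (Bs ! i)"
  have Bs: "Bs = take i Bs @ Bs ! i # drop (Suc i) Bs" using i by (rule id_take_nth_drop)
  have form: "diag_block_mat (map f Bs) = four_block_mat (diag_block_mat (map f (take i Bs))) (0\<^sub>m a (n + c)) (0\<^sub>m (n + c) a)
      (four_block_mat (f (Bs ! i)) (0\<^sub>m n c) (0\<^sub>m c n) (diag_block_mat (map f (drop (Suc i) Bs))))"
    and X: "diag_block_mat (map f (take i Bs)) \<in> carrier_mat a a"
    and Y: "diag_block_mat (map f (drop (Suc i) Bs)) \<in> carrier_mat c c"
    and B: "f (Bs ! i) \<in> carrier_mat n n"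
    if f: "\<And>B. B \<in> set Bs \<Longrightarrow> f B \<in> carrier_mat (k B) (k B)" for f :: "'a mat \<times> 'a mat \<Rightarrow> 'a mat"
  proof -
    show X: "diag_block_mat (map f (take i Bs)) \<in> carrier_mat a a"
      unfolding a_def using f by (intro diag_block_mat_carrier) (auto dest: in_set_takeD)
    show Y: "diag_block_mat (map f (drop (Suc i) Bs)) \<in> carrier_mat c c"
      unfolding c_def using f by (intro diag_block_mat_carrier) (auto dest: in_set_dropD)
    show B: "f (Bs ! i) \<in> carrier_mat n n" unfolding n_def using f i by simp
    show "diag_block_mat (map f Bs) = four_block_mat (diag_block_mat (map f (take i Bs))) (0\<^sub>m a (n + c)) (0\<^sub>m (n + c) a)
      (four_block_mat (f (Bs ! i)) (0\<^sub>m n c) (0\<^sub>m c n) (diag_block_mat (map f (drop (Suc i) Bs))))"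
      using X Y B by (subst Bs) (simp add: diag_block_mat_append Let_def)
  qed
  have f1: "diag_block_mat (map fst Bs) = four_block_mat (diag_block_mat (map fst (take i Bs))) (0\<^sub>m a (n + c)) (0\<^sub>m (n + c) a)
      (four_block_mat (fst (Bs ! i)) (0\<^sub>m n c) (0\<^sub>m c n) (diag_block_mat (map fst (drop (Suc i) Bs))))"
    "diag_block_mat (map fst (take i Bs)) \<in> carrier_mat a a"
    "diag_block_mat (map fst (drop (Suc i) Bs)) \<in> carrier_mat c c" "fst (Bs ! i) \<in> carrier_mat n n"
    using form[of fst] X[of fst] Y[of fst] B[of fst] sq(1) by blast+
  have f2: "diag_block_mat (map snd Bs) = four_block_mat (diag_block_mat (map snd (take i Bs))) (0\<^sub>m a (n + c)) (0\<^sub>m (n + c) a)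
      (four_block_mat (snd (Bs ! i)) (0\<^sub>m n c) (0\<^sub>m c n) (diag_block_mat (map snd (drop (Suc i) Bs))))"
    "diag_block_mat (map snd (take i Bs)) \<in> carrier_mat a a"
    "diag_block_mat (map snd (drop (Suc i) Bs)) \<in> carrier_mat c c" "snd (Bs ! i) \<in> carrier_mat n n"
    using form[of snd] X[of snd] Y[of snd] B[of snd] sq(2) by blast+
  have \<Phi>: "fst \<Phi> = diag_block_mat (map fst Bs)" "snd \<Phi> = diag_block_mat (map snd Bs)"
    using fr by (auto simp: fully_refined_blocks_def)
  have dd: "d = a + (n + c)"
  proof -
    have "diag_block_mat (map fst Bs) \<in> carrier_mat (\<Sum>B\<leftarrow>Bs. k B) (\<Sum>B\<leftarrow>Bs. k B)"
      by (intro diag_block_mat_carrier sq(1))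
    moreover have "(\<Sum>B\<leftarrow>Bs. k B) = a + (n + c)" by (subst Bs) (simp add: a_def n_def c_def)
    ultimately have "diag_block_mat (map fst Bs) \<in> carrier_mat (a + (n + c)) (a + (n + c))" by (simp only:)
    with d show ?thesis unfolding \<Phi> by auto
  qed
  have start: "block_start Bs i = a" "block_start Bs (Suc i) = a + n"
    using i by (auto simp: block_start_def a_def n_def k_def take_Suc_conv_app_nth)
  have space: "block_space d Bs i = block_embed a c ` carrier_vec n"
  proof (intro equalityI subsetI)
    fix v :: "'a vec" assume "v \<in> block_space d Bs i"
    then have v: "v \<in> carrier_vec d" "\<And>j. j < d \<Longrightarrow> j < a \<or> a + n \<le> j \<Longrightarrow> v $ j = 0"
      by (auto simp: block_space_def start)
    have "v = block_embed a c (vec n (\<lambda>j. v $ (a + j)))"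
      by (rule eq_vecI) (use v dd in \<open>auto simp: index_embed[of _ n] block_embed_def\<close>)
    then show "v \<in> block_embed a c ` carrier_vec n" by auto
  next
    fix v :: "'a vec" assume "v \<in> block_embed a c ` carrier_vec n"
    then obtain w where "w \<in> carrier_vec n" "v = block_embed a c w" by auto
    then show "v \<in> block_space d Bs i"
      using dd embed_carrier[of w n a c] by (auto simp: block_space_def start index_embed[of _ n])
  qed
  show thesis
  proof (rule that[OF f1(4) f2(4) dd space]; intro ballI)
    fix u v :: "'a vec" assume uv: "u \<in> carrier_vec n" "v \<in> carrier_vec n"
    show "block_embed a c u \<bullet> (fst \<Phi> *\<^sub>v block_embed a c v) = u \<bullet> (fst (Bs ! i) *\<^sub>v v)"
      unfolding \<Phi> f1(1)
      by (rule embed_form[OF f1(2) f1(4) f1(3) uv])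
    show "block_embed a c u \<bullet> (snd \<Phi> *\<^sub>v block_embed a c v) = u \<bullet> (snd (Bs ! i) *\<^sub>v v)"
      unfolding \<Phi> f2(1)
      by (rule embed_form[OF f2(2) f2(4) f2(3) uv])
  qed
qed

lemma mat_eqI_vec:
  fixes A B :: "'a :: comm_ring_1 mat"
  assumes "A \<in> carrier_mat n m" "B \<in> carrier_mat n m"
    and "\<And>v. v \<in> carrier_vec m \<Longrightarrow> A *\<^sub>v v = B *\<^sub>v v"
  shows "A = B"
proof (rule eq_matI)
  fix i j assume "i < dim_row B" "j < dim_col B"
  then have ij: "i < n" "j < m" using assms by auto
  have "unit_vec n i \<bullet> (A *\<^sub>v unit_vec m j) = unit_vec n i \<bullet> (B *\<^sub>v unit_vec m j)" using assms(3) by simp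
  then show "A $$ (i, j) = B $$ (i, j)"
    unfolding bilinear_unit_vec[OF assms(1) ij] bilinear_unit_vec[OF assms(2) ij] .
qed (use assms in auto)

text \<open>A self-adjoint idempotent other than zero and the identity would split the block into
  its fixed space and its kernel. These are orthogonal for both forms, and their embeddings would
  refine the given decomposition.\<close>

lemma fully_refined_sloped_summand:
  fixes \<Phi> :: "'a :: field mat \<times> 'a mat"
  assumes alt: "alternating_pair d \<Phi>" and fr: "fully_refined_blocks d \<Phi> Bs" and B: "B \<in> set Bs" "sloped B"
  shows "sloped_summand (dim_row (fst B)) B"
proof -
  obtain i where i: "i < length Bs" "Bs ! i = B" using B(1) by (metis in_set_conv_nth)
  note \<Phi> = alternating_pair_carrier[OF alt]
  obtain a c n where cB: "fst B \<in> carrier_mat n n" "snd B \<in> carrier_mat n n" and d: "d = a + (n + c)"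
    and space: "block_space d Bs i = block_embed a c ` carrier_vec n"
    and form1: "\<forall>u\<in>carrier_vec n. \<forall>v\<in>carrier_vec n.
      block_embed a c u \<bullet> (fst \<Phi> *\<^sub>v block_embed a c v) = u \<bullet> (fst B *\<^sub>v v)"
    and form2: "\<forall>u\<in>carrier_vec n. \<forall>v\<in>carrier_vec n.
      block_embed a c u \<bullet> (snd \<Phi> *\<^sub>v block_embed a c v) = u \<bullet> (snd B *\<^sub>v v)"
    by (rule block_embedding[OF fr conjunct1[OF \<Phi>] i(1), unfolded i(2)]) metis
  note form1 = form1[rule_format] and form2 = form2[rule_format]
  let ?V = "block_space d Bs i"
  have V: "?V \<in> set (map (block_space d Bs) [0..<length Bs])" using i(1) by auto
  have refined: "fully_refined d \<Phi> (map (block_space d Bs) [0..<length Bs])"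
    using fr by (simp add: fully_refined_blocks_def)
  then have nz: "?V \<noteq> {0\<^sub>v d}" and ind: "\<not> (\<exists>Ws. orth_decomp d \<Phi> ?V Ws \<and> length Ws \<ge> 2)"
    using V unfolding fully_refined_def orth_decomp_def by blast+
  have n: "n > 0"
  proof (rule ccontr)
    assume "\<not> n > 0"
    then have "carrier_vec n = {0\<^sub>v n :: 'a vec}" by auto
    then have "?V = {0\<^sub>v d}" unfolding space unfolding d by (simp only: image_insert image_empty embed_zero)
    with nz show False by simp
  qed
  have "alternating_mat n (fst B)" "alternating_mat n (snd B)"
    unfolding alternating_mat_iff[OF cB(1)] alternating_mat_iff[OF cB(2)]
  proof -
    have "\<forall>v\<in>carrier_vec d. v \<bullet> (fst \<Phi> *\<^sub>v v) = 0" "\<forall>v\<in>carrier_vec d. v \<bullet> (snd \<Phi> *\<^sub>v v) = 0"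
      using alt alternating_mat_iff[of "fst \<Phi>" d] alternating_mat_iff[of "snd \<Phi>" d] \<Phi>
      unfolding alternating_pair_def by blast+
    moreover have "block_embed a c v \<in> carrier_vec d" if "v \<in> carrier_vec n" for v :: "'a vec"
      using embed_carrier[OF that] d by simp
    ultimately show "\<forall>v\<in>carrier_vec n. v \<bullet> (fst B *\<^sub>v v) = 0" "\<forall>v\<in>carrier_vec n. v \<bullet> (snd B *\<^sub>v v) = 0"
      by (metis form1, metis form2)
  qed
  then have "alternating_pair n B" by (simp add: alternating_pair_def)
  moreover have "indecomposable n B"
    unfolding indecomposable_def
  proof (intro ballI impI, rule ccontr)
    fix E assume E: "E \<in> carrier_mat n n"
      and *: "E * E = E \<and> transpose_mat E * fst B = fst B * E \<and> transpose_mat E * snd B = snd B * E"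
      and **: "\<not> (E = 0\<^sub>m n n \<or> E = 1\<^sub>m n)"
    have EE: "E *\<^sub>v (E *\<^sub>v w) = E *\<^sub>v w" if "w \<in> carrier_vec n" for w
      using * E that by (metis assoc_mult_mat_vec)
    \<comment> \<open>For an idempotent the fixed vectors form the image, so
      \<open>w = E w + (w - E w)\<close> is the decomposition along \<open>I1\<close> and
      \<open>I2\<close>.\<close>
    define I1 where "I1 = {w \<in> carrier_vec n. E *\<^sub>v w = w}"
    define I2 where "I2 = {w \<in> carrier_vec n. E *\<^sub>v w = 0\<^sub>v n}"
    define W1 W2 where "W1 = block_embed a c ` I1" and "W2 = block_embed a c ` I2"
    have I: "I1 \<subseteq> carrier_vec n" "I2 \<subseteq> carrier_vec n" by (auto simp: I1_def I2_def)
    have adj: "u \<bullet> (A *\<^sub>v v) = 0 \<and> v \<bullet> (A *\<^sub>v u) = 0"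
      if A: "A \<in> carrier_mat n n" "transpose_mat E * A = A * E" and uv: "u \<in> I1" "v \<in> I2" for A u v
    proof -
      have c: "u \<in> carrier_vec n" "v \<in> carrier_vec n" using uv I by auto
      have form: "x \<bullet> (A *\<^sub>v (E *\<^sub>v y)) = (E *\<^sub>v x) \<bullet> (A *\<^sub>v y)"
        if "x \<in> carrier_vec n" "y \<in> carrier_vec n" for x y
      proof -
        have "A *\<^sub>v (E *\<^sub>v y) = transpose_mat E *\<^sub>v (A *\<^sub>v y)"
          using A E that by (metis assoc_mult_mat_vec transpose_carrier_mat)
        then show ?thesis
          using mat_adjoint[of "transpose_mat E" n n x "A *\<^sub>v y"] A E that by simp
      qed
      have "u \<bullet> (A *\<^sub>v v) = (E *\<^sub>v u) \<bullet> (A *\<^sub>v v)" using uv by (simp add: I1_def)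
      also have "\<dots> = u \<bullet> (A *\<^sub>v (E *\<^sub>v v))" using form c by simp
      also have "\<dots> = 0" using uv A c by (simp add: I2_def mult_mat_zero_vec[OF A(1)])
      finally have 1: "u \<bullet> (A *\<^sub>v v) = 0" .
      have "v \<bullet> (A *\<^sub>v u) = v \<bullet> (A *\<^sub>v (E *\<^sub>v u))" using uv by (simp add: I1_def)
      also have "\<dots> = (E *\<^sub>v v) \<bullet> (A *\<^sub>v u)" using form c by simp
      also have "\<dots> = 0" using uv A c by (simp add: I2_def)
      finally show ?thesis using 1 by simp
    qed
    have sub1: "VectorSpace.subspace class_ring W1 (module_vec TYPE('a) d)"
      unfolding W1_def d using E
      by (intro subspace_embed) (auto simp: I1_def mult_add_distrib_mat_vec[of _ n n] mult_mat_vec[of _ n n])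
    have sub2: "VectorSpace.subspace class_ring W2 (module_vec TYPE('a) d)"
      unfolding W2_def d using E
      by (intro subspace_embed) (auto simp: I2_def mult_add_distrib_mat_vec[of _ n n] mult_mat_vec[of _ n n])
    have Ew: "E *\<^sub>v w \<in> I1" "w - E *\<^sub>v w \<in> I2" if "w \<in> carrier_vec n" for w
      using that E EE[OF that] by (auto simp: I1_def I2_def mult_minus_distrib_mat_vec[of _ n n])
    have ne1: "W1 \<noteq> {0\<^sub>v d}"
    proof
      assume eq: "W1 = {0\<^sub>v d}"
      have "E = 0\<^sub>m n n"
      proof (rule mat_eqI_vec[OF E zero_carrier_mat])
        fix w :: "'a vec" assume w: "w \<in> carrier_vec n"
        have e0: "block_embed a c (E *\<^sub>v w) = block_embed a c (0\<^sub>v n)" using eq Ew(1)[OF w] unfolding W1_def embed_zero d by auto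
        have "E *\<^sub>v w = 0\<^sub>v n" by (rule embed_inject[OF _ zero_carrier_vec e0]) (use E w in simp)
        then show "E *\<^sub>v w = 0\<^sub>m n n *\<^sub>v w" using w by (intro eq_vecI) auto
      qed
      with ** show False by simp
    qed
    have ne2: "W2 \<noteq> {0\<^sub>v d}"
    proof
      assume eq: "W2 = {0\<^sub>v d}"
      have "E = 1\<^sub>m n"
      proof (rule mat_eqI_vec[OF E one_carrier_mat])
        fix w :: "'a vec" assume w: "w \<in> carrier_vec n"
        have e0: "block_embed a c (w - E *\<^sub>v w) = block_embed a c (0\<^sub>v n)" using eq Ew(2)[OF w] unfolding W2_def embed_zero d by auto
        have "w - E *\<^sub>v w = 0\<^sub>v n" by (rule embed_inject[OF _ zero_carrier_vec e0]) (use E w in simp)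
        then have "(w - E *\<^sub>v w) $ i = 0" if "i < n" for i using that by simp
        then have i: "w $ i = (E *\<^sub>v w) $ i" if "i < n" for i using that E w by simp
        have "E *\<^sub>v w = w" by (rule eq_vecI) (use E w in \<open>simp_all only: i carrier_vecD dim_mult_mat_vec carrier_matD\<close>)
        then show "E *\<^sub>v w = 1\<^sub>m n *\<^sub>v w" using w by simp
      qed
      with ** show False by simp
    qed
    have pair: "list_all2 (\<in>) vs [W1, W2] \<longleftrightarrow> (\<exists>x\<in>I1. \<exists>y\<in>I2. vs = [block_embed a c x, block_embed a c y])" for vs
      unfolding W1_def W2_def by (auto simp: list_all2_Cons2)
    have sum: "foldr (+) [block_embed a c x, block_embed a c y] (0\<^sub>v d) = block_embed a c (x + y)" if "x \<in> I1" "y \<in> I2" for x y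
    proof -
      have c: "x \<in> carrier_vec n" "y \<in> carrier_vec n" using that I by auto
      then have "block_embed a c y + 0\<^sub>v d = block_embed a c y" using embed_carrier[of y n a c] d by simp
      then show ?thesis using embed_add[OF c] by simp
    qed
    have "orth_decomp d \<Phi> ?V [W1, W2]"
      unfolding orth_decomp_def
    proof (intro conjI)
      show "\<forall>V\<in>set [W1, W2]. VectorSpace.subspace class_ring V (module_vec TYPE('a) d) \<and> V \<noteq> {0\<^sub>v d} \<and> V \<subseteq> ?V"
        using sub1 sub2 ne1 ne2 I unfolding space W1_def[symmetric] by (auto simp: W1_def W2_def)
      have orth: "bimap \<Phi> u v = 0\<^sub>v 2 \<and> bimap \<Phi> v u = 0\<^sub>v 2" if uv: "u \<in> W1" "v \<in> W2" for u v
      proof -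
        obtain x y where xy: "x \<in> I1" "y \<in> I2" "u = block_embed a c x" "v = block_embed a c y"
          using uv unfolding W1_def W2_def by blast
        then have "x \<in> carrier_vec n" "y \<in> carrier_vec n" using I by auto
        then show ?thesis
          unfolding bimap_eq_zero_iff xy(3,4) using adj[OF cB(1) _ xy(1,2)] adj[OF cB(2) _ xy(1,2)] *
          by (simp add: form1 form2)
      qed
      show "\<forall>i<length [W1, W2]. \<forall>j<length [W1, W2]. i \<noteq> j \<longrightarrow>
          (\<forall>u\<in>[W1, W2] ! i. \<forall>v\<in>[W1, W2] ! j. bimap \<Phi> u v = 0\<^sub>v 2)"
        using orth by (auto simp: less_Suc_eq)
      show "\<forall>vs. list_all2 (\<in>) vs [W1, W2] \<longrightarrow> foldr (+) vs (0\<^sub>v d) \<in> ?V"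
        unfolding pair space using sum I by fastforce
      show "\<forall>u\<in>?V. \<exists>!vs. list_all2 (\<in>) vs [W1, W2] \<and> foldr (+) vs (0\<^sub>v d) = u"
      proof
        fix u assume "u \<in> ?V"
        then obtain w where w: "w \<in> carrier_vec n" "u = block_embed a c w" unfolding space by auto
        show "\<exists>!vs. list_all2 (\<in>) vs [W1, W2] \<and> foldr (+) vs (0\<^sub>v d) = u"
        proof (rule ex1I[of _ "[block_embed a c (E *\<^sub>v w), block_embed a c (w - E *\<^sub>v w)]"])
          have "E *\<^sub>v w + (w - E *\<^sub>v w) = w" using w E by (intro eq_vecI) auto
          then show "list_all2 (\<in>) [block_embed a c (E *\<^sub>v w), block_embed a c (w - E *\<^sub>v w)] [W1, W2] \<and>
              foldr (+) [block_embed a c (E *\<^sub>v w), block_embed a c (w - E *\<^sub>v w)] (0\<^sub>v d) = u"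
            unfolding pair sum[OF Ew[OF w(1)]] w(2) using Ew[OF w(1)] by auto
          fix vs assume vs: "list_all2 (\<in>) vs [W1, W2] \<and> foldr (+) vs (0\<^sub>v d) = u"
          then obtain x y where xy: "x \<in> I1" "y \<in> I2" "vs = [block_embed a c x, block_embed a c y]" unfolding pair by blast
          have c: "x \<in> carrier_vec n" "y \<in> carrier_vec n" using xy I by auto
          have e0: "block_embed a c (x + y) = block_embed a c w" using vs sum[OF xy(1,2)] unfolding xy(3) w(2) by simp
          have s: "x + y = w" by (rule embed_inject[OF _ w(1) e0]) (use c in simp)
          have "E *\<^sub>v w = E *\<^sub>v x + E *\<^sub>v y" unfolding s[symmetric] using E c by (rule mult_add_distrib_mat_vec)
          also have "\<dots> = x" using xy c by (simp add: I1_def I2_def)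
          finally have x: "E *\<^sub>v w = x" .
          have "w - x = y" unfolding s[symmetric] using c by (intro eq_vecI) auto
          then show "vs = [block_embed a c (E *\<^sub>v w), block_embed a c (w - E *\<^sub>v w)]" unfolding x xy(3) by simp
        qed
      qed
    qed
    then show False using ind by (metis length_Cons le_refl list.size(3) numeral_2_eq_2)
  qed
  moreover have "dim_row (fst B) = n" using cB by simp
  ultimately show ?thesis using n B(2) by (simp add: sloped_summand_def)
qed

section \<open>Orthogonal sums\<close>

definition diag_pair :: "('a :: zero mat \<times> 'a mat) list \<Rightarrow> 'a mat \<times> 'a mat" where
  "diag_pair Bs = (diag_block_mat (map fst Bs), diag_block_mat (map snd Bs))"

definition square_pair :: "nat \<Rightarrow> 'a mat \<times> 'a mat \<Rightarrow> bool" where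
  "square_pair n B \<longleftrightarrow> fst B \<in> carrier_mat n n \<and> snd B \<in> carrier_mat n n"

definition block_sum :: "nat \<Rightarrow> nat \<Rightarrow> 'a :: zero mat \<Rightarrow> 'a mat \<Rightarrow> 'a mat" where
  "block_sum n m A B = four_block_mat A (0\<^sub>m n m) (0\<^sub>m m n) B"

definition pair_sum :: "nat \<Rightarrow> nat \<Rightarrow> 'a :: zero mat \<times> 'a mat \<Rightarrow> 'a mat \<times> 'a mat \<Rightarrow> 'a mat \<times> 'a mat" where
  "pair_sum n m B C = (block_sum n m (fst B) (fst C), block_sum n m (snd B) (snd C))"

lemma block_sum_carrier:
  "A \<in> carrier_mat n n \<Longrightarrow> B \<in> carrier_mat m m \<Longrightarrow> block_sum n m A B \<in> carrier_mat (n + m) (n + m)"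
  by (simp add: block_sum_def)

lemma block_sum_mult:
  fixes A :: "'a :: comm_ring_1 mat"
  assumes "A \<in> carrier_mat n n" "A' \<in> carrier_mat n n" "B \<in> carrier_mat m m" "B' \<in> carrier_mat m m"
  shows "block_sum n m A B * block_sum n m A' B' = block_sum n m (A * A') (B * B')"
  unfolding block_sum_def using assms by (subst mult_four_block_mat[of _ n n _ m _ m _ _ n _ m]) auto

lemma transpose_block_sum:
  "A \<in> carrier_mat n n \<Longrightarrow> B \<in> carrier_mat m m \<Longrightarrow>
   transpose_mat (block_sum n m A B) = block_sum n m (transpose_mat A) (transpose_mat B)"
  unfolding block_sum_def by (subst transpose_four_block_mat[of _ n n _ m _ m]) auto

lemma block_sum_one: "block_sum n m (1\<^sub>m n) (1\<^sub>m m) = 1\<^sub>m (n + m)"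
  unfolding block_sum_def by (rule eq_matI) auto

lemma congruentI:
  fixes N :: "'a :: field mat"
  assumes "N \<in> carrier_mat n n" "invertible_mat N"
    and "fst B = transpose_mat N * fst B' * N" "snd B = transpose_mat N * snd B' * N"
  shows "congruent n B B'"
  using assms unfolding congruent_def by blast

lemma congruent_refl: "square_pair n B \<Longrightarrow> congruent n B B"
  using invertible_matI[of "1\<^sub>m n" n "1\<^sub>m n"]
  by (intro congruentI[of "1\<^sub>m n"]) (auto simp: square_pair_def)

lemma congruent_trans:
  assumes "congruent n A B" "congruent n B C" and C: "square_pair n C"
  shows "congruent n A C"
proof -
  obtain N where N: "N \<in> carrier_mat n n" "invertible_mat N"
    "fst A = transpose_mat N * fst B * N" "snd A = transpose_mat N * snd B * N"
    using assms(1) unfolding congruent_def by blast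
  obtain M where M: "M \<in> carrier_mat n n" "invertible_mat M"
    "fst B = transpose_mat M * fst C * M" "snd B = transpose_mat M * snd C * M"
    using assms(2) unfolding congruent_def by blast
  have *: "transpose_mat N * (transpose_mat M * X * M) * N = transpose_mat (M * N) * X * (M * N)"
    if "X \<in> carrier_mat n n" for X
    using N(1) M(1) that
    by (simp add: transpose_mult[of _ n n _ n] assoc_mult_mat[of _ n n _ n _ n] mult_carrier_mat[of _ n n _ n])
  show ?thesis
  proof (rule congruentI)
    show "M * N \<in> carrier_mat n n" using M N by simp
    show "invertible_mat (M * N)" by (rule invertible_mat_mult[OF M(1) N(1) M(2) N(2)])
  qed (use * C in \<open>simp_all add: N(3,4) M(3,4) square_pair_def\<close>)
qed

lemma congruent_pair_sum:
  fixes B :: "'a :: field mat \<times> 'a mat"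
  assumes "congruent n B B'" "congruent m C C'" and sq: "square_pair n B'" "square_pair m C'"
  shows "congruent (n + m) (pair_sum n m B C) (pair_sum n m B' C')"
proof -
  obtain N where N: "N \<in> carrier_mat n n" "invertible_mat N"
    "fst B = transpose_mat N * fst B' * N" "snd B = transpose_mat N * snd B' * N"
    using assms(1) unfolding congruent_def by blast
  obtain M where M: "M \<in> carrier_mat m m" "invertible_mat M"
    "fst C = transpose_mat M * fst C' * M" "snd C = transpose_mat M * snd C' * M"
    using assms(2) unfolding congruent_def by blast
  have *: "transpose_mat (block_sum n m N M) * block_sum n m X Y * block_sum n m N M
      = block_sum n m (transpose_mat N * X * N) (transpose_mat M * Y * M)"
    if "X \<in> carrier_mat n n" "Y \<in> carrier_mat m m" for X Y
    using N(1) M(1) that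
    by (simp add: transpose_block_sum block_sum_mult mult_carrier_mat[of _ n n _ n] mult_carrier_mat[of _ m m _ m])
  obtain N' where N': "N' \<in> carrier_mat n n" "N * N' = 1\<^sub>m n" by (rule invertible_matE[OF N(1,2)])
  obtain M' where M': "M' \<in> carrier_mat m m" "M * M' = 1\<^sub>m m" by (rule invertible_matE[OF M(1,2)])
  show ?thesis
  proof (rule congruentI)
    show c: "block_sum n m N M \<in> carrier_mat (n + m) (n + m)" by (rule block_sum_carrier[OF N(1) M(1)])
    have "block_sum n m N M * block_sum n m N' M' = 1\<^sub>m (n + m)"
      unfolding block_sum_mult[OF N(1) N'(1) M(1) M'(1)] N'(2) M'(2) by (rule block_sum_one)
    then show "invertible_mat (block_sum n m N M)"
      by (rule invertible_mat_right_inverseI[OF c block_sum_carrier[OF N'(1) M'(1)]])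
  qed (use * sq in \<open>simp_all add: pair_sum_def N(3,4) M(3,4) square_pair_def\<close>)
qed

lemma congruent_pair_sum_swap:
  fixes B :: "'a :: field mat \<times> 'a mat"
  assumes sq: "square_pair n B" "square_pair m C"
  shows "congruent (n + m) (pair_sum n m B C) (pair_sum m n C B)"
proof (rule congruentI)
  define N :: "'a mat" where "N = four_block_mat (0\<^sub>m m n) (1\<^sub>m m) (1\<^sub>m n) (0\<^sub>m n m)"
  have tN: "transpose_mat N = four_block_mat (0\<^sub>m n m) (1\<^sub>m n) (1\<^sub>m m) (0\<^sub>m m n)"
    unfolding N_def by (subst transpose_four_block_mat[of _ m n _ m _ n]) auto
  have N': "N \<in> carrier_mat (m + n) (n + m)" by (simp add: N_def)
  then show N: "N \<in> carrier_mat (n + m) (n + m)" by (simp add: add.commute)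
  have "transpose_mat N * N = 1\<^sub>m (n + m)"
    unfolding tN unfolding N_def by (subst mult_four_block_mat[of _ n m _ n _ m _ _ n _ m]) (auto intro!: eq_matI)
  then show "invertible_mat N"
    using invertible_matI[of N "n + m" "transpose_mat N"] mat_mult_left_right_inverse[of "transpose_mat N" "n + m" N] N by simp
  have *: "transpose_mat N * block_sum m n Y X * N = block_sum n m X Y"
    if "X \<in> carrier_mat n n" "Y \<in> carrier_mat m m" for X Y
  proof -
    have "block_sum m n Y X * N = four_block_mat (0\<^sub>m m n) Y X (0\<^sub>m n m)"
      unfolding block_sum_def N_def using that
      by (subst mult_four_block_mat[of _ m m _ n _ n _ _ n _ m]) (auto intro!: cong_four_block_mat)
    then have "transpose_mat N * (block_sum m n Y X * N) = block_sum n m X Y"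
      unfolding tN block_sum_def using that
      by (simp, subst mult_four_block_mat[of _ n m _ n _ m _ _ n _ m]) (auto intro!: cong_four_block_mat)
    moreover have "transpose_mat N * block_sum m n Y X * N = transpose_mat N * (block_sum m n Y X * N)"
      using N' block_sum_carrier[OF that(2,1)] by (intro assoc_mult_mat[of _ "n + m" "m + n" _ "m + n" _ "n + m"]) auto
    ultimately show ?thesis by simp
  qed
  show "fst (pair_sum n m B C) = transpose_mat N * fst (pair_sum m n C B) * N"
    "snd (pair_sum n m B C) = transpose_mat N * snd (pair_sum m n C B) * N"
    using * sq by (simp_all add: pair_sum_def square_pair_def)
qed

lemma diag_pair_Nil: "diag_pair [] = (0\<^sub>m 0 0, 0\<^sub>m 0 0)"
  by (simp add: diag_pair_def)

lemma square_diag_pair: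
  assumes "\<And>B. B \<in> set Bs \<Longrightarrow> square_pair (k B) B"
  shows "square_pair (\<Sum>B\<leftarrow>Bs. k B) (diag_pair Bs)"
  using assms diag_block_mat_carrier[of Bs fst k] diag_block_mat_carrier[of Bs snd k]
  unfolding square_pair_def diag_pair_def by simp

lemma diag_pair_append:
  assumes "square_pair n (diag_pair Bs)" "square_pair m (diag_pair Cs)"
  shows "diag_pair (Bs @ Cs) = pair_sum n m (diag_pair Bs) (diag_pair Cs)"
proof -
  have *: "diag_block_mat (As @ As') = block_sum n m (diag_block_mat As) (diag_block_mat As')"
    if "diag_block_mat As \<in> carrier_mat n n" "diag_block_mat As' \<in> carrier_mat m m" for As As' :: "'a mat list"
    unfolding diag_block_mat_append Let_def block_sum_def carrier_matD[OF that(1)] carrier_matD[OF that(2)] ..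
  show ?thesis
    using assms unfolding diag_pair_def square_pair_def pair_sum_def by (simp add: *)
qed

lemma diag_pair_singleton: "diag_pair [B] = B"
  by (simp only: diag_pair_def list.map diag_block_mat_singleton prod.collapse)

lemma diag_pair_Cons:
  assumes "square_pair n B" "square_pair m (diag_pair Bs)"
  shows "diag_pair (B # Bs) = pair_sum n m B (diag_pair Bs)"
  using diag_pair_append[of n "[B]" m Bs] assms by (simp add: diag_pair_singleton)

lemma congruent_diag_pair:
  fixes Bs :: "('a :: field mat \<times> 'a mat) list"
  assumes "list_all2 (\<lambda>B C. square_pair (k B) B \<and> square_pair (k B) C \<and> congruent (k B) B C) Bs Cs"
  shows "square_pair (\<Sum>B\<leftarrow>Bs. k B) (diag_pair Bs) \<and> square_pair (\<Sum>B\<leftarrow>Bs. k B) (diag_pair Cs) \<and>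
    congruent (\<Sum>B\<leftarrow>Bs. k B) (diag_pair Bs) (diag_pair Cs)"
  using assms
proof (induction rule: list_all2_induct)
  case Nil
  have "square_pair 0 (diag_pair [] :: 'a mat \<times> 'a mat)" by (simp add: diag_pair_Nil square_pair_def)
  then show ?case using congruent_refl by simp
next
  case (Cons B Bs C Cs)
  let ?n = "k B" and ?m = "\<Sum>B\<leftarrow>Bs. k B"
  have eq: "diag_pair (B # Bs) = pair_sum ?n ?m B (diag_pair Bs)" "diag_pair (C # Cs) = pair_sum ?n ?m C (diag_pair Cs)"
    using Cons by (auto intro!: diag_pair_Cons)
  have "square_pair (?n + ?m) (pair_sum ?n ?m B (diag_pair Bs))" "square_pair (?n + ?m) (pair_sum ?n ?m C (diag_pair Cs))"
    using Cons by (auto simp: square_pair_def pair_sum_def block_sum_carrier)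
  moreover have "congruent (?n + ?m) (pair_sum ?n ?m B (diag_pair Bs)) (pair_sum ?n ?m C (diag_pair Cs))"
    using Cons by (intro congruent_pair_sum) auto
  ultimately show ?case unfolding eq by simp
qed

text \<open>The head \<open>B\<close> is located in the other list as \<open>Us @ B # Vs\<close> and
  moved to the front by one swap with the whole sum over \<open>Us\<close>; the remainder is handled
  by induction.\<close>

lemma congruent_diag_pair_mset:
  fixes Bs :: "('a :: field mat \<times> 'a mat) list"
  assumes "mset Bs = mset Cs" and "\<And>B. B \<in> set Bs \<Longrightarrow> square_pair (k B) B"
  shows "congruent (\<Sum>B\<leftarrow>Bs. k B) (diag_pair Bs) (diag_pair Cs)"
  using assms
proof (induction Bs arbitrary: Cs)
  case Nil
  then have "Cs = []" by simp
  have "square_pair 0 (diag_pair [] :: 'a mat \<times> 'a mat)" by (simp add: diag_pair_Nil square_pair_def)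
  then show ?case using congruent_refl \<open>Cs = []\<close> by simp
next
  case (Cons B Bs)
  have "B \<in> set Cs" using Cons.prems(1) by (metis list.set_intros(1) mset_eq_setD)
  then obtain Us Vs where Cs: "Cs = Us @ B # Vs" by (meson split_list)
  have ms: "mset Bs = mset (Us @ Vs)" using Cons.prems(1) unfolding Cs by simp
  have set: "set Bs = set Us \<union> set Vs" using mset_eq_setD[OF ms] by simp
  have sqB: "square_pair (k B) B" by (rule Cons.prems(2)) simp
  let ?n = "k B" and ?u = "\<Sum>B\<leftarrow>Us. k B" and ?v = "\<Sum>B\<leftarrow>Vs. k B" and ?m = "\<Sum>B\<leftarrow>Bs. k B"
  have m: "?m = ?u + ?v"
    using arg_cong[OF ms, of "\<lambda>M. sum_mset (image_mset k M)"] by (simp flip: sum_mset_sum_list mset_map)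
  have U: "square_pair ?u (diag_pair Us)" and V: "square_pair ?v (diag_pair Vs)" and Bs: "square_pair ?m (diag_pair Bs)"
    using Cons.prems(2) set by (auto intro!: square_diag_pair)
  have UV: "square_pair ?m (diag_pair (Us @ Vs))"
    using square_diag_pair[of "Us @ Vs" k] Cons.prems(2) set m by auto
  have BU: "square_pair (?n + ?u) (diag_pair (B # Us))" and UB: "square_pair (?u + ?n) (diag_pair (Us @ [B]))"
    using square_diag_pair[of "B # Us" k] square_diag_pair[of "Us @ [B]" k] Cons.prems(2) set by auto
  have 1: "congruent (?n + ?m) (diag_pair (B # Bs)) (diag_pair (B # Us @ Vs))"
    unfolding diag_pair_Cons[OF sqB Bs] diag_pair_Cons[OF sqB UV]
    using Cons.IH[OF ms] Cons.prems(2) congruent_refl[OF sqB] sqB UV by (intro congruent_pair_sum) auto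
  have "congruent (?n + ?u) (diag_pair (B # Us)) (diag_pair (Us @ [B]))"
    unfolding diag_pair_Cons[OF sqB U] diag_pair_append[of ?u Us ?n "[B]", unfolded diag_pair_singleton, OF U sqB]
    by (rule congruent_pair_sum_swap[OF sqB U])
  then have "congruent (?n + ?u + ?v) (pair_sum (?n + ?u) ?v (diag_pair (B # Us)) (diag_pair Vs))
      (pair_sum (?n + ?u) ?v (diag_pair (Us @ [B])) (diag_pair Vs))"
    using V UB congruent_refl[OF V] by (intro congruent_pair_sum) (auto simp: add.commute)
  moreover have "pair_sum (?n + ?u) ?v (diag_pair (B # Us)) (diag_pair Vs) = diag_pair (B # Us @ Vs)"
    using diag_pair_append[OF BU V] by simp
  moreover have "pair_sum (?n + ?u) ?v (diag_pair (Us @ [B])) (diag_pair Vs) = diag_pair Cs"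
    using diag_pair_append[OF UB V] unfolding Cs by (simp add: add.commute)
  ultimately have 2: "congruent (?n + ?m) (diag_pair (B # Us @ Vs)) (diag_pair Cs)"
    unfolding m by (simp add: add.assoc)
  have "square_pair (?n + ?m) (diag_pair Cs)"
    using square_diag_pair[of Cs k] Cons.prems(2) set m unfolding Cs by (simp add: ac_simps)
  from congruent_trans[OF 1 2 this] show ?case by simp
qed

lemma map_mat_diag_block_mat:
  assumes "f 0 = 0"
  shows "map_mat f (diag_block_mat As) = diag_block_mat (map (map_mat f) As)"
proof (induction As)
  case (Cons A As)
  show ?case unfolding list.map diag_block_mat.simps Let_def Cons[symmetric]
    using assms by (intro eq_matI) auto
qed (auto intro!: eq_matI)

lemma linear_diag_block_mat:
  fixes f g :: "'b \<Rightarrow> 'a :: comm_ring_1 mat"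
  assumes "\<And>B. B \<in> set Bs \<Longrightarrow> f B \<in> carrier_mat (k B) (k B) \<and> g B \<in> carrier_mat (k B) (k B)"
  shows "a \<cdot>\<^sub>m diag_block_mat (map f Bs) + b \<cdot>\<^sub>m diag_block_mat (map g Bs)
    = diag_block_mat (map (\<lambda>B. a \<cdot>\<^sub>m f B + b \<cdot>\<^sub>m g B) Bs)"
  using assms
proof (induction Bs)
  case (Cons B Bs)
  have 1: "f B \<in> carrier_mat (k B) (k B)" "g B \<in> carrier_mat (k B) (k B)" using Cons.prems by auto
  have 2: "diag_block_mat (map f Bs) \<in> carrier_mat (\<Sum>B\<leftarrow>Bs. k B) (\<Sum>B\<leftarrow>Bs. k B)"
    "diag_block_mat (map g Bs) \<in> carrier_mat (\<Sum>B\<leftarrow>Bs. k B) (\<Sum>B\<leftarrow>Bs. k B)"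
    using Cons.prems by (auto intro!: diag_block_mat_carrier)
  have IH: "diag_block_mat (map (\<lambda>B. a \<cdot>\<^sub>m f B + b \<cdot>\<^sub>m g B) Bs)
      = a \<cdot>\<^sub>m diag_block_mat (map f Bs) + b \<cdot>\<^sub>m diag_block_mat (map g Bs)"
    using Cons by simp
  show ?case unfolding list.map diag_block_mat.simps Let_def IH
    using 1 2 by (intro eq_matI) auto
qed (auto intro!: eq_matI)

lemma pencil_diag_pair:
  fixes Bs :: "('a :: field mat \<times> 'a mat) list"
  assumes "\<And>B. B \<in> set Bs \<Longrightarrow> square_pair (k B) B"
  shows "pencil (diag_pair Bs) = diag_block_mat (map pencil Bs)"
proof -
  have "pencil (diag_pair Bs) = var_x \<cdot>\<^sub>m diag_block_mat (map (\<lambda>B. map_mat const_xy (fst B)) Bs)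
      + var_y \<cdot>\<^sub>m diag_block_mat (map (\<lambda>B. map_mat const_xy (snd B)) Bs)"
    unfolding pencil_def diag_pair_def fst_conv snd_conv by (simp add: map_mat_diag_block_mat comp_def)
  also have "\<dots> = diag_block_mat (map pencil Bs)"
    unfolding pencil_def using assms by (intro linear_diag_block_mat[of _ _ k]) (auto simp: square_pair_def)
  finally show ?thesis .
qed

lemma twist_diag_pair:
  assumes h: "h \<in> GammaL2" and Bs: "\<And>B. B \<in> set Bs \<Longrightarrow> square_pair (k B) B"
  shows "twist h (diag_pair Bs) = diag_pair (map (twist h) Bs)"
proof -
  interpret field_isom "snd h" by (rule snd_GammaL2[OF h])
  have "a \<cdot>\<^sub>m map_mat (snd h) (diag_block_mat (map fst Bs)) + b \<cdot>\<^sub>m map_mat (snd h) (diag_block_mat (map snd Bs))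
      = diag_block_mat (map (\<lambda>B. a \<cdot>\<^sub>m map_mat (snd h) (fst B) + b \<cdot>\<^sub>m map_mat (snd h) (snd B)) Bs)" for a b
    unfolding map_mat_diag_block_mat[of "snd h", OF hom_zero] map_map comp_def
    using Bs by (intro linear_diag_block_mat[of _ _ k]) (auto simp: square_pair_def)
  then show ?thesis
    unfolding twist_def change_basis_def diag_pair_def by (simp add: comp_def)
qed

section \<open>Uniqueness of the summands\<close>

lemma sloped_summand_square_pair: "sloped_summand n B \<Longrightarrow> square_pair n B"
  using sloped_summand_carrier[of n B] by (simp add: square_pair_def)

lemma loc_diag_diag_pair:
  fixes Bs :: "('a :: field mat \<times> 'a mat) list"
  assumes p: "prime_elem p" and Bs: "\<And>B. B \<in> set Bs \<Longrightarrow> sloped_summand (k B) B"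
  obtains ds where "loc_diag p (pencil (diag_pair Bs)) ds"
    "\<forall>e>0. length (filter (\<lambda>d. p ^ e dvd d) ds) = 2 * length (filter (\<lambda>B. p ^ e dvd Pf B) Bs)"
proof -
  have "\<exists>dss. list_all2 (loc_diag p) (map pencil Bs) dss \<and>
      (\<forall>e>0. length (filter (\<lambda>d. p ^ e dvd d) (concat dss)) = 2 * length (filter (\<lambda>B. p ^ e dvd Pf B) Bs))"
    using Bs
  proof (induction Bs)
    case (Cons B Bs)
    obtain dss where dss: "list_all2 (loc_diag p) (map pencil Bs) dss"
      "\<forall>e>0. length (filter (\<lambda>d. p ^ e dvd d) (concat dss)) = 2 * length (filter (\<lambda>B. p ^ e dvd Pf B) Bs)"
      using Cons by auto
    have "sloped_summand (k B) B" using Cons.prems by simp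
    then obtain ds where "loc_diag p (pencil B) ds"
      "\<forall>e>0. length (filter (\<lambda>d. p ^ e dvd d) ds) = (if p ^ e dvd Pf B then 2 else 0)"
      using loc_diag_sloped_summand[OF _ p] by blast
    with dss show ?case by (intro exI[of _ "ds # dss"]) auto
  qed simp
  then obtain dss where dss: "list_all2 (loc_diag p) (map pencil Bs) dss"
    "\<forall>e>0. length (filter (\<lambda>d. p ^ e dvd d) (concat dss)) = 2 * length (filter (\<lambda>B. p ^ e dvd Pf B) Bs)"
    by blast
  have "pencil (diag_pair Bs) = diag_block_mat (map pencil Bs)"
    by (rule pencil_diag_pair[of _ k]) (rule sloped_summand_square_pair[OF Bs])
  then have "loc_diag p (pencil (diag_pair Bs)) (concat dss)"
    using loc_diag_diag_block_mat[OF p dss(1)] by simp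
  with dss(2) show thesis by (intro that[of "concat dss"]) auto
qed

text \<open>A congruence acts on the pencil by constant matrices with nonzero constant determinants,
  which are prime to every \<open>p\<close>. So both families of summands diagonalise the same
  pencil, and the doubled counts agree.\<close>

lemma congruent_imp_count_eq:
  fixes Bs Cs :: "('a :: field mat \<times> 'a mat) list"
  assumes cong: "congruent d (diag_pair Bs) (diag_pair Cs)" and sq: "square_pair d (diag_pair Bs)" "square_pair d (diag_pair Cs)"
    and Bs: "\<And>B. B \<in> set Bs \<Longrightarrow> sloped_summand (k B) B" and Cs: "\<And>C. C \<in> set Cs \<Longrightarrow> sloped_summand (k C) C"
    and p: "prime_elem p" and e: "e > 0"
  shows "length (filter (\<lambda>B. p ^ e dvd Pf B) Bs) = length (filter (\<lambda>C. p ^ e dvd Pf C) Cs)"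
proof -
  obtain N where N: "N \<in> carrier_mat d d" "invertible_mat N"
    "fst (diag_pair Bs) = transpose_mat N * fst (diag_pair Cs) * N"
    "snd (diag_pair Bs) = transpose_mat N * snd (diag_pair Cs) * N"
    using cong unfolding congruent_def by blast
  obtain ds where ds: "loc_diag p (pencil (diag_pair Bs)) ds"
    "\<forall>e>0. length (filter (\<lambda>d. p ^ e dvd d) ds) = 2 * length (filter (\<lambda>B. p ^ e dvd Pf B) Bs)"
    by (rule loc_diag_diag_pair[OF p Bs])
  obtain ds' where ds': "loc_diag p (pencil (diag_pair Cs)) ds'"
    "\<forall>e>0. length (filter (\<lambda>d. p ^ e dvd d) ds') = 2 * length (filter (\<lambda>B. p ^ e dvd Pf B) Cs)"
    by (rule loc_diag_diag_pair[OF p Cs])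
  have c: "pencil (diag_pair Bs) \<in> carrier_mat d d" "pencil (diag_pair Cs) \<in> carrier_mat d d"
    using pencil_carrier[of "fst (diag_pair Bs)" d d "snd (diag_pair Bs)"]
      pencil_carrier[of "fst (diag_pair Cs)" d d "snd (diag_pair Cs)"] sq unfolding square_pair_def by auto
  have len: "length ds = d" using ds(1) c unfolding loc_diag_def by auto
  have tN: "transpose_mat N \<in> carrier_mat d d" "invertible_mat (transpose_mat N)"
    using N invertible_mat_transpose by auto
  have "pencil (diag_pair Bs) = map_mat const_xy (transpose_mat N) * pencil (diag_pair Cs) * map_mat const_xy N"
    using pencil_congruence[OF tN(1) N(1), of "fst (diag_pair Cs)" "snd (diag_pair Cs)"] sq(2) N(3,4)
    unfolding square_pair_def by (metis prod.collapse)
  then have "loc_diag p (pencil (diag_pair Cs)) ds"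
    using loc_diag_mult[OF p ds(1) len _ _ c(2) prime_not_dvd_det_const[OF p tN] prime_not_dvd_det_const[OF p N(1,2)]] N(1)
    by simp
  from loc_diag_count_eq[OF p e this ds'(1)] show ?thesis using ds(2) ds'(2) e by simp
qed

text \<open>The Pfaffian is a prime power \<open>q ^ j\<close> up to a scalar. Divisibility by
  \<open>p ^ e\<close> with positive \<open>e\<close> makes \<open>p\<close> and \<open>q\<close>
  associates, and failure at the next power fixes \<open>e = j\<close>.\<close>

lemma equiv_units_primary_iff:
  assumes B: "sloped_summand n B" and p: "prime_elem p" and e: "e > 0"
  shows "equiv_units (p ^ e) (Pf B) \<longleftrightarrow> p ^ e dvd Pf B \<and> \<not> p ^ Suc e dvd Pf B"
proof -
  have power: "p ^ i dvd p ^ j \<longleftrightarrow> i \<le> j" for i j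
  proof
    assume *: "p ^ i dvd p ^ j"
    show "i \<le> j"
    proof (rule ccontr)
      assume "\<not> i \<le> j"
      then have "p ^ Suc j dvd p ^ j" using * by (meson dvd_trans le_imp_power_dvd not_less_eq_eq)
      then obtain c where "p ^ j = p ^ Suc j * c" by (rule dvdE)
      then have "p ^ j * 1 = p ^ j * (p * c)" by (simp add: ac_simps)
      then have "1 = p * c" using p unfolding mult_cancel_left by (simp add: prime_elem_def)
      then show False using prime_elem_not_unit[OF p] by (metis dvd_triv_left)
    qed
  qed (rule le_imp_power_dvd)
  obtain q j where q: "prime_elem q" "j > 0" "equiv_units (Pf B) (q ^ j)" by (rule sloped_summand_Pf_primary[OF B])
  have Pf: "x dvd Pf B \<longleftrightarrow> x dvd q ^ j" for x
    using q(3) unfolding equiv_units_iff_dvd by (meson dvd_trans)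
  show ?thesis
  proof
    assume *: "equiv_units (p ^ e) (Pf B)"
    then have "\<not> p ^ Suc e dvd Pf B" using power[of "Suc e" e] unfolding equiv_units_iff_dvd by (meson Suc_n_not_le_n dvd_trans)
    with * show "p ^ e dvd Pf B \<and> \<not> p ^ Suc e dvd Pf B" unfolding equiv_units_iff_dvd by blast
  next
    assume *: "p ^ e dvd Pf B \<and> \<not> p ^ Suc e dvd Pf B"
    have "p dvd q ^ j" using * e unfolding Pf by (meson dvd_power dvd_trans)
    then have pq: "p dvd q" using prime_elem_dvd_power[OF p] by blast
    then have "q dvd p"
      using irreducibleD'[OF prime_elem_imp_irreducible[OF q(1)] pq] prime_elem_not_unit[OF p] by blast
    then have qp: "q ^ j dvd p ^ j" "p ^ j dvd q ^ j" using pq by (auto intro: dvd_power_same)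
    have "e \<le> j" using * qp unfolding Pf power[symmetric] by (meson dvd_trans)
    moreover have "\<not> Suc e \<le> j" using * qp unfolding Pf power[symmetric] by (meson dvd_trans)
    ultimately have "e = j" by simp
    then show "equiv_units (p ^ e) (Pf B)" unfolding equiv_units_iff_dvd Pf using qp q(3)
      unfolding equiv_units_iff_dvd by (meson dvd_trans)
  qed
qed

lemma length_filter_diff:
  assumes "\<And>x. x \<in> set xs \<Longrightarrow> Q x \<Longrightarrow> P x"
  shows "length (filter (\<lambda>x. P x \<and> \<not> Q x) xs) + length (filter Q xs) = length (filter P xs)"
  using assms by (induction xs) auto

text \<open>Each Pfaffian class is that of some \<open>p ^ e\<close>, and its multiplicity is the
  number of summands divisible by \<open>p ^ e\<close> minus the number divisible by
  \<open>p ^ Suc e\<close>. Both numbers are congruence invariants, so the multisets of classes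
  agree.\<close>

lemma congruent_imp_matching:
  fixes Bs Cs :: "('a :: field mat \<times> 'a mat) list"
  assumes cong: "congruent d (diag_pair Bs) (diag_pair Cs)" and sq: "square_pair d (diag_pair Bs)" "square_pair d (diag_pair Cs)"
    and Bs: "\<And>B. B \<in> set Bs \<Longrightarrow> sloped_summand (k B) B" and Cs: "\<And>C. C \<in> set Cs \<Longrightarrow> sloped_summand (k C) C"
  shows "length Bs = length Cs \<and> (\<exists>\<sigma>. \<sigma> permutes {..<length Bs} \<and>
    (\<forall>i<length Bs. equiv_units (Pf (Bs ! i)) (Pf (Cs ! \<sigma> i))))"
proof -
  \<comment> \<open>Replacing a Pfaffian by its whole class turns proportionality into equality, so
    that equality of multisets yields a permutation.\<close>
  define cl where "cl = (\<lambda>B :: 'a mat \<times> 'a mat. {f. equiv_units (Pf B) f})"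
  have cl: "cl B = cl C \<longleftrightarrow> equiv_units (Pf B) (Pf C)" for B C :: "'a mat \<times> 'a mat"
    unfolding cl_def using equiv_units_refl equiv_units_sym equiv_units_trans by blast
  have count: "length (filter (\<lambda>B. cl B = cl B0) Bs) = length (filter (\<lambda>C. cl C = cl B0) Cs)"
    if B0: "sloped_summand n B0" for n B0
  proof -
    obtain p e where p: "prime_elem p" "e > 0" "equiv_units (Pf B0) (p ^ e)" by (rule sloped_summand_Pf_primary[OF B0])
    have iff: "cl B = cl B0 \<longleftrightarrow> p ^ e dvd Pf B \<and> \<not> p ^ Suc e dvd Pf B" if "sloped_summand (k B) B" for B
      unfolding cl equiv_units_primary_iff[OF that p(1,2), symmetric]
      using p(3) equiv_units_sym equiv_units_trans by blast
    have eq: "filter (\<lambda>B. cl B = cl B0) Bs = filter (\<lambda>B. p ^ e dvd Pf B \<and> \<not> p ^ Suc e dvd Pf B) Bs"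
      "filter (\<lambda>B. cl B = cl B0) Cs = filter (\<lambda>B. p ^ e dvd Pf B \<and> \<not> p ^ Suc e dvd Pf B) Cs"
      by (rule filter_cong[OF refl iff[OF Bs]], assumption, rule filter_cong[OF refl iff[OF Cs]])
    have mono: "p ^ Suc e dvd x \<Longrightarrow> p ^ e dvd x" for x by (meson dvd_trans le_imp_power_dvd le_Suc_eq order_refl)
    have "length (filter (\<lambda>B. p ^ e dvd Pf B \<and> \<not> p ^ Suc e dvd Pf B) Bs) + length (filter (\<lambda>B. p ^ Suc e dvd Pf B) Bs)
        = length (filter (\<lambda>B. p ^ e dvd Pf B \<and> \<not> p ^ Suc e dvd Pf B) Cs) + length (filter (\<lambda>B. p ^ Suc e dvd Pf B) Cs)"
      using length_filter_diff[of Bs "\<lambda>B. p ^ Suc e dvd Pf B" "\<lambda>B. p ^ e dvd Pf B", OF mono]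
        length_filter_diff[of Cs "\<lambda>B. p ^ Suc e dvd Pf B" "\<lambda>B. p ^ e dvd Pf B", OF mono]
        congruent_imp_count_eq[OF cong sq Bs Cs p(1,2)] by simp
    moreover have "length (filter (\<lambda>B. p ^ Suc e dvd Pf B) Bs) = length (filter (\<lambda>B. p ^ Suc e dvd Pf B) Cs)"
      by (rule congruent_imp_count_eq[OF cong sq Bs Cs p(1)]) simp_all
    ultimately show ?thesis unfolding eq by linarith
  qed
  have "mset (map cl Bs) = mset (map cl Cs)"
  proof (rule multiset_eqI)
    fix X
    have c: "count (mset (map cl Ds)) X = length (filter (\<lambda>B. cl B = X) Ds)" for Ds
      by (induction Ds) auto
    show "count (mset (map cl Bs)) X = count (mset (map cl Cs)) X"
    proof (cases "\<exists>B\<in>set Bs \<union> set Cs. cl B = X")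
      case True
      then obtain B0 where "sloped_summand (k B0) B0" "cl B0 = X" using Bs Cs by blast
      then show ?thesis using count[of _ B0] unfolding c by metis
    next
      case False
      then have "filter (\<lambda>B. cl B = X) Bs = []" "filter (\<lambda>B. cl B = X) Cs = []"
        by (auto simp: filter_empty_conv)
      then show ?thesis unfolding c by simp
    qed
  qed
  then obtain \<sigma> where \<sigma>: "\<sigma> permutes {..<length (map cl Cs)}" "permute_list \<sigma> (map cl Cs) = map cl Bs"
    by (rule mset_eq_permutation)
  have len: "length Bs = length Cs" using arg_cong[OF \<sigma>(2), of length] by simp
  have "equiv_units (Pf (Bs ! i)) (Pf (Cs ! \<sigma> i))" if "i < length Bs" for i
  proof -
    have "map cl Bs ! i = map cl Cs ! \<sigma> i"
      unfolding \<sigma>(2)[symmetric] using \<sigma>(1) that len by (intro permute_list_nth) auto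
    moreover have "\<sigma> i < length Cs" using \<sigma>(1) that len permutes_in_image[OF \<sigma>(1), of i] by simp
    ultimately show ?thesis using that cl by simp
  qed
  with \<sigma>(1) len show ?thesis by auto
qed

section \<open>Pseudo-isometries\<close>

lemma map_vec_unit:
  assumes "f 0 = 0" "f 1 = 1"
  shows "map_vec f (unit_vec n i) = unit_vec n i"
  using assms by (intro eq_vecI) (auto simp: unit_vec_def)

lemma index_act_vec:
  assumes "fst h \<in> carrier_mat 2 2"
  shows "act_vec h (vec_of_list [a, b]) $ 0 = fst h $$ (0, 0) * snd h a + fst h $$ (1, 0) * snd h b"
    and "act_vec h (vec_of_list [a, b]) $ 1 = fst h $$ (0, 1) * snd h a + fst h $$ (1, 1) * snd h b"
  using assms by (auto simp: act_vec_def scalar_prod_def numeral_2_eq_2)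

lemma smult_vec_of_list:
  "k \<cdot>\<^sub>v vec_of_list [a, b] = vec_of_list [k * a, k * b :: 'a :: semiring_0]"
  by (rule eq_vecI) (auto simp: less_Suc_eq)

lemma dim_act_vec: "fst h \<in> carrier_mat 2 2 \<Longrightarrow> dim_vec (act_vec h w) = 2"
  by (simp add: act_vec_def)

context
  fixes h :: "'a :: field mat \<times> ('a \<Rightarrow> 'a)"
  assumes h: "h \<in> GammaL2"
begin

interpretation \<tau>: field_isom "snd h" by (rule snd_GammaL2[OF h])

lemma twist_form:
  assumes \<Phi>: "fst \<Phi> \<in> carrier_mat d d" "snd \<Phi> \<in> carrier_mat d d"
    and uv: "u \<in> carrier_vec d" "v \<in> carrier_vec d"
  shows "bimap (twist h \<Phi>) (map_vec (snd h) u) (map_vec (snd h) v) = act_vec h (bimap \<Phi> u v)"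
proof -
  have cM: "fst h \<in> carrier_mat 2 2" by (rule fst_GammaL2[OF h])
  let ?\<tau> = "map_vec (snd h)"
  have c: "?\<tau> u \<in> carrier_vec d" "?\<tau> v \<in> carrier_vec d" using uv by auto
  have form: "?\<tau> u \<bullet> (map_mat (snd h) A *\<^sub>v ?\<tau> v) = snd h (u \<bullet> (A *\<^sub>v v))" if "A \<in> carrier_mat d d" for A
  proof -
    have "map_mat (snd h) A *\<^sub>v ?\<tau> v = ?\<tau> (A *\<^sub>v v)"
      using \<tau>.mult_mat_vec_hom[OF that uv(2)] by simp
    moreover have "?\<tau> u \<bullet> ?\<tau> w = snd h (u \<bullet> w)" if "w \<in> carrier_vec d" for w
      unfolding scalar_prod_def \<tau>.hom_sum using uv that by (intro sum.cong) (auto simp: \<tau>.hom_mult)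
    ultimately show ?thesis using that uv by simp
  qed
  have lin: "x \<bullet> ((a \<cdot>\<^sub>m A + b \<cdot>\<^sub>m B) *\<^sub>v y) = a * (x \<bullet> (A *\<^sub>v y)) + b * (x \<bullet> (B *\<^sub>v y))"
    if "A \<in> carrier_mat d d" "B \<in> carrier_mat d d" "x \<in> carrier_vec d" "y \<in> carrier_vec d" for a b A B and x y :: "'a vec"
  proof -
    have "(a \<cdot>\<^sub>m A + b \<cdot>\<^sub>m B) *\<^sub>v y = a \<cdot>\<^sub>v (A *\<^sub>v y) + b \<cdot>\<^sub>v (B *\<^sub>v y)"
      using that by (intro eq_vecI) (auto simp: add_scalar_prod_distrib[of _ d])
    then show ?thesis using that by (simp add: scalar_prod_add_distrib[of _ d] mult_mat_vec_carrier[of _ d d])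
  qed
  have "bimap (twist h \<Phi>) (?\<tau> u) (?\<tau> v) = vec_of_list
      [fst h $$ (0,0) * snd h (u \<bullet> (fst \<Phi> *\<^sub>v v)) + fst h $$ (1,0) * snd h (u \<bullet> (snd \<Phi> *\<^sub>v v)),
       fst h $$ (0,1) * snd h (u \<bullet> (fst \<Phi> *\<^sub>v v)) + fst h $$ (1,1) * snd h (u \<bullet> (snd \<Phi> *\<^sub>v v))]"
    unfolding bimap_def twist_def change_basis_def fst_conv snd_conv
    using \<Phi> c by (simp add: lin form)
  also have "\<dots> = act_vec h (bimap \<Phi> u v)"
    unfolding bimap_def
    by (rule eq_vecI) (use index_act_vec[OF cM] dim_act_vec[OF cM] in \<open>auto simp: less_Suc_eq numeral_2_eq_2\<close>)
  finally show ?thesis .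
qed

lemma congruent_imp_pseudo_isometry:
  assumes \<Phi>: "fst \<Phi> \<in> carrier_mat d d" "snd \<Phi> \<in> carrier_mat d d"
    and \<Lambda>: "fst \<Lambda> \<in> carrier_mat d d" "snd \<Lambda> \<in> carrier_mat d d"
    and cong: "congruent d (twist h \<Phi>) \<Lambda>"
  shows "\<exists>\<alpha>. pseudo_isometry d \<Phi> d \<Lambda> \<alpha> h"
proof -
  obtain N where N: "N \<in> carrier_mat d d" "invertible_mat N"
    "fst (twist h \<Phi>) = transpose_mat N * fst \<Lambda> * N" "snd (twist h \<Phi>) = transpose_mat N * snd \<Lambda> * N"
    using cong unfolding congruent_def by blast
  obtain R where R: "R \<in> carrier_mat d d" "N * R = 1\<^sub>m d" "R * N = 1\<^sub>m d" by (rule invertible_matE[OF N(1,2)])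
  let ?\<tau> = "map_vec (snd h)"
  define \<alpha> where "\<alpha> = (\<lambda>u. N *\<^sub>v ?\<tau> u)"
  define \<sigma> where "\<sigma> = inv_into UNIV (snd h)"
  have \<sigma>: "snd h (\<sigma> x) = x" "\<sigma> (snd h x) = x" for x
    unfolding \<sigma>_def using \<tau>.surj \<tau>.inj_f by (simp_all add: surj_f_inv_f inv_f_f)
  have bij: "bij_betw \<alpha> (carrier_vec d) (carrier_vec d)"
  proof (rule bij_betw_byWitness[where f' = "\<lambda>w. map_vec \<sigma> (R *\<^sub>v w)"])
    show "\<forall>u\<in>carrier_vec d. map_vec \<sigma> (R *\<^sub>v \<alpha> u) = u"
    proof
      fix u :: "'a vec" assume u: "u \<in> carrier_vec d"
      have "R *\<^sub>v \<alpha> u = ?\<tau> u"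
        unfolding \<alpha>_def using assoc_mult_mat_vec[OF R(1) N(1), of "?\<tau> u"] R(3) u by simp
      then show "map_vec \<sigma> (R *\<^sub>v \<alpha> u) = u" using u by (intro eq_vecI) (auto simp: \<sigma>)
    qed
    show "\<forall>w\<in>carrier_vec d. \<alpha> (map_vec \<sigma> (R *\<^sub>v w)) = w"
    proof
      fix w :: "'a vec" assume w: "w \<in> carrier_vec d"
      have "?\<tau> (map_vec \<sigma> (R *\<^sub>v w)) = R *\<^sub>v w" by (intro eq_vecI) (auto simp: \<sigma>)
      then show "\<alpha> (map_vec \<sigma> (R *\<^sub>v w)) = w"
        unfolding \<alpha>_def using assoc_mult_mat_vec[OF N(1) R(1) w] R(2) w by simp
    qed
  qed (use N(1) R(1) in \<open>auto simp: \<alpha>_def\<close>)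
  have add: "\<alpha> (u + v) = \<alpha> u + \<alpha> v" if "u \<in> carrier_vec d" "v \<in> carrier_vec d" for u v
  proof -
    have "?\<tau> (u + v) = ?\<tau> u + ?\<tau> v" using that by (intro eq_vecI) (auto simp: \<tau>.hom_add)
    then show ?thesis unfolding \<alpha>_def using that N(1) by (simp add: mult_add_distrib_mat_vec[of _ d d])
  qed
  have smult: "\<alpha> (c \<cdot>\<^sub>v u) = snd h c \<cdot>\<^sub>v \<alpha> u" if "u \<in> carrier_vec d" for c u
  proof -
    have "?\<tau> (c \<cdot>\<^sub>v u) = snd h c \<cdot>\<^sub>v ?\<tau> u" by (intro eq_vecI) (auto simp: \<tau>.hom_mult)
    then show ?thesis unfolding \<alpha>_def using that N(1) by (simp add: mult_mat_vec[of _ d d])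
  qed
  have form: "(N *\<^sub>v x) \<bullet> (A *\<^sub>v (N *\<^sub>v y)) = x \<bullet> (transpose_mat N * A * N *\<^sub>v y)"
    if "A \<in> carrier_mat d d" "x \<in> carrier_vec d" "y \<in> carrier_vec d" for A x y
  proof -
    have "transpose_mat N * A * N *\<^sub>v y = transpose_mat N *\<^sub>v (A *\<^sub>v (N *\<^sub>v y))"
      using N(1) that by (simp add: assoc_mult_mat_vec[of _ d d _ d])
    then show ?thesis using mat_adjoint[of "transpose_mat N" d d x "A *\<^sub>v (N *\<^sub>v y)"] N(1) that by simp
  qed
  have "bimap \<Lambda> (\<alpha> u) (\<alpha> v) = act_vec h (bimap \<Phi> u v)" if "u \<in> carrier_vec d" "v \<in> carrier_vec d" for u v
  proof -
    have "bimap \<Lambda> (\<alpha> u) (\<alpha> v) = bimap (twist h \<Phi>) (?\<tau> u) (?\<tau> v)"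
      unfolding bimap_def \<alpha>_def N(3,4) using that \<Lambda> by (simp add: form)
    then show ?thesis using twist_form[OF \<Phi> that] by simp
  qed
  then have "pseudo_isometry d \<Phi> d \<Lambda> \<alpha> h"
    unfolding pseudo_isometry_def semilinear_bij_def
    using bij add smult h snd_GammaL2[OF h] by blast
  then show ?thesis by blast
qed

lemma semilinear_matrix:
  fixes \<alpha> :: "'a vec \<Rightarrow> 'a vec"
  assumes cod: "\<And>u. u \<in> carrier_vec d \<Longrightarrow> \<alpha> u \<in> carrier_vec e"
    and add: "\<And>u v. u \<in> carrier_vec d \<Longrightarrow> v \<in> carrier_vec d \<Longrightarrow> \<alpha> (u + v) = \<alpha> u + \<alpha> v"
    and smult: "\<And>c u. u \<in> carrier_vec d \<Longrightarrow> \<alpha> (c \<cdot>\<^sub>v u) = snd h c \<cdot>\<^sub>v \<alpha> u"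
  obtains N where "N \<in> carrier_mat e d" "\<And>u. u \<in> carrier_vec d \<Longrightarrow> \<alpha> u = N *\<^sub>v map_vec (snd h) u"
proof -
  define N where "N = mat e d (\<lambda>(a, i). \<alpha> (unit_vec d i) $ a)"
  have N: "N \<in> carrier_mat e d" by (simp add: N_def)
  have zero: "\<alpha> (0\<^sub>v d) = 0\<^sub>v e"
  proof -
    have "0 \<cdot>\<^sub>v 0\<^sub>v d = (0\<^sub>v d :: 'a vec)" by (intro eq_vecI) auto
    moreover have "0 \<cdot>\<^sub>v \<alpha> (0\<^sub>v d) = 0\<^sub>v e" using cod[of "0\<^sub>v d"] by (intro eq_vecI) auto
    ultimately show ?thesis using smult[of "0\<^sub>v d" 0] by simp
  qed
  have col: "\<alpha> (unit_vec d i) = N *\<^sub>v unit_vec d i" if "i < d" for i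
  proof (rule eq_vecI)
    fix a assume "a < dim_vec (N *\<^sub>v unit_vec d i)"
    then have a: "a < e" using N by simp
    then have "(N *\<^sub>v unit_vec d i) $ a = N $$ (a, i)" using that N by simp
    then show "\<alpha> (unit_vec d i) $ a = (N *\<^sub>v unit_vec d i) $ a" using a that by (simp add: N_def)
  qed (use N cod[of "unit_vec d i"] in auto)
  have "\<alpha> u = N *\<^sub>v map_vec (snd h) u" if u: "u \<in> carrier_vec d" for u
  proof -
    \<comment> \<open>Truncations of \<open>u\<close> to its first \<open>k\<close> coordinates; the
      formula is propagated from \<open>t 0 = 0\<close> to \<open>t d = u\<close> one unit vector at
      a time.\<close>
    define t where "t = (\<lambda>k. vec d (\<lambda>i. if i < k then u $ i else 0))"
    have "k \<le> d \<Longrightarrow> \<alpha> (t k) = N *\<^sub>v map_vec (snd h) (t k)" for k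
    proof (induction k)
      case 0
      have t0: "t 0 = 0\<^sub>v d" by (auto simp: t_def)
      have "map_vec (snd h) (0\<^sub>v d) = 0\<^sub>v d" by (intro eq_vecI) auto
      then show ?case unfolding t0 using zero mult_mat_zero_vec[OF N] by (simp only:)
    next
      case (Suc k)
      have k: "k < d" using Suc by simp
      have t: "t k \<in> carrier_vec d" by (simp add: t_def)
      have eq: "t (Suc k) = t k + u $ k \<cdot>\<^sub>v unit_vec d k"
        using k u by (intro eq_vecI) (auto simp: t_def less_Suc_eq)
      have "map_vec (snd h) (t (Suc k)) = map_vec (snd h) (t k) + snd h (u $ k) \<cdot>\<^sub>v unit_vec d k"
        using k u by (intro eq_vecI) (auto simp: t_def less_Suc_eq)
      then have "N *\<^sub>v map_vec (snd h) (t (Suc k)) = N *\<^sub>v map_vec (snd h) (t k) + snd h (u $ k) \<cdot>\<^sub>v (N *\<^sub>v unit_vec d k)"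
        using N t by (simp add: mult_add_distrib_mat_vec[of _ e d] mult_mat_vec[of _ e d])
      also have "\<dots> = \<alpha> (t k) + \<alpha> (u $ k \<cdot>\<^sub>v unit_vec d k)"
        using Suc smult[of "unit_vec d k" "u $ k"] col[OF k] by simp
      also have "\<dots> = \<alpha> (t (Suc k))" unfolding eq using t by (intro add[symmetric]) auto
      finally show ?case by simp
    qed
    moreover have "t d = u" unfolding t_def using u by (intro eq_vecI) auto
    ultimately show ?thesis by force
  qed
  with N show thesis by (rule that)
qed

text \<open>The map \<alpha> is semilinear for some automorphism \<rho>. Scaling one argument of a
  nonvanishing value of the bimap by \<open>c\<close> shows that \<rho> agrees with the automorphism
  of \<open>h\<close>. Then \<alpha> is that automorphism followed by a matrix \<open>N\<close>, and
  \<open>N\<close> provides the congruence.\<close>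

lemma pseudo_isometry_imp_congruent:
  assumes \<Phi>: "fst \<Phi> \<in> carrier_mat d d" "snd \<Phi> \<in> carrier_mat d d"
    and \<Lambda>: "fst \<Lambda> \<in> carrier_mat e e" "snd \<Lambda> \<in> carrier_mat e e"
    and nz: "d > 0 \<Longrightarrow> \<exists>u\<in>carrier_vec d. \<exists>v\<in>carrier_vec d. bimap \<Phi> u v \<noteq> 0\<^sub>v 2"
    and iso: "pseudo_isometry d \<Phi> e \<Lambda> \<alpha> h"
  shows "d = e \<and> congruent d (twist h \<Phi>) \<Lambda>"
proof -
  have bij: "bij_betw \<alpha> (carrier_vec d) (carrier_vec e)"
    and add: "\<And>u v. u \<in> carrier_vec d \<Longrightarrow> v \<in> carrier_vec d \<Longrightarrow> \<alpha> (u + v) = \<alpha> u + \<alpha> v"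
    and form: "\<And>u v. u \<in> carrier_vec d \<Longrightarrow> v \<in> carrier_vec d \<Longrightarrow> bimap \<Lambda> (\<alpha> u) (\<alpha> v) = act_vec h (bimap \<Phi> u v)"
    using iso by (auto simp: pseudo_isometry_def semilinear_bij_def)
  obtain \<rho> where \<rho>: "field_isom \<rho>" "\<And>c u. u \<in> carrier_vec d \<Longrightarrow> \<alpha> (c \<cdot>\<^sub>v u) = \<rho> c \<cdot>\<^sub>v \<alpha> u"
    using iso by (auto simp: pseudo_isometry_def semilinear_bij_def)
  have cod: "\<alpha> u \<in> carrier_vec e" if "u \<in> carrier_vec d" for u using bij that by (auto simp: bij_betw_def)
  have cM: "fst h \<in> carrier_mat 2 2" "invertible_mat (fst h)" by (rule fst_GammaL2[OF h])+
  have bimap_eq: "bimap B u v = vec_of_list [u \<bullet> (fst B *\<^sub>v v), u \<bullet> (snd B *\<^sub>v v)]" for B :: "'a mat \<times> 'a mat" and u v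
    by (simp add: bimap_def)
  have smult: "\<alpha> (c \<cdot>\<^sub>v u) = snd h c \<cdot>\<^sub>v \<alpha> u" if "u \<in> carrier_vec d" for c u
  proof (cases "d = 0")
    case True
    interpret \<rho>: field_isom \<rho> by (rule \<rho>(1))
    \<comment> \<open>In dimension zero there is no value of the bimap to compare; scalars act
      trivially on the source, and \<alpha> sends its only vector to zero.\<close>
    have 0: "c \<cdot>\<^sub>v u = u" "0 \<cdot>\<^sub>v u = u" using that True by (auto intro!: eq_vecI)
    have "\<alpha> u = 0 \<cdot>\<^sub>v \<alpha> u" using \<rho>(2)[OF that, of 0] unfolding 0 \<rho>.hom_zero .
    then have "\<alpha> u $ i = 0 * \<alpha> u $ i" if "i < dim_vec (\<alpha> u)" for i using that by (metis index_smult_vec(1))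
    then show ?thesis unfolding 0 by (intro eq_vecI) auto
  next
    case False
    then obtain x y where xy: "x \<in> carrier_vec d" "y \<in> carrier_vec d" "bimap \<Phi> x y \<noteq> 0\<^sub>v 2" using nz by blast
    let ?p = "x \<bullet> (fst \<Phi> *\<^sub>v y)" and ?q = "x \<bullet> (snd \<Phi> *\<^sub>v y)"
    let ?w = "act_vec h (bimap \<Phi> x y)"
    have "\<rho> c = snd h c"
    proof -
      have c: "fst \<Phi> *\<^sub>v y \<in> carrier_vec d" "snd \<Phi> *\<^sub>v y \<in> carrier_vec d"
        "fst \<Lambda> *\<^sub>v \<alpha> y \<in> carrier_vec e" "snd \<Lambda> *\<^sub>v \<alpha> y \<in> carrier_vec e"
        using \<Phi> \<Lambda> xy cod[OF xy(2)] by auto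
      have \<Lambda>eq: "bimap \<Lambda> (\<alpha> (c \<cdot>\<^sub>v x)) (\<alpha> y) = \<rho> c \<cdot>\<^sub>v bimap \<Lambda> (\<alpha> x) (\<alpha> y)"
        unfolding \<rho>(2)[OF xy(1)] bimap_eq smult_vec_of_list
          smult_scalar_prod_distrib[OF cod[OF xy(1)] c(3)] smult_scalar_prod_distrib[OF cod[OF xy(1)] c(4)] ..
      have "bimap \<Phi> (c \<cdot>\<^sub>v x) y = vec_of_list [c * ?p, c * ?q]"
        unfolding bimap_eq smult_scalar_prod_distrib[OF xy(1) c(1)] smult_scalar_prod_distrib[OF xy(1) c(2)] ..
      moreover have "act_vec h (vec_of_list [c * ?p, c * ?q]) = snd h c \<cdot>\<^sub>v ?w"
        unfolding bimap_eq
        by (rule eq_vecI) (use dim_act_vec[OF cM(1)] index_act_vec[OF cM(1)] in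
            \<open>auto simp: less_Suc_eq numeral_2_eq_2 \<tau>.hom_mult algebra_simps\<close>)
      ultimately have "\<rho> c \<cdot>\<^sub>v ?w = snd h c \<cdot>\<^sub>v ?w"
        using \<Lambda>eq form[of "c \<cdot>\<^sub>v x" y] form[OF xy(1,2)] xy(1,2) by simp
      \<comment> \<open>The action of \<open>h\<close> on k^2 is injective, so a nonzero value of
        the bimap keeps a nonzero coordinate, by which the comparison of scalars can be
        cancelled.\<close>
      moreover have "?w \<noteq> 0\<^sub>v 2"
      proof
        assume w: "?w = 0\<^sub>v 2"
        let ?v = "map_vec (snd h) (bimap \<Phi> x y)"
        have v: "?v \<in> carrier_vec 2" by (intro carrier_vecI) (simp add: bimap_def)
        have tM: "transpose_mat (fst h) \<in> carrier_mat 2 2" "invertible_mat (transpose_mat (fst h))"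
          using cM invertible_mat_transpose by auto
        obtain K where K: "K \<in> carrier_mat 2 2" "K * transpose_mat (fst h) = 1\<^sub>m 2"
          using invertible_matE[OF tM] by blast
        have "?v = K *\<^sub>v (transpose_mat (fst h) *\<^sub>v ?v)"
          using assoc_mult_mat_vec[OF K(1) tM(1) v] K(2) v by simp
        also have "\<dots> = 0\<^sub>v 2" using w mult_mat_zero_vec[OF K(1)] unfolding act_vec_def by simp
        finally have v0: "?v = 0\<^sub>v 2" .
        have "bimap \<Phi> x y = 0\<^sub>v 2"
        proof (rule eq_vecI)
          fix i assume "i < dim_vec (0\<^sub>v 2 :: 'a vec)"
          then have i: "i < 2" by simp
          then have "snd h (bimap \<Phi> x y $ i) = 0"
            using arg_cong[OF v0, of "\<lambda>w. w $ i"] v by simp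
          then show "bimap \<Phi> x y $ i = 0\<^sub>v 2 $ i" using i by simp
        qed (use v in simp)
        with xy(3) show False by simp
      qed
      moreover have "?w \<in> carrier_vec 2" by (intro carrier_vecI dim_act_vec[OF cM(1)])
      ultimately obtain i where "i < 2" "?w $ i \<noteq> 0" "\<rho> c * ?w $ i = snd h c * ?w $ i"
        by (metis carrier_vecD eq_vecI index_smult_vec(1) index_zero_vec)
      then show ?thesis by simp
    qed
    then show ?thesis using \<rho>(2)[OF that] by simp
  qed
  obtain N where N: "N \<in> carrier_mat e d" and \<alpha>: "\<And>u. u \<in> carrier_vec d \<Longrightarrow> \<alpha> u = N *\<^sub>v map_vec (snd h) u"
    using semilinear_matrix[OF cod add smult] by blast
  have ex: "\<exists>w\<in>carrier_vec d. \<alpha> w = unit_vec e j" for j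
    using bij unfolding bij_betw_def by (metis image_iff unit_vec_carrier)
  then obtain w where w: "\<And>j. w j \<in> carrier_vec d" "\<And>j. \<alpha> (w j) = unit_vec e j" by metis
  \<comment> \<open>The columns are the images under the automorphism of preimages of the unit
    vectors. Surjectivity of \<alpha> thus gives a right inverse of \<open>N\<close>, and
    injectivity will give the other dimension bound.\<close>
  define R where "R = mat d e (\<lambda>(a, j). snd h (w j $ a))"
  have R: "R \<in> carrier_mat d e" by (simp add: R_def)
  have NR: "N * R = 1\<^sub>m e"
  proof (rule mat_col_eqI)
    fix j assume "j < dim_col (1\<^sub>m e :: 'a mat)"
    then have j: "j < e" by simp
    have "col R j = map_vec (snd h) (w j)" using j w(1)[of j] by (intro eq_vecI) (auto simp: R_def)
    then have "col (N * R) j = \<alpha> (w j)" using \<alpha>[OF w(1)] j col_mult2[OF N R j] by simp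
    then show "col (N * R) j = col (1\<^sub>m e) j" using w(2) j by simp
  qed (use N R in auto)
  have ed: "e \<le> d" by (rule right_inverse_dim_le[OF N R NR])
  have "d \<le> e"
  proof (rule ccontr)
    assume "\<not> d \<le> e"
    then obtain v where v: "v \<in> carrier_vec d" "v \<noteq> 0\<^sub>v d" "N *\<^sub>v v = 0\<^sub>v e" using wide_mat_kernel[OF N] by auto
    define u where "u = map_vec (inv_into UNIV (snd h)) v"
    have u: "u \<in> carrier_vec d" using v(1) by (simp add: u_def)
    have uv: "map_vec (snd h) u = v"
      using v(1) \<tau>.surj by (intro eq_vecI) (auto simp: u_def surj_f_inv_f)
    have z: "map_vec (snd h) (0\<^sub>v d) = 0\<^sub>v d" by (intro eq_vecI) auto
    have "\<alpha> u = \<alpha> (0\<^sub>v d)"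
      by (simp only: \<alpha>[OF u] \<alpha>[OF zero_carrier_vec] uv v(3) z mult_mat_zero_vec[OF N])
    then have "u = 0\<^sub>v d" using bij u unfolding bij_betw_def inj_on_def by auto
    then have "v = 0\<^sub>v d" using uv z by metis
    with v(2) show False by simp
  qed
  with ed have de: "d = e" by simp
  have N': "N \<in> carrier_mat d d" and R': "R \<in> carrier_mat d d" using N R de by auto
  have inv: "invertible_mat N" using invertible_mat_right_inverseI[OF N' R'] NR de by simp
  have tw: "fst (twist h \<Phi>) \<in> carrier_mat d d" "snd (twist h \<Phi>) \<in> carrier_mat d d"
    using twist_carrier[OF h \<Phi>] by auto
  have unit: "(N *\<^sub>v unit_vec d i) \<bullet> (X *\<^sub>v (N *\<^sub>v unit_vec d j)) = (transpose_mat N * X * N) $$ (i, j)"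
    if "X \<in> carrier_mat d d" "i < d" "j < d" for X i j
  proof -
    have "transpose_mat N * X * N *\<^sub>v unit_vec d j = transpose_mat N *\<^sub>v (X *\<^sub>v (N *\<^sub>v unit_vec d j))"
      using N' that by (simp add: assoc_mult_mat_vec[of _ d d _ d])
    moreover have "transpose_mat N * X * N \<in> carrier_mat d d" using N' that by simp
    ultimately show ?thesis
      using mat_adjoint[of "transpose_mat N" d d "unit_vec d i" "X *\<^sub>v (N *\<^sub>v unit_vec d j)"]
        bilinear_unit_vec[of "transpose_mat N * X * N" d d i j] N' that by simp
  qed
  have bim: "bimap \<Lambda> (N *\<^sub>v unit_vec d i) (N *\<^sub>v unit_vec d j) = bimap (twist h \<Phi>) (unit_vec d i) (unit_vec d j)" for i j
    using form[of "unit_vec d i" "unit_vec d j"] \<alpha>[of "unit_vec d i"] \<alpha>[of "unit_vec d j"]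
      twist_form[OF \<Phi>, of "unit_vec d i" "unit_vec d j"] map_vec_unit[of "snd h" d] by simp
  have ent: "(transpose_mat N * fst \<Lambda> * N) $$ (i, j) = fst (twist h \<Phi>) $$ (i, j)"
    "(transpose_mat N * snd \<Lambda> * N) $$ (i, j) = snd (twist h \<Phi>) $$ (i, j)" if "i < d" "j < d" for i j
  proof -
    have \<Lambda>': "fst \<Lambda> \<in> carrier_mat d d" "snd \<Lambda> \<in> carrier_mat d d" using \<Lambda> de by auto
    show "(transpose_mat N * fst \<Lambda> * N) $$ (i, j) = fst (twist h \<Phi>) $$ (i, j)"
      using arg_cong[OF bim[of i j], of "\<lambda>w. w $ 0"] unit[OF \<Lambda>'(1) that] bilinear_unit_vec[OF tw(1) that]
      unfolding bimap_def by simp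
    show "(transpose_mat N * snd \<Lambda> * N) $$ (i, j) = snd (twist h \<Phi>) $$ (i, j)"
      using arg_cong[OF bim[of i j], of "\<lambda>w. w $ 1"] unit[OF \<Lambda>'(2) that] bilinear_unit_vec[OF tw(2) that]
      unfolding bimap_def by simp
  qed
  have "congruent d (twist h \<Phi>) \<Lambda>"
  proof (rule congruentI[OF N' inv])
    show "fst (twist h \<Phi>) = transpose_mat N * fst \<Lambda> * N"
      by (rule eq_matI) (use ent(1) tw N' in auto)
    show "snd (twist h \<Phi>) = transpose_mat N * snd \<Lambda> * N"
      by (rule eq_matI) (use ent(2) tw N' in auto)
  qed
  with de show ?thesis by simp
qed

end

lemma sloped_summand_nonzero:
  assumes "sloped_summand n B"
  shows "\<not> (fst B = 0\<^sub>m n n \<and> snd B = 0\<^sub>m n n)"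
proof
  assume 0: "fst B = 0\<^sub>m n n \<and> snd B = 0\<^sub>m n n"
  obtain g where "invertible_mat (fst (change_basis g B))" using assms by (auto simp: sloped_summand_def sloped_def)
  moreover have "fst (change_basis g B) = 0\<^sub>m n n"
    unfolding change_basis_def using 0 by (auto intro!: eq_matI)
  ultimately show False
    using invertible_mat_iff_det[of "0\<^sub>m n n :: 'a mat" n] det_zero[of n] assms by (simp add: sloped_summand_def)
qed

text \<open>In positive dimension there is at least one block, and a sloped block of positive size
  is not the zero pair. This supplies the nonvanishing value that determines the automorphism of a
  pseudo-isometry.\<close>

lemma bimap_nonzero:
  fixes \<Phi> :: "'a :: field mat \<times> 'a mat"
  assumes alt: "alternating_pair d \<Phi>" and fr: "fully_refined_blocks d \<Phi> Bs" and sl: "\<forall>B\<in>set Bs. sloped B"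
    and d: "d > 0"
  shows "\<exists>u\<in>carrier_vec d. \<exists>v\<in>carrier_vec d. bimap \<Phi> u v \<noteq> 0\<^sub>v 2"
proof (rule ccontr)
  assume "\<not> ?thesis"
  then have 0: "u \<bullet> (fst \<Phi> *\<^sub>v v) = 0" "u \<bullet> (snd \<Phi> *\<^sub>v v) = 0" if "u \<in> carrier_vec d" "v \<in> carrier_vec d" for u v
    using that bimap_eq_zero_iff by blast+
  note \<Phi> = alternating_pair_carrier[OF alt]
  have "Bs \<noteq> []"
  proof
    assume "Bs = []"
    then have "fst \<Phi> = 0\<^sub>m 0 0" using fr by (simp add: fully_refined_blocks_def)
    with \<Phi> d show False by auto
  qed
  then have i: "0 < length Bs" by simp
  obtain a c n where B: "fst (Bs ! 0) \<in> carrier_mat n n" "snd (Bs ! 0) \<in> carrier_mat n n" and dd: "d = a + (n + c)"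
    and form: "\<forall>u\<in>carrier_vec n. \<forall>v\<in>carrier_vec n.
      block_embed a c u \<bullet> (fst \<Phi> *\<^sub>v block_embed a c v) = u \<bullet> (fst (Bs ! 0) *\<^sub>v v)"
      "\<forall>u\<in>carrier_vec n. \<forall>v\<in>carrier_vec n.
      block_embed a c u \<bullet> (snd \<Phi> *\<^sub>v block_embed a c v) = u \<bullet> (snd (Bs ! 0) *\<^sub>v v)"
    by (rule block_embedding[OF fr conjunct1[OF \<Phi>] i]) metis
  have "Bs ! 0 \<in> set Bs" using i by simp
  then have sloped_summand: "sloped_summand n (Bs ! 0)" using fully_refined_sloped_summand[OF alt fr] sl B(1) by (metis carrier_matD(1))
  have e: "block_embed a c u \<in> carrier_vec d" if "u \<in> carrier_vec n" for u :: "'a vec"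
    using embed_carrier[OF that] dd by simp
  have z: "X = 0\<^sub>m n n" if "X \<in> carrier_mat n n" "\<forall>u\<in>carrier_vec n. \<forall>v\<in>carrier_vec n. u \<bullet> (X *\<^sub>v v) = 0" for X :: "'a mat"
  proof (rule eq_matI)
    fix i j assume "i < dim_row (0\<^sub>m n n :: 'a mat)" "j < dim_col (0\<^sub>m n n :: 'a mat)"
    then show "X $$ (i, j) = 0\<^sub>m n n $$ (i, j)"
      using bilinear_unit_vec[OF that(1), of i j] that(2) by simp
  qed (use that in auto)
  have "fst (Bs ! 0) = 0\<^sub>m n n" by (rule z[OF B(1)]) (use form(1) 0(1) e in metis)
  moreover have "snd (Bs ! 0) = 0\<^sub>m n n" by (rule z[OF B(2)]) (use form(2) 0(2) e in metis)
  ultimately show False using sloped_summand_nonzero[OF sloped_summand] by simp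
qed

theorem theorem3p29:
  fixes \<Phi> \<Lambda> :: "'a :: field mat \<times> 'a mat"
    and \<Phi>s \<Lambda>s :: "('a mat \<times> 'a mat) list"
    and h :: "'a mat \<times> ('a \<Rightarrow> 'a)"
  assumes "alternating_pair d \<Phi>" and "alternating_pair e \<Lambda>"
    and "fully_refined_blocks d \<Phi> \<Phi>s" and "fully_refined_blocks e \<Lambda> \<Lambda>s"
    and "\<forall>B\<in>set \<Phi>s. sloped B" and "\<forall>B\<in>set \<Lambda>s. sloped B"
    and "h \<in> GammaL2"
  shows "(\<exists>\<alpha>. pseudo_isometry d \<Phi> e \<Lambda> \<alpha> h) \<longleftrightarrow>
         length \<Phi>s = length \<Lambda>s \<and>
         (\<exists>\<sigma>. \<sigma> permutes {..<length \<Phi>s} \<and>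
              (\<forall>i<length \<Phi>s. equiv_units (act_poly h (Pf (\<Phi>s ! i))) (Pf (\<Lambda>s ! \<sigma> i))))"
proof -
  note h = assms(7)
  define k where "k = (\<lambda>B :: 'a mat \<times> 'a mat. dim_row (fst B))"
  note c\<Phi> = alternating_pair_carrier[OF assms(1)] and c\<Lambda> = alternating_pair_carrier[OF assms(2)]
  have g\<Phi>: "sloped_summand (k B) B" if "B \<in> set \<Phi>s" for B
    unfolding k_def using fully_refined_sloped_summand[OF assms(1,3) that] assms(5) that by blast
  have g\<Lambda>: "sloped_summand (k B) B" if "B \<in> set \<Lambda>s" for B
    unfolding k_def using fully_refined_sloped_summand[OF assms(2,4) that] assms(6) that by blast
  have \<Phi>: "\<Phi> = diag_pair \<Phi>s" and \<Lambda>: "\<Lambda> = diag_pair \<Lambda>s"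
    using assms(3,4) by (auto simp: fully_refined_blocks_def diag_pair_def prod_eq_iff)
  \<comment> \<open>The twisted summands. Twisting respects the block decomposition and the Pfaffian
    classes, so the rest is a comparison of two pairs under congruence.\<close>
  define Ts where "Ts = map (twist h) \<Phi>s"
  have tw: "twist h \<Phi> = diag_pair Ts"
    unfolding \<Phi> Ts_def by (rule twist_diag_pair[OF h]) (rule sloped_summand_square_pair[OF g\<Phi>])
  have kT: "k (twist h B) = k B" if "B \<in> set \<Phi>s" for B
    using sloped_summand_carrier(1)[OF sloped_summand_twist[OF h g\<Phi>[OF that]]] by (simp add: k_def)
  have gT: "sloped_summand (k B) B" if "B \<in> set Ts" for B
    using that sloped_summand_twist[OF h g\<Phi>] kT unfolding Ts_def by auto
  have sT: "square_pair d (diag_pair Ts)"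
    using twist_carrier[OF h, of \<Phi> d d] c\<Phi> unfolding tw[symmetric] square_pair_def by simp
  have s\<Lambda>: "square_pair e (diag_pair \<Lambda>s)" using c\<Lambda> unfolding \<Lambda>[symmetric] square_pair_def by simp
  have PfT: "equiv_units (act_poly h (Pf (\<Phi>s ! i))) (Pf (Ts ! i))" if "i < length \<Phi>s" for i
    using Pf_twist[OF h g\<Phi>, of "\<Phi>s ! i"] that by (simp add: Ts_def)
  show ?thesis
  proof
    assume "\<exists>\<alpha>. pseudo_isometry d \<Phi> e \<Lambda> \<alpha> h"
    then obtain \<alpha> where "pseudo_isometry d \<Phi> e \<Lambda> \<alpha> h" by blast
    then have "d = e \<and> congruent d (twist h \<Phi>) \<Lambda>"
      using c\<Phi> c\<Lambda> by (intro pseudo_isometry_imp_congruent[OF h] bimap_nonzero[OF assms(1,3,5)]) auto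
    then have de: "d = e" and cong: "congruent d (diag_pair Ts) (diag_pair \<Lambda>s)"
      unfolding tw \<Lambda> by auto
    have "length Ts = length \<Lambda>s \<and> (\<exists>\<sigma>. \<sigma> permutes {..<length Ts} \<and>
        (\<forall>i<length Ts. equiv_units (Pf (Ts ! i)) (Pf (\<Lambda>s ! \<sigma> i))))"
      by (rule congruent_imp_matching[OF cong sT s\<Lambda>[folded de] gT g\<Lambda>])
    then show "length \<Phi>s = length \<Lambda>s \<and> (\<exists>\<sigma>. \<sigma> permutes {..<length \<Phi>s} \<and>
        (\<forall>i<length \<Phi>s. equiv_units (act_poly h (Pf (\<Phi>s ! i))) (Pf (\<Lambda>s ! \<sigma> i))))"
      using PfT equiv_units_trans unfolding Ts_def length_map by blast
  next
    assume *: "length \<Phi>s = length \<Lambda>s \<and> (\<exists>\<sigma>. \<sigma> permutes {..<length \<Phi>s} \<and>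
        (\<forall>i<length \<Phi>s. equiv_units (act_poly h (Pf (\<Phi>s ! i))) (Pf (\<Lambda>s ! \<sigma> i))))"
    then obtain \<sigma> where len: "length \<Phi>s = length \<Lambda>s" and \<sigma>: "\<sigma> permutes {..<length \<Lambda>s}"
      and eq: "\<And>i. i < length \<Phi>s \<Longrightarrow> equiv_units (act_poly h (Pf (\<Phi>s ! i))) (Pf (\<Lambda>s ! \<sigma> i))" by auto
    let ?Ls = "permute_list \<sigma> \<Lambda>s"
    have ms: "mset ?Ls = mset \<Lambda>s" by (rule mset_permute_list[OF \<sigma>])
    have step: "k (Ts ! i) = k (?Ls ! i) \<and> congruent (k (Ts ! i)) (Ts ! i) (?Ls ! i)" if "i < length Ts" for i
    proof -
      have i: "i < length \<Phi>s" "i < length \<Lambda>s" using that len by (auto simp: Ts_def)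
      have L: "?Ls ! i = \<Lambda>s ! \<sigma> i" by (rule permute_list_nth[OF \<sigma> i(2)])
      have "\<sigma> i < length \<Lambda>s" using permutes_in_image[OF \<sigma>, of i] i by simp
      then have "sloped_summand (k (?Ls ! i)) (?Ls ! i)" using g\<Lambda> L by simp
      moreover have "sloped_summand (k (Ts ! i)) (Ts ! i)" using gT that by simp
      moreover have "equiv_units (Pf (Ts ! i)) (Pf (?Ls ! i))"
        using PfT[OF i(1)] eq[OF i(1)] equiv_units_sym equiv_units_trans unfolding L by blast
      ultimately show ?thesis using sloped_summand_congruent_of_Pf by blast
    qed
    have gL: "sloped_summand (k B) B" if "B \<in> set ?Ls" for B
      using g\<Lambda> that mset_eq_setD[OF ms] by simp
    have "list_all2 (\<lambda>B C. square_pair (k B) B \<and> square_pair (k B) C \<and> congruent (k B) B C) Ts ?Ls"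
    proof (rule list_all2_all_nthI)
      show "length Ts = length ?Ls" using len by (simp add: Ts_def)
      fix i assume i: "i < length Ts"
      then have "Ts ! i \<in> set Ts" "?Ls ! i \<in> set ?Ls" using len by (auto simp: Ts_def simp del: set_permute_list)
      then show "square_pair (k (Ts ! i)) (Ts ! i) \<and> square_pair (k (Ts ! i)) (?Ls ! i) \<and>
          congruent (k (Ts ! i)) (Ts ! i) (?Ls ! i)"
        using sloped_summand_square_pair[OF gT] sloped_summand_square_pair[OF gL] step[OF i] by metis
    qed
    note 1 = congruent_diag_pair[OF this]
    \<comment> \<open>The equality \<open>d = e\<close> is not given in this direction; it is read
      off the sizes of the matched blocks.\<close>
    have kd: "(\<Sum>B\<leftarrow>Ts. k B) = d"
      using conjunct1[OF 1] sT unfolding square_pair_def by (metis carrier_matD(1))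
    have ksum: "(\<Sum>B\<leftarrow>?Ls. k B) = (\<Sum>B\<leftarrow>Ts. k B)"
      using step len by (intro arg_cong[of _ _ sum_list] nth_equalityI) (auto simp: Ts_def)
    have 2: "congruent d (diag_pair ?Ls) (diag_pair \<Lambda>s)"
      using congruent_diag_pair_mset[OF ms, of k] sloped_summand_square_pair[OF gL] ksum kd by simp
    have "square_pair (\<Sum>B\<leftarrow>\<Lambda>s. k B) (diag_pair \<Lambda>s)" by (rule square_diag_pair) (rule sloped_summand_square_pair[OF g\<Lambda>])
    moreover have "(\<Sum>B\<leftarrow>\<Lambda>s. k B) = (\<Sum>B\<leftarrow>?Ls. k B)"
      using arg_cong[OF ms, of "\<lambda>M. sum_mset (image_mset k M)"] by (simp flip: sum_mset_sum_list mset_map)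
    ultimately have de: "d = e" using s\<Lambda> ksum kd unfolding square_pair_def by (metis carrier_matD(1))
    have "congruent d (twist h \<Phi>) \<Lambda>"
      unfolding tw \<Lambda> using congruent_trans[OF _ 2] 1 kd s\<Lambda> de by auto
    then show "\<exists>\<alpha>. pseudo_isometry d \<Phi> e \<Lambda> \<alpha> h"
      using congruent_imp_pseudo_isometry[OF h, where \<Phi> = \<Phi> and \<Lambda> = \<Lambda> and d = d] c\<Phi> c\<Lambda> de by blast
  qed
qed

end
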